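(* Let $K$ be a field and let $D$ be a division $K$-algebra such that $D\otimes D$ is a Noetherian $D$-bimodule. Let $\Delta=\{\delta_1,\ldots,\delta_t\}$ be either a finite set of commuting $K$-derivations of $D$ or a finite set of commuting $K$-automorphisms of $D$. Then: 1. $D$ satisfies the ascending chain condition on division $K$-subalgebras, or equivalently, every division $K$-subalgebra of $D$ is a finitely generated division $K$-algebra. 2. The group of eigenvalues $\mathrm{Ev}(\Delta)$ is a finitely generated abelian group, and so $\mathrm{Ev}(\Delta)=\mathcal{T}\oplus\mathbb{Z}^r$, where $r$ is the rank of the group $\mathrm{Ev}(\Delta)$ and $\mathcal{T}$ is a finite abelian group. 3. The eigen-algebra $D(\Delta)$ is a Noetherian domain which is isomorphic to an iterated skew Laurent extension. In more detail, $D_{\mathcal{T}}:=\bigoplus_{\lambda\in\mathcal{T}}D_\lambda$ is a division algebra of right and left dimension $|\mathcal{T}|$ over the division algebra $D_0$, and $D(\Delta)$ is isomorphic to an iterated skew Laurent extension $D_{\mathcal{T}}[x_1,x_1^{-1};\sigma_1]\cdots[x_r,x_r^{-1};\sigma_r]$ with coefficients from the division algebra $D_{\mathcal{T}}$. 4. For each subgroup $F$ of $\mathrm{Ev}(\Delta)$, $\mathcal{F}(F):=\bigoplus_{\lambda\in F}D_\lambda$ is a Noetherian domain whose quotient division algebra $\mathrm{Frac}(\mathcal{F}(F))$ is $\Delta$-invariant and satisfies $\mathrm{Ev}(\mathrm{Frac}(\mathcal{F}(F)))=F$; any $\Delta$-eigenvector $v\in\mathrm{Frac}(\mathcal{F}(F))_\lambda$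 has the form $u^{-1}w$ for some $0\neq u\in D_\mu$, $w\in D_{\lambda+\mu}$, with $\lambda,\mu\in F$.
   Context: Notation: $\otimes=\otimes_K$; "Noetherian" for rings means left and right Noetherian. $D\otimes D$ is a $D$-bimodule via $a(x\otimes y)b=ax\otimes yb$; it is a Noetherian bimodule if it satisfies the ascending chain condition on sub-bimodules. A division $K$-algebra $E$ is a finitely generated division algebra if there are finitely many elements $x_1,\ldots,x_n\in E$ such that $E$ is the only division $K$-subalgebra of $E$ containing $x_1,\ldots,x_n$. Eigenvalues. In the derivation case put $$\mathrm{Ev}(\Delta):=\{\lambda=(\lambda_1,\ldots,\lambda_t)\in K^t \mid \delta_i(u)=\lambda_iu,\ i=1,\ldots,t,\ \text{for some } 0\ne u\in D\},$$ an additive subgroup of $K^t$. In the automorphism case put $$\mathrm{Ev}(\Delta):=\{\lambda\in (K^* )^t\mid \delta_i(u)=\lambda_iu,\ i=1,\ldots,t,\ \text{for some } 0\neq u\in D\},$$ a multiplicative subgroup of $(K^* )^t$, where $K^*=K\setminus\{0\}$. In the automorphism case the group operation is also written additively: $\lambda+\mu$ means the componentwise product $\lambda\mu$, and $0$ means $(1,\ldots,1)$. For $\lambda\in\mathrm{Ev}(\Delta)$, $D_\lambda:=\{u\in D\mid\delta_i(u)=\lambda_iu,\ i=1,\ldots,t\}$. In particular $D_0$ is the division subalgebra of $\Delta$-constants (elements killed by all $\delta_i$ in the derivation case, fixed by all $\delta_i$ in the automorphism case). The eigen-algebra is $D(\Delta):=\bigoplus_{\lambda\in\mathrm{Ev}(\Delta)}D_\lambda\subseteq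 D$. For a $\Delta$-invariant division subalgebra $E\subseteq D$, $\mathrm{Ev}(E)$ and $E_\lambda$ are defined in the same way with $E$ in place of $D$. For a Noetherian domain $A$, $\mathrm{Frac}(A)$ is its quotient division algebra; $\mathrm{Frac}(\mathcal{F}(F))$ is viewed inside $D$. The rank of an abelian group $G$ is $\dim_{\mathbb{Q}}(\mathbb{Q}\otimes_{\mathbb{Z}}G)$; $\mathcal{T}$ is the torsion subgroup of $\mathrm{Ev}(\Delta)$. For a ring $\Gamma$ and an automorphism $\sigma$ of $\Gamma$, the skew Laurent extension $\Gamma[x,x^{-1};\sigma]$ is generated by $\Gamma$ and $x^{\pm1}$ subject to $x^{\pm1}a=\sigma^{\pm1}(a)x^{\pm1}$ for $a\in\Gamma$ (free as a left $\Gamma$-module on the powers $x^i$, $i\in\mathbb{Z}$). An iterated skew Laurent extension $A_n=\Gamma[x_1,x_1^{-1};\sigma_1]\cdots[x_n,x_n^{-1};\sigma_n]$ is defined inductively by $A_n=A_{n-1}[x_n,x_n^{-1};\sigma_n]$ with $\sigma_n$ an automorphism of $A_{n-1}$, $A_0=\Gamma$. *)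

theory Defs
  imports "HOL-Algebra.Algebra" "HOL-Algebra.Algebraic_Closure_Type"
begin

section \<open>Division algebras over a field\<close>

locale division_algebra = vector_space scale
  for scale :: "'k::field \<Rightarrow> 'd::division_ring \<Rightarrow> 'd" +
  assumes scale_mult_left: "scale c (x * y) = scale c x * y"
    and scale_mult_right: "scale c (x * y) = x * scale c y"

definition division_subalgebra :: "('k::field \<Rightarrow> 'd::division_ring \<Rightarrow> 'd) \<Rightarrow> 'd set \<Rightarrow> bool" where
  "division_subalgebra scale E \<longleftrightarrow>
     module.subspace scale E \<and> 1 \<in> E \<and> (\<forall>x\<in>E. \<forall>y\<in>E. x * y \<in> E) \<and> (\<forall>x\<in>E. inverse x \<in> E)"

definition fin_gen_division_algebra :: "('k::field \<Rightarrow> 'd::division_ring \<Rightarrow> 'd) \<Rightarrow> 'd set \<Rightarrow> bool" where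
  "fin_gen_division_algebra scale E \<longleftrightarrow>
     (\<exists>Z. finite Z \<and> Z \<subseteq> E \<and>
        (\<forall>E'. division_subalgebra scale E' \<and> E' \<subseteq> E \<and> Z \<subseteq> E' \<longrightarrow> E' = E))"

text \<open>The ring structure that the ambient division ring induces on a subset.\<close>

abbreviation ring_on :: "'d::ring_1 set \<Rightarrow> 'd ring" where
  "ring_on S \<equiv> ring_of_type_algebra\<lparr>carrier := S\<rparr>"

text \<open>Left and right Ore fractions coincide in the situation of the theorem;
  \<open>is_quotient_division_algebra\<close> requires both forms.\<close>

definition Frac :: "'d::division_ring set \<Rightarrow> 'd set" where
  "Frac A = {inverse s * a | s a. s \<in> A \<and> s \<noteq> 0 \<and> a \<in> A}"

definition is_quotient_division_algebra ::
    "('k::field \<Rightarrow> 'd::division_ring \<Rightarrow> 'd) \<Rightarrow> 'd set \<Rightarrow> 'd set \<Rightarrow> bool" where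
  "is_quotient_division_algebra scale A Q \<longleftrightarrow>
     division_subalgebra scale Q \<and> A \<subseteq> Q \<and>
     Q = {inverse s * a | s a. s \<in> A \<and> s \<noteq> 0 \<and> a \<in> A} \<and>
     Q = {a * inverse s | s a. s \<in> A \<and> s \<noteq> 0 \<and> a \<in> A}"


section \<open>Chain conditions and Noetherian domains\<close>

definition acc :: "('a set \<Rightarrow> bool) \<Rightarrow> bool" where
  "acc P \<longleftrightarrow>
     (\<forall>C :: nat \<Rightarrow> 'a set. (\<forall>n. P (C n) \<and> C n \<subseteq> C (Suc n)) \<longrightarrow> (\<exists>N. \<forall>n\<ge>N. C n = C N))"

definition left_ideal :: "'a set \<Rightarrow> 'a ring \<Rightarrow> bool" where
  "left_ideal I R \<longleftrightarrow>
     additive_subgroup I R \<and> (\<forall>a\<in>carrier R. \<forall>x\<in>I. a \<otimes>\<^bsub>R\<^esub> x \<in> I)"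

definition right_ideal :: "'a set \<Rightarrow> 'a ring \<Rightarrow> bool" where
  "right_ideal I R \<longleftrightarrow>
     additive_subgroup I R \<and> (\<forall>a\<in>carrier R. \<forall>x\<in>I. x \<otimes>\<^bsub>R\<^esub> a \<in> I)"

text \<open>The library's \<open>domain\<close> and \<open>noetherian_domain\<close> are commutative.\<close>

definition nc_noetherian_domain :: "'a ring \<Rightarrow> bool" where
  "nc_noetherian_domain R \<longleftrightarrow>
     ring R \<and> \<one>\<^bsub>R\<^esub> \<noteq> \<zero>\<^bsub>R\<^esub> \<and>
     (\<forall>a\<in>carrier R. \<forall>b\<in>carrier R. a \<otimes>\<^bsub>R\<^esub> b = \<zero>\<^bsub>R\<^esub> \<longrightarrow> a = \<zero>\<^bsub>R\<^esub> \<or> b = \<zero>\<^bsub>R\<^esub>) \<and>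
     acc (\<lambda>I. left_ideal I R) \<and> acc (\<lambda>I. right_ideal I R)"


section \<open>Tensor products\<close>

text \<open>\<open>M\<close> and \<open>N\<close> are abelian groups, written multiplicatively as everywhere in HOL-Algebra, on
  which the commutative ring \<open>'c\<close> of scalars acts by \<open>sM\<close> and \<open>sN\<close>. Their tensor product
  is the free abelian group on \<open>M \<times> N\<close> modulo the bilinear relations.\<close>

definition tensor_relations ::
    "('a, 'm) monoid_scheme \<Rightarrow> ('b, 'n) monoid_scheme \<Rightarrow>
     ('c \<Rightarrow> 'a \<Rightarrow> 'a) \<Rightarrow> ('c \<Rightarrow> 'b \<Rightarrow> 'b) \<Rightarrow> (('a \<times> 'b) \<Rightarrow>\<^sub>0 int) set" where
  "tensor_relations M N sM sN =
     {frag_of (x \<otimes>\<^bsub>M\<^esub> x', y) - frag_of (x, y) - frag_of (x', y) | x x' y.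
        x \<in> carrier M \<and> x' \<in> carrier M \<and> y \<in> carrier N} \<union>
     {frag_of (x, y \<otimes>\<^bsub>N\<^esub> y') - frag_of (x, y) - frag_of (x, y') | x y y'.
        x \<in> carrier M \<and> y \<in> carrier N \<and> y' \<in> carrier N} \<union>
     {frag_of (sM c x, y) - frag_of (x, sN c y) | c x y. x \<in> carrier M \<and> y \<in> carrier N}"

abbreviation tensor_free ::
    "('a, 'm) monoid_scheme \<Rightarrow> ('b, 'n) monoid_scheme \<Rightarrow> (('a \<times> 'b) \<Rightarrow>\<^sub>0 int) monoid" where
  "tensor_free M N \<equiv> free_Abelian_group (carrier M \<times> carrier N)"

definition tensor_null ::
    "('a, 'm) monoid_scheme \<Rightarrow> ('b, 'n) monoid_scheme \<Rightarrow>
     ('c \<Rightarrow> 'a \<Rightarrow> 'a) \<Rightarrow> ('c \<Rightarrow> 'b \<Rightarrow> 'b) \<Rightarrow> (('a \<times> 'b) \<Rightarrow>\<^sub>0 int) set" where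
  "tensor_null M N sM sN = generate (tensor_free M N) (tensor_relations M N sM sN)"

definition tensor_product ::
    "('a, 'm) monoid_scheme \<Rightarrow> ('b, 'n) monoid_scheme \<Rightarrow>
     ('c \<Rightarrow> 'a \<Rightarrow> 'a) \<Rightarrow> ('c \<Rightarrow> 'b \<Rightarrow> 'b) \<Rightarrow> (('a \<times> 'b) \<Rightarrow>\<^sub>0 int) set monoid" where
  "tensor_product M N sM sN = tensor_free M N Mod tensor_null M N sM sN"

text \<open>The map \<open>x \<otimes> y \<mapsto> f x \<otimes> g y\<close> induced on cosets by linear maps \<open>f\<close> and \<open>g\<close>.
  For linear \<open>f\<close> and \<open>g\<close> all members of the union below are the same coset.\<close>

definition tensor_map ::
    "('a, 'm) monoid_scheme \<Rightarrow> ('b, 'n) monoid_scheme \<Rightarrow>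
     ('c \<Rightarrow> 'a \<Rightarrow> 'a) \<Rightarrow> ('c \<Rightarrow> 'b \<Rightarrow> 'b) \<Rightarrow> ('a \<Rightarrow> 'a) \<Rightarrow> ('b \<Rightarrow> 'b) \<Rightarrow>
     (('a \<times> 'b) \<Rightarrow>\<^sub>0 int) set \<Rightarrow> (('a \<times> 'b) \<Rightarrow>\<^sub>0 int) set" where
  "tensor_map M N sM sN f g Z =
     (\<Union>p\<in>Z. tensor_null M N sM sN #>\<^bsub>tensor_free M N\<^esub>
        frag_extend (\<lambda>(x, y). frag_of (f x, g y)) p)"

definition self_tensor ::
    "('k::field \<Rightarrow> 'd::division_ring \<Rightarrow> 'd) \<Rightarrow> (('d \<times> 'd) \<Rightarrow>\<^sub>0 int) set monoid" where
  "self_tensor scale =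
     tensor_product (add_monoid ring_of_type_algebra) (add_monoid ring_of_type_algebra) scale scale"

definition self_tensor_act ::
    "('k::field \<Rightarrow> 'd::division_ring \<Rightarrow> 'd) \<Rightarrow> 'd \<Rightarrow> 'd \<Rightarrow>
     (('d \<times> 'd) \<Rightarrow>\<^sub>0 int) set \<Rightarrow> (('d \<times> 'd) \<Rightarrow>\<^sub>0 int) set" where
  "self_tensor_act scale a b =
     tensor_map (add_monoid ring_of_type_algebra) (add_monoid ring_of_type_algebra) scale scale
       (\<lambda>x. a * x) (\<lambda>y. y * b)"

definition sub_bimodule ::
    "('k::field \<Rightarrow> 'd::division_ring \<Rightarrow> 'd) \<Rightarrow> (('d \<times> 'd) \<Rightarrow>\<^sub>0 int) set set \<Rightarrow> bool" where
  "sub_bimodule scale U \<longleftrightarrow>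
     subgroup U (self_tensor scale) \<and> (\<forall>a b. \<forall>Z\<in>U. self_tensor_act scale a b Z \<in> U)"

definition noetherian_self_tensor :: "('k::field \<Rightarrow> 'd::division_ring \<Rightarrow> 'd) \<Rightarrow> bool" where
  "noetherian_self_tensor scale \<longleftrightarrow> acc (sub_bimodule scale)"


section \<open>Dimension and rank\<close>

text \<open>\<open>V\<close> is an abelian group (in multiplicative notation) on which the set \<open>S\<close> of scalars, a
  division ring, acts by \<open>act\<close>; the left and the right dimension are obtained from the left and
  the right action.\<close>

definition has_dimension :: "('v, 'm) monoid_scheme \<Rightarrow> 's set \<Rightarrow> ('s \<Rightarrow> 'v \<Rightarrow> 'v) \<Rightarrow> nat \<Rightarrow> bool" where
  "has_dimension V S act n \<longleftrightarrow>
     (\<exists>B \<subseteq> carrier V. finite B \<and> card B = n \<and>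
        (\<forall>v\<in>carrier V. \<exists>!c. c \<in> B \<rightarrow>\<^sub>E S \<and> v = finprod V (\<lambda>b. act (c b) b) B))"

text \<open>\<open>has_rank G r\<close> says that \<open>\<rat> \<otimes>\<^sub>\<int> G\<close> has dimension \<open>r\<close> over \<open>\<rat>\<close>.\<close>

definition has_rank :: "('g, 'm) monoid_scheme \<Rightarrow> nat \<Rightarrow> bool" where
  "has_rank G r \<longleftrightarrow>
     (let Q = add_monoid (ring_of_type_algebra :: rat ring);
          sQ = (\<lambda>(n::int) (q::rat). of_int n * q);
          sG = (\<lambda>(n::int) g. g [^]\<^bsub>G\<^esub> n)
      in has_dimension (tensor_product Q G sQ sG) (UNIV :: rat set)
           (\<lambda>q. tensor_map Q G sQ sG (\<lambda>p. q * p) (\<lambda>g. g)) r)"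

definition finitely_generated_group :: "('g, 'm) monoid_scheme \<Rightarrow> bool" where
  "finitely_generated_group G \<longleftrightarrow>
     (\<exists>Z. finite Z \<and> Z \<subseteq> carrier G \<and> generate G Z = carrier G)"

definition torsion_part :: "('g, 'm) monoid_scheme \<Rightarrow> 'g set" where
  "torsion_part G = {g \<in> carrier G. \<exists>n::nat. n > 0 \<and> g [^]\<^bsub>G\<^esub> n = \<one>\<^bsub>G\<^esub>}"


section \<open>Skew Laurent extensions\<close>

definition auto_pow :: "'a ring \<Rightarrow> ('a \<Rightarrow> 'a) \<Rightarrow> int \<Rightarrow> 'a \<Rightarrow> 'a" where
  "auto_pow R \<sigma> i =
     (if i \<ge> 0 then \<sigma> ^^ nat i else (inv_into (carrier R) \<sigma>) ^^ nat (- i))"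

text \<open>The function \<open>f\<close> stands for the Laurent polynomial \<open>\<Sum>i. f i x\<^sup>i\<close> with coefficients on
  the left; the product is determined by \<open>x\<^sup>i a = \<sigma>\<^sup>i(a) x\<^sup>i\<close>.\<close>

definition skew_laurent :: "'a ring \<Rightarrow> ('a \<Rightarrow> 'a) \<Rightarrow> (int \<Rightarrow> 'a) ring" where
  "skew_laurent R \<sigma> =
     \<lparr>carrier = {f. (\<forall>i. f i \<in> carrier R) \<and> finite {i. f i \<noteq> \<zero>\<^bsub>R\<^esub>}},
      monoid.mult = (\<lambda>f g k.
        finsum R (\<lambda>i. f i \<otimes>\<^bsub>R\<^esub> auto_pow R \<sigma> i (g (k - i))) {i. f i \<noteq> \<zero>\<^bsub>R\<^esub>}),
      one = (\<lambda>i. if i = 0 then \<one>\<^bsub>R\<^esub> else \<zero>\<^bsub>R\<^esub>),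
      ring.zero = (\<lambda>i. \<zero>\<^bsub>R\<^esub>),
      add = (\<lambda>f g i. f i \<oplus>\<^bsub>R\<^esub> g i)\<rparr>"

definition laurent_const :: "'a ring \<Rightarrow> 'a \<Rightarrow> int \<Rightarrow> 'a" where
  "laurent_const R a = (\<lambda>i. if i = 0 then a else \<zero>\<^bsub>R\<^esub>)"

text \<open>\<open>iterated_skew_laurent \<Gamma> n A\<close> says that \<open>A\<close> is, by an isomorphism that is the identity
  on \<open>\<Gamma>\<close>, an \<open>n\<close>-fold iterated skew Laurent extension of \<open>\<Gamma>\<close>. As the type of
  \<open>skew_laurent R \<sigma>\<close> differs from that of \<open>R\<close>, every stage of the iteration is represented
  by an isomorphic copy \<open>A\<close> on the type of \<open>\<Gamma>\<close> that contains the preceding stage \<open>B\<close>.\<close>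

inductive iterated_skew_laurent :: "'a ring \<Rightarrow> nat \<Rightarrow> 'a ring \<Rightarrow> bool" for \<Gamma> :: "'a ring" where
  base: "iterated_skew_laurent \<Gamma> 0 \<Gamma>"
| step: "iterated_skew_laurent \<Gamma> n B \<Longrightarrow> \<sigma> \<in> ring_iso B B \<Longrightarrow> ring A \<Longrightarrow>
     \<phi> \<in> ring_iso (skew_laurent B \<sigma>) A \<Longrightarrow>
     (\<And>b. b \<in> carrier B \<Longrightarrow> \<phi> (laurent_const B b) = b) \<Longrightarrow>
     iterated_skew_laurent \<Gamma> (Suc n) A"


section \<open>Derivations, automorphisms and eigenvalues\<close>

definition algebra_derivation ::
    "('k::field \<Rightarrow> 'd::division_ring \<Rightarrow> 'd) \<Rightarrow> ('d \<Rightarrow> 'd) \<Rightarrow> bool" where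
  "algebra_derivation scale d \<longleftrightarrow>
     Vector_Spaces.linear scale scale d \<and> (\<forall>x y. d (x * y) = d x * y + x * d y)"

definition algebra_automorphism ::
    "('k::field \<Rightarrow> 'd::division_ring \<Rightarrow> 'd) \<Rightarrow> ('d \<Rightarrow> 'd) \<Rightarrow> bool" where
  "algebra_automorphism scale s \<longleftrightarrow>
     Vector_Spaces.linear scale scale s \<and> (\<forall>x y. s (x * y) = s x * s y) \<and> s 1 = 1 \<and> bij s"

datatype delta_kind = Derivations | Automorphisms

text \<open>The family \<open>\<delta>\<close> is indexed by \<open>{1..t}\<close>; its values elsewhere are irrelevant.\<close>

definition commuting_family ::
    "delta_kind \<Rightarrow> ('k::field \<Rightarrow> 'd::division_ring \<Rightarrow> 'd) \<Rightarrow> nat \<Rightarrow> (nat \<Rightarrow> 'd \<Rightarrow> 'd) \<Rightarrow> bool" where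
  "commuting_family kind scale t \<delta> \<longleftrightarrow>
     (\<forall>i\<in>{1..t}. case kind of
         Derivations \<Rightarrow> algebra_derivation scale (\<delta> i)
       | Automorphisms \<Rightarrow> algebra_automorphism scale (\<delta> i)) \<and>
     (\<forall>i\<in>{1..t}. \<forall>j\<in>{1..t}. \<forall>x. \<delta> i (\<delta> j x) = \<delta> j (\<delta> i x))"

text \<open>The group \<open>(K\<^sup>t, +)\<close> for derivations and \<open>((K\<^sup>*)\<^sup>t, \<cdot>)\<close> for automorphisms.\<close>

definition weight_group :: "delta_kind \<Rightarrow> nat \<Rightarrow> (nat \<Rightarrow> 'k::field) monoid" where
  "weight_group kind t =
     product_group {1..t} (\<lambda>_. case kind of
         Derivations \<Rightarrow> add_monoid (ring_of_type_algebra :: 'k ring)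
       | Automorphisms \<Rightarrow> units_of (ring_of_type_algebra :: 'k ring))"

definition eigenspace ::
    "('k::field \<Rightarrow> 'd::division_ring \<Rightarrow> 'd) \<Rightarrow> nat \<Rightarrow> (nat \<Rightarrow> 'd \<Rightarrow> 'd) \<Rightarrow> 'd set \<Rightarrow>
     (nat \<Rightarrow> 'k) \<Rightarrow> 'd set" where
  "eigenspace scale t \<delta> E \<nu> = {u \<in> E. \<forall>i\<in>{1..t}. \<delta> i u = scale (\<nu> i) u}"

definition eigenvalues ::
    "delta_kind \<Rightarrow> ('k::field \<Rightarrow> 'd::division_ring \<Rightarrow> 'd) \<Rightarrow> nat \<Rightarrow> (nat \<Rightarrow> 'd \<Rightarrow> 'd) \<Rightarrow> 'd set \<Rightarrow>
     (nat \<Rightarrow> 'k) set" where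
  "eigenvalues kind scale t \<delta> E =
     {\<nu> \<in> carrier (weight_group kind t). \<exists>u\<in>eigenspace scale t \<delta> E \<nu>. u \<noteq> 0}"

definition eigenvalue_group ::
    "delta_kind \<Rightarrow> ('k::field \<Rightarrow> 'd::division_ring \<Rightarrow> 'd) \<Rightarrow> nat \<Rightarrow> (nat \<Rightarrow> 'd \<Rightarrow> 'd) \<Rightarrow>
     (nat \<Rightarrow> 'k) monoid" where
  "eigenvalue_group kind scale t \<delta> =
     (weight_group kind t)\<lparr>carrier := eigenvalues kind scale t \<delta> UNIV\<rparr>"

text \<open>The sum of the eigenspaces \<open>D\<^sub>\<nu>\<close>, \<open>\<nu> \<in> F\<close>, inside \<open>D\<close>; that it is direct
  is expressed by \<open>independent_eigenspaces\<close>.\<close>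

definition eigen_sum ::
    "('k::field \<Rightarrow> 'd::division_ring \<Rightarrow> 'd) \<Rightarrow> nat \<Rightarrow> (nat \<Rightarrow> 'd \<Rightarrow> 'd) \<Rightarrow> (nat \<Rightarrow> 'k) set \<Rightarrow> 'd set" where
  "eigen_sum scale t \<delta> F =
     {\<Sum>\<nu>\<in>S. u \<nu> | S u. finite S \<and> S \<subseteq> F \<and> (\<forall>\<nu>\<in>S. u \<nu> \<in> eigenspace scale t \<delta> UNIV \<nu>)}"

definition independent_eigenspaces ::
    "('k::field \<Rightarrow> 'd::division_ring \<Rightarrow> 'd) \<Rightarrow> nat \<Rightarrow> (nat \<Rightarrow> 'd \<Rightarrow> 'd) \<Rightarrow> (nat \<Rightarrow> 'k) set \<Rightarrow> bool" where
  "independent_eigenspaces scale t \<delta> F \<longleftrightarrow>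
     (\<forall>S u. finite S \<and> S \<subseteq> F \<and> (\<forall>\<nu>\<in>S. u \<nu> \<in> eigenspace scale t \<delta> UNIV \<nu>) \<and>
        (\<Sum>\<nu>\<in>S. u \<nu>) = 0 \<longrightarrow> (\<forall>\<nu>\<in>S. u \<nu> = 0))"

end

(*
  For a division subalgebra E of D, the kernel of D (x) D -> D (x)_E D is a sub-bimodule that contains
  x (x) 1 - 1 (x) x exactly when x lies in E; hence chains of division subalgebras of D become constant.

  Eigenvectors of different weights are linearly independent, and D_lambda = D_0 u for every nonzero u in
  D_lambda. If F is generated by finitely many weights, the sum A of the D_lambda, lambda in F, arises from
  D_0 by adjoining one eigenvector and its inverse at a time. Such an eigenvector normalizes the ring
  reached before it, so A is Noetherian by Hilbert's basis theorem and therefore an Ore domain. If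
  v = s^-1 a is an eigenvector with s, a in A, comparing components in s v = a puts its weight into F and
  rewrites v as a fraction of eigenvectors. So F is determined by Frac(A), the chain condition on division
  subalgebras makes Ev(Delta) and all its subgroups finitely generated, and the argument covers every F.

  The skew Laurent structure comes from a basis of Ev(Delta) modulo torsion, obtained from a minimal
  generating family by the Euclidean algorithm. Over the finite torsion part, the decreasing left
  D_0-subspaces D_T x^n become constant, which makes every nonzero x invertible in D_T.
*)
theory Submission
  imports Defs
begin

section \<open>Chain conditions\<close>

text \<open>Until F is known to be finitely generated, the sum A of its D_lambda is not known to be
  Noetherian, and Frac(A) is not known to be closed under addition. The chain condition on division
  subalgebras is therefore applied to groups of weights with a finite generating set; finite
  generation of an arbitrary F comes out of that and lifts the restriction. An eigenvector u of
  weight g normalizes A because weights commute: conjugation by u maps each D_nu into itself,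
  although it need not fix D_0 elementwise. A nonzero multiple of g may already lie in F, and then
  the powers of u are dependent over A. Hence the basis theorem is proved for subrings of D in which
  every element becomes a polynomial in u after multiplication by a power of u, with no uniqueness
  of that polynomial. Uniqueness enters with the skew Laurent isomorphism, where g has infinite
  order modulo F. The rings are kept as subsets of D, so that the absence of zero divisors is
  inherited.\<close>

lemma finitely_generated_if_acc:
  fixes cl :: "'a set \<Rightarrow> 'a set"
  assumes extensive: "\<And>Z. Z \<subseteq> E \<Longrightarrow> Z \<subseteq> cl Z"
    and mono: "\<And>Y Z. Y \<subseteq> Z \<Longrightarrow> Z \<subseteq> E \<Longrightarrow> cl Y \<subseteq> cl Z"
    and closed: "\<And>Z. Z \<subseteq> E \<Longrightarrow> cl Z \<subseteq> E"
    and acc: "acc (\<lambda>C. \<exists>Z. finite Z \<and> Z \<subseteq> E \<and> C = cl Z)"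
  shows "\<exists>Z. finite Z \<and> Z \<subseteq> E \<and> cl Z = E"
proof (rule ccontr)
  assume neg: "\<not> ?thesis"
  define pick where "pick = (\<lambda>Z. SOME x. x \<in> E - cl Z)"
  have pick: "pick Z \<in> E - cl Z" if "finite Z" "Z \<subseteq> E" for Z
  proof -
    have "\<exists>x. x \<in> E - cl Z"
      using neg that closed by blast
    then show ?thesis
      unfolding pick_def by (rule someI_ex)
  qed
  \<comment> \<open>If no finite set had closure \<open>E\<close>, each of these finite sets would
    add a point outside the closure of its predecessor, and the closures would never become
    constant.\<close>
  define Zs where "Zs = rec_nat {} (\<lambda>_ Z. insert (pick Z) Z)"
  have Zs_Suc: "Zs (Suc n) = insert (pick (Zs n)) (Zs n)" for n
    by (simp add: Zs_def)
  have Zs: "finite (Zs n) \<and> Zs n \<subseteq> E" for n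
  proof (induction n)
    case 0
    show ?case by (simp add: Zs_def)
  next
    case (Suc n)
    then show ?case
      using pick[of "Zs n"] by (auto simp: Zs_Suc)
  qed
  have "cl (Zs n) \<subseteq> cl (Zs (Suc n))" for n
    using Zs[of "Suc n"] by (intro mono) (auto simp: Zs_Suc)
  moreover have "\<exists>Z. finite Z \<and> Z \<subseteq> E \<and> cl (Zs n) = cl Z" for n
    using Zs by blast
  ultimately obtain N where N: "\<forall>n\<ge>N. cl (Zs n) = cl (Zs N)"
    using acc[unfolded acc_def, rule_format, of "\<lambda>n. cl (Zs n)"] by blast
  have "pick (Zs N) \<in> cl (Zs (Suc N))"
    using extensive[of "Zs (Suc N)"] Zs[of "Suc N"] by (auto simp: Zs_Suc)
  then show False
    using N pick[of "Zs N"] Zs[of N] by (metis DiffD2 le_SucI order_refl)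
qed

text \<open>A chain compares only nested sets, so injectivity is asked only for those. This is what
  the two main applications offer: a tensor kernel and a quotient division algebra each detect a
  proper enlargement.\<close>

lemma acc_injective_image:
  assumes "acc Q"
    and "\<And>U. P U \<Longrightarrow> Q (f U)"
    and "\<And>U Y. P U \<Longrightarrow> P Y \<Longrightarrow> U \<subseteq> Y \<Longrightarrow> f U \<subseteq> f Y"
    and inj: "\<And>U Y. P U \<Longrightarrow> P Y \<Longrightarrow> U \<subseteq> Y \<Longrightarrow> f U = f Y \<Longrightarrow> U = Y"
  shows "acc P"
  unfolding acc_def
proof (intro allI impI)
  fix C :: "nat \<Rightarrow> 'b set"
  assume C: "\<forall>n. P (C n) \<and> C n \<subseteq> C (Suc n)"
  then have mono: "C m \<subseteq> C n" if "m \<le> n" for m n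
    using that by (simp add: lift_Suc_mono_le)
  have "\<forall>n. Q (f (C n)) \<and> f (C n) \<subseteq> f (C (Suc n))"
    using assms(2,3) C by blast
  then obtain N where "\<forall>n\<ge>N. f (C n) = f (C N)"
    using \<open>acc Q\<close>[unfolded acc_def, rule_format, of "\<lambda>n. f (C n)"] by blast
  then have "\<forall>n\<ge>N. C n = C N"
    using inj[of "C N" "C _"] mono[of N] C by metis
  then show "\<exists>N. \<forall>n\<ge>N. C n = C N" ..
qed

lemma acc_constant_from:
  assumes "acc P" "\<And>n. P (C n)" "\<And>n. C n \<subseteq> C (Suc n)"
  obtains N where "\<And>n. n \<ge> N \<Longrightarrow> C n = C N"
  using assms unfolding acc_def by blast

section \<open>Evaluation of tensors by balanced maps\<close>

text \<open>The additive extension of \<open>h\<close> to formal sums. Values in an arbitrary ring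
  let it serve both for pairings with values in D and for rational coordinates on an abelian
  group.\<close>

definition frag_eval :: "('a \<Rightarrow> 'z::ring_1) \<Rightarrow> ('a \<Rightarrow>\<^sub>0 int) \<Rightarrow> 'z" where
  "frag_eval h p = (\<Sum>k\<in>Poly_Mapping.keys p. of_int (Poly_Mapping.lookup p k) * h k)"

lemma frag_eval_superset:
  assumes "finite S" "Poly_Mapping.keys p \<subseteq> S"
  shows "frag_eval h p = (\<Sum>k\<in>S. of_int (Poly_Mapping.lookup p k) * h k)"
  unfolding frag_eval_def
  by (rule sum.mono_neutral_left) (use assms in \<open>auto simp: in_keys_iff\<close>)

lemma frag_eval_0 [simp]: "frag_eval h 0 = 0"
  by (simp add: frag_eval_def)

lemma frag_eval_of [simp]: "frag_eval h (frag_of a) = h a"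
  by (simp add: frag_eval_def)

lemma frag_eval_add [simp]: "frag_eval h (p + q) = frag_eval h p + frag_eval h q"
proof -
  let ?S = "Poly_Mapping.keys p \<union> Poly_Mapping.keys q"
  show ?thesis
    using Poly_Mapping.keys_add[of p q]
    by (simp add: frag_eval_superset[of ?S] lookup_add ring_distribs sum.distrib)
qed

lemma frag_eval_minus [simp]: "frag_eval h (- p) = - frag_eval h p"
  using frag_eval_add[of h p "- p"] by (metis add.right_inverse frag_eval_0 minus_unique)

lemma frag_eval_diff [simp]: "frag_eval h (p - q) = frag_eval h p - frag_eval h q"
  using frag_eval_add[of h p "- q"] by simp

lemma frag_eval_frag_extend:
  "frag_eval h (frag_extend (\<lambda>k. frag_of (f k)) p) = frag_eval (\<lambda>k. h (f k)) p"
  by (rule frag_induction[of p UNIV]) (auto simp: frag_extend_diff)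

text \<open>Covers two tensor products: D with itself over K, and the rationals with an abelian
  group, by which the rank is defined. The scalars carry no ring structure because they enter only
  through the relation that moves them across.\<close>

locale tensor =
  M: comm_group M + N: comm_group N
  for M :: "('a, 'm) monoid_scheme" and N :: "('b, 'n) monoid_scheme"
    and sM :: "'c \<Rightarrow> 'a \<Rightarrow> 'a" and sN :: "'c \<Rightarrow> 'b \<Rightarrow> 'b" +
  assumes sM_closed: "x \<in> carrier M \<Longrightarrow> sM c x \<in> carrier M"
    and sN_closed: "y \<in> carrier N \<Longrightarrow> sN c y \<in> carrier N"
begin

abbreviation "null \<equiv> tensor_null M N sM sN"
abbreviation "free \<equiv> tensor_free M N"
abbreviation "coset p \<equiv> null #>\<^bsub>free\<^esub> p"

sublocale free: comm_group free
  by (rule abelian_free_Abelian_group)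

lemma relations_subset: "tensor_relations M N sM sN \<subseteq> carrier free"
proof -
  have frag: "frag_of (x, y) \<in> carrier free" if "x \<in> carrier M" "y \<in> carrier N" for x y
    using that by simp
  have diff: "p - q \<in> carrier free" if "p \<in> carrier free" "q \<in> carrier free" for p q
    using that keys_diff[of p q] by auto
  show ?thesis
    unfolding tensor_relations_def
    using sM_closed sN_closed by (blast intro: frag diff M.m_closed N.m_closed)
qed

lemma subgroup_null: "subgroup null free"
  unfolding tensor_null_def by (rule free.generate_is_subgroup[OF relations_subset])

sublocale null: normal null free
  by (rule free.normal_iff_subgroup[THEN iffD2, OF subgroup_null])

lemma null_subset: "null \<subseteq> carrier free"
  by (rule null.subset)

lemma null_zero: "0 \<in> null"
  using null.one_closed by simp

lemma null_add: "p \<in> null \<Longrightarrow> q \<in> null \<Longrightarrow> p + q \<in> null"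
  using null.m_closed by simp

lemma null_minus: "p \<in> null \<Longrightarrow> - p \<in> null"
proof -
  assume p: "p \<in> null"
  then have "Poly_Mapping.keys p \<subseteq> carrier M \<times> carrier N"
    using null_subset by (simp add: subset_iff)
  then show "- p \<in> null"
    using null.m_inv_closed[OF p] by (simp only: inv_free_Abelian_group)
qed

lemma null_induct [consumes 1, case_names zero relation add minus]:
  assumes "p \<in> null" "P 0" "\<And>p. p \<in> tensor_relations M N sM sN \<Longrightarrow> P p"
    "\<And>p q. P p \<Longrightarrow> P q \<Longrightarrow> P (p + q)" "\<And>p. P p \<Longrightarrow> P (- p)"
  shows "P p"
  using assms(1) unfolding tensor_null_def
proof (induction rule: generate.induct)
  case (inv h)
  then have "Poly_Mapping.keys h \<subseteq> carrier M \<times> carrier N"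
    using subsetD[OF relations_subset, of h] by simp
  then show ?case using inv assms by simp
qed (use assms in auto)

lemma in_null_if_relation: "p \<in> tensor_relations M N sM sN \<Longrightarrow> p \<in> null"
  unfolding tensor_null_def by (rule generate.incl)

lemma coset_eq_iff:
  assumes "p \<in> carrier free" "q \<in> carrier free"
  shows "coset p = coset q \<longleftrightarrow> p - q \<in> null"
proof
  assume "coset p = coset q"
  then have "p \<in> coset q"
    using free.rcos_self[OF assms(1) subgroup_null] by simp
  then show "p - q \<in> null"
    by (auto simp: r_coset_def)
next
  assume *: "p - q \<in> null"
  then have "p \<in> coset q"
    unfolding r_coset_def by (auto intro!: bexI[of _ "p - q"])
  then show "coset p = coset q"
    by (metis assms(2) free.repr_independence subgroup_null)
qed

lemma carrier_tensor: "carrier (tensor_product M N sM sN) = coset ` carrier free"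
  by (simp add: tensor_product_def carrier_FactGroup)

lemma coset_add:
  assumes "p \<in> carrier free" "q \<in> carrier free"
  shows "coset p \<otimes>\<^bsub>tensor_product M N sM sN\<^esub> coset q = coset (p + q)"
  using null.rcos_sum[OF assms] by (simp add: tensor_product_def)

lemma comm_group_tensor: "comm_group (tensor_product M N sM sN)"
  unfolding tensor_product_def
  by (rule free.abelian_FactGroup[OF subgroup_null])

lemma coset_hom: "coset \<in> hom free (tensor_product M N sM sN)"
  unfolding tensor_product_def by (rule null.r_coset_hom_Mod)

lemma one_tensor: "\<one>\<^bsub>tensor_product M N sM sN\<^esub> = coset 0"
  unfolding tensor_product_def using null_subset
  by (simp add: FactGroup_def r_coset_def)

definition balanced :: "('a \<times> 'b \<Rightarrow> 'z::ring_1) \<Rightarrow> bool" where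
  "balanced h \<longleftrightarrow>
     (\<forall>x\<in>carrier M. \<forall>x'\<in>carrier M. \<forall>y\<in>carrier N. h (x \<otimes>\<^bsub>M\<^esub> x', y) = h (x, y) + h (x', y)) \<and>
     (\<forall>x\<in>carrier M. \<forall>y\<in>carrier N. \<forall>y'\<in>carrier N. h (x, y \<otimes>\<^bsub>N\<^esub> y') = h (x, y) + h (x, y')) \<and>
     (\<forall>c. \<forall>x\<in>carrier M. \<forall>y\<in>carrier N. h (sM c x, y) = h (x, sN c y))"

text \<open>This is how cosets are told apart: two representatives on which a balanced map differs
  cannot be congruent modulo \<open>null\<close>.\<close>

lemma frag_eval_null:
  assumes "balanced h" "p \<in> null"
  shows "frag_eval h p = 0"
  using assms(2)
proof (induction rule: null_induct)
  case (relation p)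
  then show ?case
    using assms(1) by (auto simp: tensor_relations_def balanced_def)
qed auto

text \<open>The lifted map sends each defining relation to a defining relation, hence
  \<open>null\<close> into \<open>null\<close>; so the union in \<open>tensor_map\<close> runs over
  copies of a single coset.\<close>

lemma tensor_map_coset:
  assumes f: "f \<in> hom M M" "\<And>c x. x \<in> carrier M \<Longrightarrow> f (sM c x) = sM c (f x)"
    and g: "g \<in> hom N N" "\<And>c y. y \<in> carrier N \<Longrightarrow> g (sN c y) = sN c (g y)"
    and p: "p \<in> carrier free"
  shows "tensor_map M N sM sN f g (coset p) =
    coset (frag_extend (\<lambda>(x, y). frag_of (f x, g y)) p)"
proof -
  let ?L = "frag_extend (\<lambda>(x, y). frag_of (f x, g y))"
  have L_free: "?L q \<in> carrier free" if "q \<in> carrier free" for q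
  proof -
    have "Poly_Mapping.keys (?L q) \<subseteq> (\<lambda>(x, y). (f x, g y)) ` Poly_Mapping.keys q"
      using keys_frag_extend[of "\<lambda>(x, y). frag_of (f x, g y)" q]
      by (rule order_trans) (auto simp: keys_frag_of)
    also have "\<dots> \<subseteq> carrier M \<times> carrier N"
      using that hom_in_carrier[OF f(1)] hom_in_carrier[OF g(1)] by auto
    finally show ?thesis by simp
  qed
  have *: "?L q \<in> null" if "q \<in> null" for q
    using that
  proof (induction rule: null_induct)
    case (relation p)
    have "?L p \<in> tensor_relations M N sM sN"
      using relation[unfolded tensor_relations_def]
    proof (elim UnE CollectE exE conjE)
      fix x x' y
      assume "p = frag_of (x \<otimes>\<^bsub>M\<^esub> x', y) - frag_of (x, y) - frag_of (x', y)"
        and *: "x \<in> carrier M" "x' \<in> carrier M" "y \<in> carrier N"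
      then have "?L p = frag_of (f x \<otimes>\<^bsub>M\<^esub> f x', g y) - frag_of (f x, g y) - frag_of (f x', g y)"
        using hom_mult[OF f(1)] by (simp add: frag_extend_diff)
      then show "?L p \<in> tensor_relations M N sM sN"
        unfolding tensor_relations_def
        using hom_in_carrier[OF f(1)] hom_in_carrier[OF g(1)] * by blast
    next
      fix x y y'
      assume "p = frag_of (x, y \<otimes>\<^bsub>N\<^esub> y') - frag_of (x, y) - frag_of (x, y')"
        and *: "x \<in> carrier M" "y \<in> carrier N" "y' \<in> carrier N"
      then have "?L p = frag_of (f x, g y \<otimes>\<^bsub>N\<^esub> g y') - frag_of (f x, g y) - frag_of (f x, g y')"
        using hom_mult[OF g(1)] by (simp add: frag_extend_diff)
      then show "?L p \<in> tensor_relations M N sM sN"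
        unfolding tensor_relations_def
        using hom_in_carrier[OF f(1)] hom_in_carrier[OF g(1)] * by blast
    next
      fix c x y
      assume "p = frag_of (sM c x, y) - frag_of (x, sN c y)"
        and *: "x \<in> carrier M" "y \<in> carrier N"
      then have "?L p = frag_of (sM c (f x), g y) - frag_of (f x, sN c (g y))"
        using f(2) g(2) by (simp add: frag_extend_diff)
      then show "?L p \<in> tensor_relations M N sM sN"
        unfolding tensor_relations_def
        using hom_in_carrier[OF f(1)] hom_in_carrier[OF g(1)] * by blast
    qed
    then show ?case by (rule in_null_if_relation)
  qed (auto simp: null_zero null_add null_minus frag_extend_add frag_extend_minus)
  have L_null: "coset (?L q) = coset (?L p)" if q: "q \<in> coset p" for q
  proof -
    obtain x where x: "x \<in> null" "q = x + p"
      using q by (auto simp: r_coset_def)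
    then have "x + p \<in> carrier free"
      using p null_subset keys_add[of x p] by (simp add: subset_iff) blast
    with x show ?thesis
      using * p L_free by (simp only: coset_eq_iff) (simp add: frag_extend_add)
  qed
  have "p \<in> coset p"
    using free.rcos_self[OF p subgroup_null] .
  then show ?thesis
    unfolding tensor_map_def using L_null by blast
qed

lemma finprod_coset:
  assumes "finite J" "\<And>i. i \<in> J \<Longrightarrow> P i \<in> carrier free"
  shows "finprod (tensor_product M N sM sN) (\<lambda>i. coset (P i)) J = coset (\<Sum>i\<in>J. P i)"
proof -
  interpret TP: comm_group "tensor_product M N sM sN"
    by (rule comm_group_tensor)
  show ?thesis
    using assms
  proof (induction J rule: finite_induct)
    case empty
    show ?case
      by (simp add: one_tensor)
  next
    case (insert i J)
    have closed: "coset (P j) \<in> carrier (tensor_product M N sM sN)" if "j \<in> insert i J" for j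
      unfolding carrier_tensor using insert(4)[OF that] by blast
    have "finprod (tensor_product M N sM sN) (\<lambda>i. coset (P i)) (insert i J) =
        coset (P i) \<otimes>\<^bsub>tensor_product M N sM sN\<^esub> finprod (tensor_product M N sM sN) (\<lambda>i. coset (P i)) J"
      using insert(1,2) closed by (intro TP.finprod_insert) auto
    also have "finprod (tensor_product M N sM sN) (\<lambda>i. coset (P i)) J = coset (\<Sum>i\<in>J. P i)"
      using insert by blast
    also have "coset (P i) \<otimes>\<^bsub>tensor_product M N sM sN\<^esub> coset (\<Sum>i\<in>J. P i) = coset (P i + (\<Sum>i\<in>J. P i))"
      using insert(4) by (intro coset_add sum_closed_free_Abelian_group) auto
    finally show ?case
      by (simp only: sum.insert[OF insert(1,2)])
  qed
qed

end

section \<open>Chains of division subalgebras\<close>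

text \<open>For such \<phi> the map x \<otimes> y \<mapsto> x (\<phi> y) respects the relation x e
  \<otimes> y = x \<otimes> e y with e in \<open>E\<close>, so it lives on the tensor product over
  \<open>E\<close>.\<close>

definition left_linear :: "'d::ring_1 set \<Rightarrow> ('d \<Rightarrow> 'd) \<Rightarrow> bool" where
  "left_linear E \<phi> \<longleftrightarrow> (\<forall>y z. \<phi> (y + z) = \<phi> y + \<phi> z) \<and> (\<forall>e\<in>E. \<forall>y. \<phi> (e * y) = e * \<phi> y)"

text \<open>Zorn's lemma gives a left \<open>E\<close>-subspace \<open>M\<close> maximal among those
  that contain 1 and avoid \<open>x\<close>. Then D is the direct sum of \<open>M\<close> and the
  line through \<open>x\<close>, and \<phi> reads off the coefficient of \<open>x\<close>. The
  maximal subspace takes the place of a basis of D over \<open>E\<close>.\<close>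

lemma exists_left_linear_separating:
  fixes E :: "'d::division_ring set"
  assumes E0: "0 \<in> E" and E1: "1 \<in> E" and add: "\<And>y z. y \<in> E \<Longrightarrow> z \<in> E \<Longrightarrow> y + z \<in> E"
    and uminus: "\<And>y. y \<in> E \<Longrightarrow> - y \<in> E"
    and mult: "\<And>y z. y \<in> E \<Longrightarrow> z \<in> E \<Longrightarrow> y * z \<in> E"
    and inverse: "\<And>y. y \<in> E \<Longrightarrow> inverse y \<in> E"
    and x: "x \<notin> E"
  shows "\<exists>\<phi>. left_linear E \<phi> \<and> \<phi> 1 = 0 \<and> \<phi> x = 1"
proof -
  define \<S> where "\<S> = {M. 1 \<in> M \<and> x \<notin> M \<and>
    (\<forall>y\<in>M. \<forall>z\<in>M. y + z \<in> M) \<and> (\<forall>e\<in>E. \<forall>y\<in>M. e * y \<in> M)}"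
  have "E \<in> \<S>"
    using assms by (auto simp: \<S>_def)
  have "\<exists>M\<in>\<S>. \<forall>N\<in>\<S>. M \<subseteq> N \<longrightarrow> N = M"
  proof (rule subset_Zorn_nonempty)
    show "\<S> \<noteq> {}"
      using \<open>E \<in> \<S>\<close> by blast
    fix \<C> assume ne: "\<C> \<noteq> {}" and chain: "subset.chain \<S> \<C>"
    then have C: "\<C> \<subseteq> \<S>" "\<And>A B. A \<in> \<C> \<Longrightarrow> B \<in> \<C> \<Longrightarrow> A \<subseteq> B \<or> B \<subseteq> A"
      by (auto simp: subset.chain_def)
    have "y + z \<in> \<Union>\<C>" if y: "y \<in> A" "A \<in> \<C>" and z: "z \<in> B" "B \<in> \<C>" for y z A B
      using C(2)[OF y(2) z(2)] C(1) y z unfolding \<S>_def by blast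
    moreover have "1 \<in> \<Union>\<C>" "x \<notin> \<Union>\<C>"
      using ne C(1) by (auto simp: \<S>_def)
    moreover have "e * y \<in> \<Union>\<C>" if "e \<in> E" "y \<in> A" "A \<in> \<C>" for e y A
      using C(1) that unfolding \<S>_def by blast
    ultimately show "\<Union>\<C> \<in> \<S>"
      by (simp add: \<S>_def)
  qed
  then obtain M where "M \<in> \<S>" and max: "\<And>N. N \<in> \<S> \<Longrightarrow> M \<subseteq> N \<Longrightarrow> N = M"
    by blast
  then have M: "1 \<in> M" "x \<notin> M" "\<And>y z. y \<in> M \<Longrightarrow> z \<in> M \<Longrightarrow> y + z \<in> M"
    "\<And>e y. e \<in> E \<Longrightarrow> y \<in> M \<Longrightarrow> e * y \<in> M"
    by (auto simp: \<S>_def)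
  have M0: "0 \<in> M"
    using M(4)[OF E0 M(1)] by simp
  have Mminus: "- y \<in> M" if "y \<in> M" for y
    using M(4)[OF uminus[OF E1] that] by simp
  have Mdiff: "y - z \<in> M" if "y \<in> M" "z \<in> M" for y z
    using M(3)[OF that(1) Mminus[OF that(2)]] by simp
  have ex: "\<exists>e\<in>E. y - e * x \<in> M" for y
  proof (cases "y \<in> M")
    case True
    then show ?thesis
      using E0 by (intro bexI[of _ 0]) auto
  next
    case False
    \<comment> \<open>\<open>N\<close> is \<open>M\<close> enlarged by \<open>y\<close>. It meets
      every other condition of \<S>, so it must contain \<open>x\<close>, and the relation
      \<open>x = m + e * y\<close> can be solved for \<open>y\<close> because \<open>x\<close> is
      not in \<open>M\<close>.\<close>
    define N where "N = {m + e * y | m e. m \<in> M \<and> e \<in> E}"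
    have "M \<subseteq> N"
      using E0 by (force simp: N_def)
    moreover have "y \<in> N"
      using M0 E1 by (force simp: N_def)
    ultimately have "N \<notin> \<S>"
      using max[of N] False by blast
    moreover have "1 \<in> N"
      using M(1) \<open>M \<subseteq> N\<close> by blast
    moreover have "u + v \<in> N" if uv: "u \<in> N" "v \<in> N" for u v
    proof -
      obtain m e m' e' where "u = m + e * y" "v = m' + e' * y" "m \<in> M" "m' \<in> M" "e \<in> E" "e' \<in> E"
        using uv by (auto simp: N_def)
      then have "u + v = (m + m') + (e + e') * y" "m + m' \<in> M" "e + e' \<in> E"
        using M(3) add by (auto simp: algebra_simps)
      then show ?thesis
        unfolding N_def by blast
    qed
    moreover have "c * u \<in> N" if cu: "c \<in> E" "u \<in> N" for c u
    proof -
      obtain m e where "u = m + e * y" "m \<in> M" "e \<in> E"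
        using cu by (auto simp: N_def)
      then have "c * u = c * m + (c * e) * y" "c * m \<in> M" "c * e \<in> E"
        using M(4) mult cu by (auto simp: algebra_simps)
      then show ?thesis
        unfolding N_def by blast
    qed
    ultimately have "x \<in> N"
      by (auto simp: \<S>_def)
    then obtain m e where me: "x = m + e * y" "m \<in> M" "e \<in> E"
      by (auto simp: N_def)
    with M(2) have "e \<noteq> 0"
      by auto
    then have "y - inverse e * x = inverse e * (- m)"
      using me by (simp add: distrib_left mult.assoc[symmetric])
    also have "\<dots> \<in> M"
      by (intro M(4) Mminus inverse me)
    finally show ?thesis
      using inverse[OF me(3)] by blast
  qed
  \<comment> \<open>Two coefficients would put a nonzero \<open>E\<close>-multiple of
    \<open>x\<close>, hence \<open>x\<close> itself, into \<open>M\<close>.\<close>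
  have unique: "e = e'" if "e \<in> E" "e' \<in> E" "y - e * x \<in> M" "y - e' * x \<in> M" for e e' y
  proof (rule ccontr)
    assume "e \<noteq> e'"
    have "(e - e') * x \<in> M"
      using Mdiff[OF that(4) that(3)] by (simp add: algebra_simps)
    moreover have "e - e' \<in> E"
      using add[OF that(1) uminus[OF that(2)]] by simp
    ultimately have "inverse (e - e') * ((e - e') * x) \<in> M"
      using M(4) inverse by blast
    then show False
      using \<open>e \<noteq> e'\<close> M(2) by (simp add: mult.assoc[symmetric])
  qed
  define \<phi> where "\<phi> = (\<lambda>y. THE e. e \<in> E \<and> y - e * x \<in> M)"
  have \<phi>: "\<phi> y = e" if "e \<in> E" "y - e * x \<in> M" for e y
    unfolding \<phi>_def using that unique by blast
  have \<phi>_E: "\<phi> y \<in> E" and \<phi>_M: "y - \<phi> y * x \<in> M" for y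
    using ex[of y] \<phi> by auto
  have "\<phi> (y + z) = \<phi> y + \<phi> z" for y z
    using M(3)[OF \<phi>_M[of y] \<phi>_M[of z]] by (intro \<phi> add \<phi>_E) (simp add: algebra_simps)
  moreover have "\<phi> (e * y) = e * \<phi> y" if "e \<in> E" for e y
    using M(4)[OF that \<phi>_M[of y]] that by (intro \<phi> mult \<phi>_E) (simp_all add: algebra_simps)
  moreover have "\<phi> 1 = 0" "\<phi> x = 1"
    using E0 E1 M(1) M0 by (auto intro!: \<phi>)
  ultimately show ?thesis
    unfolding left_linear_def by blast
qed

section \<open>Kernels in the tensor square attached to division subalgebras\<close>

lemma ring_of_type_algebra_simps [simp]:
  "carrier ring_of_type_algebra = UNIV"
  "x \<otimes>\<^bsub>ring_of_type_algebra\<^esub> y = x * y" "\<one>\<^bsub>ring_of_type_algebra\<^esub> = 1"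
  "x \<oplus>\<^bsub>ring_of_type_algebra\<^esub> y = x + y" "\<zero>\<^bsub>ring_of_type_algebra\<^esub> = 0"
  by (simp_all add: ring_of_type_algebra_def)

lemma comm_group_add_monoid_type:
  "comm_group (add_monoid (ring_of_type_algebra :: 'a::ring_1 ring))"
proof (rule comm_groupI)
  fix x :: 'a
  show "\<exists>y\<in>carrier (add_monoid ring_of_type_algebra).
      y \<otimes>\<^bsub>add_monoid ring_of_type_algebra\<^esub> x = \<one>\<^bsub>add_monoid ring_of_type_algebra\<^esub>"
    by (rule bexI[of _ "- x"]) auto
qed (auto simp: ac_simps)

context division_algebra
begin

lemma subspace_iff:
  "subspace E \<longleftrightarrow> 0 \<in> E \<and> (\<forall>x\<in>E. \<forall>y\<in>E. x + y \<in> E) \<and> (\<forall>c. \<forall>x\<in>E. scale c x \<in> E)"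
  by (auto simp: subspace_def)

lemma division_subalgebraI:
  assumes "0 \<in> E" "1 \<in> E" "\<And>x y. x \<in> E \<Longrightarrow> y \<in> E \<Longrightarrow> x + y \<in> E"
    "\<And>c x. x \<in> E \<Longrightarrow> scale c x \<in> E" "\<And>x y. x \<in> E \<Longrightarrow> y \<in> E \<Longrightarrow> x * y \<in> E"
    "\<And>x. x \<in> E \<Longrightarrow> inverse x \<in> E"
  shows "division_subalgebra scale E"
  using assms by (auto simp: division_subalgebra_def subspace_iff)

lemma division_subalgebraD:
  assumes "division_subalgebra scale E"
  shows "0 \<in> E" "1 \<in> E" "\<And>x y. x \<in> E \<Longrightarrow> y \<in> E \<Longrightarrow> x + y \<in> E"
    "\<And>x. x \<in> E \<Longrightarrow> - x \<in> E"
    "\<And>c x. x \<in> E \<Longrightarrow> scale c x \<in> E" "\<And>x y. x \<in> E \<Longrightarrow> y \<in> E \<Longrightarrow> x * y \<in> E"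
    "\<And>x. x \<in> E \<Longrightarrow> inverse x \<in> E"
  using assms subspace_neg by (auto simp: division_subalgebra_def subspace_iff)

text \<open>Replaces scalars by elements of D that lie in every division subalgebra; left
  \<open>E\<close>-linear maps are thereby K-linear.\<close>

lemma scale_eq_mult: "scale c x = scale c 1 * x"
  using scale_mult_left[of c 1 x] by simp

sublocale self: tensor "add_monoid ring_of_type_algebra :: 'd monoid" "add_monoid ring_of_type_algebra" scale scale
  by (intro tensor.intro comm_group_add_monoid_type tensor_axioms.intro) auto

definition pairing :: "('d \<Rightarrow> 'd) \<Rightarrow> ('d \<times> 'd \<Rightarrow>\<^sub>0 int) \<Rightarrow> 'd" where
  "pairing \<phi> = frag_eval (\<lambda>(x, y). x * \<phi> y)"

definition annihilated :: "'d set \<Rightarrow> ('d \<times> 'd \<Rightarrow>\<^sub>0 int) set" where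
  "annihilated E = {p. \<forall>\<phi>. left_linear E \<phi> \<longrightarrow> pairing \<phi> p = 0}"

text \<open>The kernel of \<open>D \<otimes> D \<rightarrow> D \<otimes>\<^sub>E D\<close>, described by left \<open>E\<close>-linear maps so that
  tensor products over noncommutative rings are not needed.\<close>

definition tensor_kernel :: "'d set \<Rightarrow> ('d \<times> 'd \<Rightarrow>\<^sub>0 int) set set" where
  "tensor_kernel E = self.coset ` annihilated E"

lemma free_UNIV: "p \<in> carrier self.free"
  by simp

text \<open>A division subalgebra contains \<open>scale c 1\<close>, so a left
  \<open>E\<close>-linear map lets scalars pass and its pairing is balanced over K.\<close>

lemma null_subset_annihilated:
  assumes "division_subalgebra scale E"
  shows "self.null \<subseteq> annihilated E"
proof
  fix p assume p: "p \<in> self.null"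
  have "pairing \<phi> p = 0" if \<phi>: "left_linear E \<phi>" for \<phi>
  proof -
    have "\<phi> (scale c y) = scale c 1 * \<phi> y" for c y
    proof -
      have "scale c 1 \<in> E"
        using division_subalgebraD[OF assms] by blast
      then show ?thesis
        using \<phi> by (subst scale_eq_mult) (auto simp: left_linear_def)
    qed
    then have "self.balanced (\<lambda>(x, y). x * \<phi> y)"
      using \<phi> unfolding self.balanced_def
      by (auto simp: left_linear_def algebra_simps
          simp flip: scale_mult_left scale_mult_right)
    then show ?thesis
      unfolding pairing_def using p by (rule self.frag_eval_null)
  qed
  then show "p \<in> annihilated E"
    by (simp add: annihilated_def)
qed

text \<open>In a pairing, left multiplication by a comes out in front, and right multiplication by b
  turns \<phi> into y \<mapsto> \<phi> (y * b), which is again left \<open>E\<close>-linear. Being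
  annihilated by all \<phi> at once is therefore stable under both actions.\<close>

lemma sub_bimodule_tensor_kernel:
  shows "sub_bimodule scale (tensor_kernel E)"
proof -
  have "subgroup (annihilated E) self.free"
    by unfold_locales
      (auto simp: annihilated_def pairing_def)
  then have "subgroup (tensor_kernel E) (self_tensor scale)"
    unfolding tensor_kernel_def self_tensor_def
    by (intro group_hom.subgroup_img_is_subgroup[of self.free] group_hom.intro group_hom_axioms.intro
        self.coset_hom comm_group.axioms(2) self.comm_group_tensor self.free.comm_group_axioms)
  moreover have "self_tensor_act scale a b Z \<in> tensor_kernel E" if Z: "Z \<in> tensor_kernel E" for a b Z
  proof -
    obtain p where p: "Z = self.coset p" "p \<in> annihilated E"
      using Z unfolding tensor_kernel_def by blast
    let ?q = "frag_extend (\<lambda>(x, y). frag_of (a * x, y * b)) p"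
    have "self_tensor_act scale a b Z = self.coset ?q"
      unfolding self_tensor_act_def p(1)
      by (intro self.tensor_map_coset free_UNIV)
        (auto simp: hom_def distrib_left distrib_right
          simp flip: scale_mult_left scale_mult_right)
    moreover have "pairing \<phi> ?q = 0" if \<phi>: "left_linear E \<phi>" for \<phi>
    proof -
      have "pairing \<phi> ?q = frag_eval (\<lambda>(x, y). a * (x * \<phi> (y * b))) p"
        unfolding pairing_def
        using frag_eval_frag_extend[of "\<lambda>(x, y). x * \<phi> y" "\<lambda>(x, y). (a * x, y * b)" p]
        by (simp add: case_prod_unfold mult.assoc)
      also have "\<dots> = a * pairing (\<lambda>y. \<phi> (y * b)) p"
        unfolding pairing_def frag_eval_def sum_distrib_left case_prod_unfold
        by (intro sum.cong refl) (metis mult.assoc mult_of_int_commute)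
      also have "left_linear E (\<lambda>y. \<phi> (y * b))"
        using \<phi> by (simp add: left_linear_def distrib_right mult.assoc)
      then have "pairing (\<lambda>y. \<phi> (y * b)) p = 0"
        using p(2) by (simp add: annihilated_def)
      finally show ?thesis by simp
    qed
    ultimately show ?thesis
      by (auto simp: tensor_kernel_def annihilated_def)
  qed
  ultimately show ?thesis
    by (auto simp: sub_bimodule_def)
qed

lemma annihilated_mono:
  assumes "E \<subseteq> E'"
  shows "annihilated E \<subseteq> annihilated E'"
proof -
  have "left_linear E \<phi>" if "left_linear E' \<phi>" for \<phi>
    using that assms unfolding left_linear_def by blast
  then show ?thesis
    unfolding annihilated_def by blast
qed

lemma tensor_kernel_inject:
  assumes E: "division_subalgebra scale E" and E': "division_subalgebra scale E'"
    and "E \<subseteq> E'" and eq: "tensor_kernel E = tensor_kernel E'"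
  shows "E = E'"
proof (rule ccontr)
  assume "E \<noteq> E'"
  then obtain x where x: "x \<in> E'" "x \<notin> E"
    using \<open>E \<subseteq> E'\<close> by blast
  let ?p = "frag_of (x, 1) - frag_of (1, x)"
  \<comment> \<open>\<open>x\<close> is a scalar for \<open>E'\<close>, so both terms pair to x *
    \<phi> 1.\<close>
  have "pairing \<phi> ?p = 0" if "left_linear E' \<phi>" for \<phi>
  proof -
    have "\<phi> (x * 1) = x * \<phi> 1"
      using that x(1) unfolding left_linear_def by blast
    then show ?thesis
      by (simp add: pairing_def)
  qed
  then have "self.coset ?p \<in> tensor_kernel E'"
    by (auto simp: tensor_kernel_def annihilated_def)
  then obtain q where q: "q \<in> annihilated E" "self.coset ?p = self.coset q"
    unfolding eq[symmetric] by (auto simp: tensor_kernel_def)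
  then have "?p - q \<in> annihilated E"
    using null_subset_annihilated[OF E] self.coset_eq_iff[OF free_UNIV free_UNIV] by blast
  then have p: "pairing \<phi> ?p = 0" if "left_linear E \<phi>" for \<phi>
    using q(1) that by (simp add: annihilated_def pairing_def)
  \<comment> \<open>For this \<phi> the pairing of \<open>?p\<close> is x * \<phi> 1 - \<phi> x =
    -1.\<close>
  obtain \<phi> where "left_linear E \<phi>" "\<phi> 1 = 0" "\<phi> x = 1"
    using exists_left_linear_separating[of E x] division_subalgebraD[OF E] x(2) by blast
  then show False
    using p[of \<phi>] by (simp add: pairing_def)
qed

theorem acc_division_subalgebras:
  assumes "noetherian_self_tensor scale"
  shows "acc (division_subalgebra scale)"
proof (rule acc_injective_image[where f = tensor_kernel])
  show "acc (sub_bimodule scale)"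
    using assms by (simp add: noetherian_self_tensor_def)
  show "sub_bimodule scale (tensor_kernel U)" for U
    by (rule sub_bimodule_tensor_kernel)
  show "tensor_kernel U \<subseteq> tensor_kernel Y" if "U \<subseteq> Y" for U Y
    unfolding tensor_kernel_def using annihilated_mono[OF that] by (rule image_mono)
qed (rule tensor_kernel_inject)

text \<open>Hulls of finite subsets of \<open>E\<close> are division subalgebras, so they cannot
  grow forever. Once such a hull equals \<open>E\<close>, any division subalgebra that contains the
  generators contains \<open>E\<close>.\<close>

lemma fin_gen_division_subalgebra:
  assumes acc: "acc (division_subalgebra scale)" and E: "division_subalgebra scale E"
  shows "fin_gen_division_algebra scale E"
proof -
  let ?P = "division_subalgebra scale"
  have hull: "?P (?P hull Z)" for Z
    by (rule hull_in) (auto intro!: division_subalgebraI dest: division_subalgebraD)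
  have "\<exists>Z. finite Z \<and> Z \<subseteq> E \<and> ?P hull Z = E"
  proof (rule finitely_generated_if_acc)
    show "acc (\<lambda>C. \<exists>Z. finite Z \<and> Z \<subseteq> E \<and> C = ?P hull Z)"
      by (rule acc_injective_image[OF acc, of _ id]) (auto simp: hull)
  qed (auto simp: hull_inc hull_minimal E dest: hull_mono)
  then obtain Z where Z: "finite Z" "Z \<subseteq> E" "?P hull Z = E"
    by blast
  show ?thesis
    unfolding fin_gen_division_algebra_def
    using Z hull_minimal[of Z _ ?P] by (intro exI[of _ Z]) blast
qed

end

section \<open>Finitely generated abelian groups\<close>

context comm_group
begin

text \<open>Index sets are arbitrary sets of naturals rather than intervals, because the minimality
  argument below removes an arbitrary index; renumbering happens once, in
  \<open>ex_basis_modulo_torsion\<close>.\<close>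

definition comb :: "nat set \<Rightarrow> (nat \<Rightarrow> 'a) \<Rightarrow> (nat \<Rightarrow> int) \<Rightarrow> 'a" where
  "comb I x a = (\<Otimes>i\<in>I. x i [^] a i)"

lemma comb_closed [simp]: "x \<in> I \<rightarrow> carrier G \<Longrightarrow> comb I x a \<in> carrier G"
  unfolding comb_def by (intro finprod_closed) auto

lemma comb_empty [simp]: "comb {} x a = \<one>"
  by (simp add: comb_def)

lemma comb_insert:
  assumes "finite I" "i \<notin> I" "x \<in> insert i I \<rightarrow> carrier G"
  shows "comb (insert i I) x a = x i [^] a i \<otimes> comb I x a"
  unfolding comb_def using assms by (subst finprod_insert) auto

lemma comb_cong:
  assumes "x \<in> I \<rightarrow> carrier G" "\<And>i. i \<in> I \<Longrightarrow> x i = y i" "\<And>i. i \<in> I \<Longrightarrow> a i = b i"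
  shows "comb I x a = comb I y b"
  unfolding comb_def using assms by (intro finprod_cong') (auto simp: Pi_iff)

lemma comb_add:
  assumes "x \<in> I \<rightarrow> carrier G"
  shows "comb I x (\<lambda>i. a i + b i) = comb I x a \<otimes> comb I x b"
proof -
  have "comb I x (\<lambda>i. a i + b i) = (\<Otimes>i\<in>I. x i [^] a i \<otimes> x i [^] b i)"
    unfolding comb_def using assms by (intro finprod_cong') (auto simp: int_pow_mult Pi_iff)
  then show ?thesis
    unfolding comb_def using assms by (simp add: Pi_iff)
qed

lemma comb_zero: "x \<in> I \<rightarrow> carrier G \<Longrightarrow> (\<And>i. i \<in> I \<Longrightarrow> a i = 0) \<Longrightarrow> comb I x a = \<one>"
  unfolding comb_def by (intro finprod_one_eqI) auto

lemma comb_uminus: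
  assumes "x \<in> I \<rightarrow> carrier G"
  shows "comb I x (\<lambda>i. - a i) = inv (comb I x a)"
proof -
  have "comb I x (\<lambda>i. - a i) \<otimes> comb I x a = \<one>"
    using comb_add[OF assms, of "\<lambda>i. - a i" a] comb_zero[OF assms] by simp
  then show ?thesis
    using assms by (metis comb_closed inv_equality)
qed

lemma comb_single:
  assumes "finite I" "i \<in> I" "x \<in> I \<rightarrow> carrier G" "\<And>j. j \<in> I \<Longrightarrow> j \<noteq> i \<Longrightarrow> a j = 0"
  shows "comb I x a = x i [^] a i"
proof -
  have "comb (insert i (I - {i})) x a = x i [^] a i \<otimes> comb (I - {i}) x a"
    using assms(1-3) by (intro comb_insert) auto
  also have "comb (I - {i}) x a = \<one>"
    using assms(3,4) by (intro comb_zero) auto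
  finally show ?thesis
    using assms(2,3) by (simp add: insert_absorb Pi_iff)
qed

text \<open>The step of the Euclidean algorithm on the exponents \<open>b i\<close> and \<open>b j\<close>.\<close>

lemma comb_shear:
  assumes I: "finite I" "i \<in> I" "j \<in> I" "i \<noteq> j" and x: "x \<in> I \<rightarrow> carrier G"
  shows "comb I (x(j := x j \<otimes> x i [^] (e::int))) (b(i := b i - e * b j)) = comb I x b"
proof -
  let ?J = "I - {i, j}" and ?y = "x(j := x j \<otimes> x i [^] e)" and ?c = "b(i := b i - e * b j)"
  have I_eq: "I = insert i (insert j ?J)"
    using I by auto
  have xc: "x i \<in> carrier G" "x j \<in> carrier G"
    using I x by auto
  have split: "comb I y a = y i [^] a i \<otimes> (y j [^] a j \<otimes> comb ?J y a)" if "y \<in> I \<rightarrow> carrier G" for y a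
  proof -
    have "comb (insert i (insert j ?J)) y a = y i [^] a i \<otimes> comb (insert j ?J) y a"
      using I that by (intro comb_insert) auto
    also have "comb (insert j ?J) y a = y j [^] a j \<otimes> comb ?J y a"
      using I that by (intro comb_insert) auto
    finally show ?thesis
      using I_eq by metis
  qed
  have J: "comb ?J ?y ?c = comb ?J x b"
    using x xc by (intro comb_cong) auto
  have Jc: "comb ?J x b \<in> carrier G"
    using x by (intro comb_closed) auto
  have "comb I ?y ?c = x i [^] (b i - e * b j) \<otimes> ((x j \<otimes> x i [^] e) [^] b j \<otimes> comb ?J x b)"
    using split[of ?y ?c] x xc I(4) J by (auto simp: Pi_iff)
  also have "(x j \<otimes> x i [^] e) [^] b j = x j [^] b j \<otimes> x i [^] (e * b j)"
    using xc by (simp add: int_pow_distrib int_pow_pow)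
  also have "x i [^] (b i - e * b j) \<otimes> (x j [^] b j \<otimes> x i [^] (e * b j) \<otimes> comb ?J x b) =
      (x i [^] (b i - e * b j) \<otimes> x i [^] (e * b j)) \<otimes> (x j [^] b j \<otimes> comb ?J x b)"
    using xc Jc by (simp add: m_ac)
  also have "x i [^] (b i - e * b j) \<otimes> x i [^] (e * b j) = x i [^] b i"
    using xc by (simp flip: int_pow_mult)
  finally show ?thesis
    by (simp only: split[OF x])
qed

text \<open>In an abelian group the products of an element of the smaller group with a power of
  \<open>g\<close> already form a subgroup. This drives the later inductions over finite generating
  sets.\<close>

lemma generate_insert_decompose:
  assumes "Z \<subseteq> carrier G" "g \<in> carrier G" "x \<in> generate G (insert g Z)"
  shows "\<exists>h\<in>generate G Z. \<exists>k::int. x = h \<otimes> g [^] k"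
proof -
  define H where "H = {h \<otimes> g [^] k | h k. h \<in> generate G Z \<and> k \<in> (UNIV :: int set)}"
  have gen: "subgroup (generate G Z) G"
    by (rule generate_is_subgroup[OF assms(1)])
  note carr = subgroup.mem_carrier[OF gen]
  have "subgroup H G"
  proof (rule subgroupI)
    show "H \<subseteq> carrier G"
      using carr assms(2) by (auto simp: H_def)
    show "H \<noteq> {}"
      using subgroup.one_closed[OF gen] by (auto simp: H_def)
  next
    fix a assume "a \<in> H"
    then obtain h and k :: int where *: "a = h \<otimes> g [^] k" "h \<in> generate G Z"
      by (auto simp: H_def)
    then have "inv a = inv h \<otimes> g [^] (- k)"
      using carr assms(2) by (simp add: inv_mult int_pow_neg)
    then show "inv a \<in> H"
      using subgroup.m_inv_closed[OF gen *(2)] unfolding H_def by blast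
  next
    fix a b assume "a \<in> H" "b \<in> H"
    then obtain h h' and k l :: int where *: "a = h \<otimes> g [^] k" "h \<in> generate G Z"
      "b = h' \<otimes> g [^] l" "h' \<in> generate G Z"
      by (auto simp: H_def)
    then have "a \<otimes> b = (h \<otimes> h') \<otimes> g [^] (k + l)"
      using carr assms(2) by (simp add: int_pow_mult m_ac)
    then show "a \<otimes> b \<in> H"
      using subgroup.m_closed[OF gen *(2,4)] unfolding H_def by blast
  qed
  moreover have "insert g Z \<subseteq> H"
  proof -
    have "g = \<one> \<otimes> g [^] (1::int)"
      using assms(2) by (simp add: int_pow_1)
    moreover have "z = z \<otimes> g [^] (0::int)" if "z \<in> Z" for z
      using assms(1) that by auto
    ultimately show ?thesis
      using subgroup.one_closed[OF gen] generate.incl[of _ Z G]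
      by (auto simp only: H_def)
  qed
  ultimately have "generate G (insert g Z) \<subseteq> H"
    by (rule generate_subgroup_incl[rotated])
  then show ?thesis
    using assms(3) unfolding H_def by blast
qed

section \<open>Torsion and families that span modulo torsion\<close>

lemma torsion_part_iff: "g \<in> torsion_part G \<longleftrightarrow> g \<in> carrier G \<and> (\<exists>n::nat. n > 0 \<and> g [^] n = \<one>)"
  by (auto simp: torsion_part_def)

lemma subgroup_torsion_part: "subgroup (torsion_part G) G"
proof (rule subgroupI)
  have "\<one> \<in> torsion_part G"
    by (auto simp: torsion_part_iff)
  then show "torsion_part G \<noteq> {}"
    by blast
next
  fix a assume "a \<in> torsion_part G"
  then show "inv a \<in> torsion_part G"
    by (auto simp: torsion_part_iff nat_pow_inv)
next
  fix a b assume "a \<in> torsion_part G" "b \<in> torsion_part G"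
  then obtain m n :: nat where *: "a \<in> carrier G" "b \<in> carrier G" "m > 0" "n > 0" "a [^] m = \<one>" "b [^] n = \<one>"
    by (auto simp: torsion_part_iff)
  have "(a \<otimes> b) [^] (m * n) = a [^] (m * n) \<otimes> b [^] (n * m)"
    using * by (simp add: nat_pow_distrib mult.commute)
  also have "\<dots> = (a [^] m) [^] n \<otimes> (b [^] n) [^] m"
    by (simp only: nat_pow_pow *(1,2))
  finally have "(a \<otimes> b) [^] (m * n) = \<one>"
    using * by simp
  moreover have "m * n > 0"
    using * by simp
  ultimately show "a \<otimes> b \<in> torsion_part G"
    using *(1,2) unfolding torsion_part_iff by blast
qed (auto simp: torsion_part_def)

lemma torsion_part_root:
  assumes g: "g \<in> carrier G" and k: "g [^] (k::int) \<in> torsion_part G" "k \<noteq> 0"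
  shows "g \<in> torsion_part G"
proof -
  define m where "m = nat \<bar>k\<bar>"
  have "g [^] \<bar>k\<bar> \<in> torsion_part G"
    using k subgroup.m_inv_closed[OF subgroup_torsion_part] g by (cases "k \<ge> 0") (auto simp: int_pow_neg)
  then have "g [^] m \<in> torsion_part G"
    by (simp add: m_def flip: int_pow_int)
  then obtain n :: nat where "n > 0" "(g [^] m) [^] n = \<one>"
    by (auto simp: torsion_part_iff)
  moreover have "m > 0"
    using k(2) by (simp add: m_def)
  ultimately have "g [^] (m * n) = \<one>" "m * n > 0"
    using g by (auto simp: nat_pow_pow)
  then show ?thesis
    using g torsion_part_iff by blast
qed

text \<open>The torsion factor is what allows a torsion member of the family to be
  discarded.\<close>

definition spans :: "nat set \<Rightarrow> (nat \<Rightarrow> 'a) \<Rightarrow> bool" where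
  "spans I x \<longleftrightarrow> x \<in> I \<rightarrow> carrier G \<and> (\<forall>g\<in>carrier G. \<exists>t\<in>torsion_part G. \<exists>a. g = t \<otimes> comb I x a)"

lemma ex_spans:
  assumes "finitely_generated_group G"
  shows "\<exists>I x. finite I \<and> spans I x"
proof -
  obtain Z where Z: "finite Z" "Z \<subseteq> carrier G" "generate G Z = carrier G"
    using assms by (auto simp: finitely_generated_group_def)
  have "\<exists>n x. x \<in> {..<n::nat} \<rightarrow> carrier G \<and> (\<forall>h\<in>generate G Z. \<exists>a. h = comb {..<n} x a)"
    using Z(1,2)
  proof (induction Z rule: finite_induct)
    case empty
    show ?case
      by (intro exI[of _ 0]) (auto simp: generate_empty)
  next
    case (insert g Z)
    then obtain n x where nx: "x \<in> {..<n::nat} \<rightarrow> carrier G" "\<And>h. h \<in> generate G Z \<Longrightarrow> \<exists>a. h = comb {..<n} x a"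
      by auto
    let ?y = "x(n := g)"
    have y: "?y \<in> {..<Suc n} \<rightarrow> carrier G"
      using nx(1) insert(4) by (auto simp: Pi_iff less_Suc_eq)
    have "\<exists>a. h = comb {..<Suc n} ?y a" if h: "h \<in> generate G (insert g Z)" for h
    proof -
      obtain h' and k :: int where h': "h' \<in> generate G Z" "h = h' \<otimes> g [^] k"
        using generate_insert_decompose[OF _ _ h] insert(4) by auto
      obtain a where a: "h' = comb {..<n} x a"
        using nx(2)[OF h'(1)] by blast
      have "comb (insert n {..<n}) ?y (a(n := k)) = g [^] k \<otimes> comb {..<n} ?y (a(n := k))"
        using y by (subst comb_insert) (auto simp: lessThan_Suc)
      also have "comb {..<n} ?y (a(n := k)) = h'"
        unfolding a using nx(1) by (intro comb_cong[symmetric]) auto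
      also have "g [^] k \<otimes> h' = h"
        using h' a nx(1) insert(4) by (simp add: m_comm)
      finally show ?thesis
        unfolding lessThan_Suc by metis
    qed
    then show ?case
      using y by blast
  qed
  then obtain n x where nx: "x \<in> {..<n::nat} \<rightarrow> carrier G" "\<And>h. h \<in> carrier G \<Longrightarrow> \<exists>a. h = comb {..<n} x a"
    unfolding Z(3) by blast
  have "\<exists>t\<in>torsion_part G. \<exists>a. g = t \<otimes> comb {..<n} x a" if "g \<in> carrier G" for g
    using nx(2)[OF that] that subgroup.one_closed[OF subgroup_torsion_part] l_one by metis
  then have "spans {..<n} x"
    using nx(1) by (simp add: spans_def)
  then show ?thesis
    by blast
qed

text \<open>Induction on the sum of the absolute values of the exponents, for all spanning families
  indexed by \<open>I\<close> at once. With two nonzero exponents, a shear shortens one of them and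
  preserves both the span and the combination; with just one, that member of the family is torsion
  and could be dropped, against minimality.\<close>

lemma minimal_spans_independent:
  assumes min: "\<And>J y. finite J \<Longrightarrow> spans J y \<Longrightarrow> card I \<le> card J" and I: "finite I"
    and "spans I x" "comb I x a \<in> torsion_part G" "i \<in> I"
  shows "a i = 0"
  using assms(3-)
proof (induction "\<Sum>i\<in>I. nat \<bar>a i\<bar>" arbitrary: x a i rule: less_induct)
  case less
  note T = subgroup_torsion_part
  have x: "x \<in> I \<rightarrow> carrier G" and span: "\<And>g. g \<in> carrier G \<Longrightarrow> \<exists>t\<in>torsion_part G. \<exists>a. g = t \<otimes> comb I x a"
    using less.prems(1) by (auto simp: spans_def)
  show ?case
  proof (rule ccontr)
    assume i: "a i \<noteq> 0"
    show False
    proof (cases "\<exists>j\<in>I. j \<noteq> i \<and> a j \<noteq> 0")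
      case False
      then have "comb I x a = x i [^] a i"
        using I less.prems(3) x by (intro comb_single) auto
      then have xi: "x i \<in> torsion_part G"
        using torsion_part_root[of "x i" "a i"] i less.prems(2,3) x by auto
      have "spans (I - {i}) x"
        unfolding spans_def
      proof (intro conjI ballI)
        show xI: "x \<in> I - {i} \<rightarrow> carrier G"
          using x by auto
        fix g assume "g \<in> carrier G"
        then obtain t b where tb: "t \<in> torsion_part G" "g = t \<otimes> comb I x b"
          using span by blast
        have "comb (insert i (I - {i})) x b = x i [^] b i \<otimes> comb (I - {i}) x b"
          using I x less.prems(3) by (intro comb_insert) auto
        then have "g = t \<otimes> (x i [^] b i \<otimes> comb (I - {i}) x b)"
          using tb(2) less.prems(3) by (simp add: insert_absorb)
        also have "\<dots> = (t \<otimes> x i [^] b i) \<otimes> comb (I - {i}) x b"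
          using subgroup.mem_carrier[OF T] tb(1) xi xI by (simp add: m_assoc)
        finally show "\<exists>t\<in>torsion_part G. \<exists>a. g = t \<otimes> comb (I - {i}) x a"
          using subgroup.m_closed[OF T tb(1)] subgroup_int_pow_closed[OF T xi] by blast
      qed
      then have "card I \<le> card (I - {i})"
        using I by (intro min) auto
      then show False
        using I less.prems(3) by (meson card_Diff1_less not_le)
    next
      case True
      then obtain j where j: "j \<in> I" "j \<noteq> i" "a j \<noteq> 0"
        by blast
      have *: False if kl: "k \<in> I" "l \<in> I" "k \<noteq> l" "a k \<noteq> 0" "a l \<noteq> 0" "\<bar>a l\<bar> \<le> \<bar>a k\<bar>" for k l
      proof -
        \<comment> \<open>With this sign, \<open>a k - e * a l\<close> has absolute value |a k| - |a
          l|, which is smaller than |a k| because a l is nonzero.\<close>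
        define e where "e = sgn (a k) * sgn (a l)"
        define y where "y = x(l := x l \<otimes> x k [^] e)"
        define b where "b = a(k := a k - e * a l)"
        have shear: "comb I y (c(k := c k - e * c l)) = comb I x c" for c
          unfolding y_def by (rule comb_shear[OF I kl(1-3) x])
        have "\<bar>a k - e * a l\<bar> < \<bar>a k\<bar>"
          using kl(4-6) unfolding e_def by (auto simp: sgn_if)
        then have "(\<Sum>i\<in>I. nat \<bar>b i\<bar>) < (\<Sum>i\<in>I. nat \<bar>a i\<bar>)"
          using I kl(1) by (intro sum_strict_mono_ex1) (auto simp: b_def)
        moreover have "spans I y"
          unfolding spans_def
        proof (intro conjI ballI)
          show "y \<in> I \<rightarrow> carrier G"
            using x kl by (auto simp: y_def Pi_iff)
          show "\<exists>t\<in>torsion_part G. \<exists>a. g = t \<otimes> comb I y a" if "g \<in> carrier G" for g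
            using span[OF that] shear by metis
        qed
        moreover have "comb I y b \<in> torsion_part G"
          unfolding b_def shear by (rule less.prems(2))
        \<comment> \<open>The induction hypothesis covers every index, in particular
          \<open>l\<close>, whose exponent the shear left unchanged and nonzero.\<close>
        ultimately have "b l = 0"
          using less.hyps kl(2) by blast
        then show False
          using kl by (simp add: b_def)
      qed
      show False
        using *[of i j] *[of j i] i j less.prems(3) by linarith
    qed
  qed
qed

text \<open>A spanning family of least size, renumbered along a bijection with an interval;
  exponents are carried back by the inverse bijection.\<close>

theorem ex_basis_modulo_torsion:
  assumes "finitely_generated_group G"
  obtains r x where "spans {1..r::nat} x"
    "\<And>a i. comb {1..r} x a \<in> torsion_part G \<Longrightarrow> i \<in> {1..r} \<Longrightarrow> a i = 0"
proof -
  define P where "P = (\<lambda>n. \<exists>I x. finite I \<and> spans I x \<and> card I = n)"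
  have P_iff: "P n \<longleftrightarrow> (\<exists>I x. finite I \<and> spans I x \<and> card I = n)" for n
    by (simp add: P_def)
  have "\<exists>n. P n"
    using ex_spans[OF assms] unfolding P_iff by blast
  then have "P (LEAST n. P n)"
    by (rule LeastI_ex)
  then obtain I x where I: "finite I" "spans I x" "card I = (LEAST n. P n)"
    unfolding P_iff[of "LEAST n. P n"] by blast
  have min: "card I \<le> card J" if "finite J" "spans J y" for J y
    unfolding I(3) using that P_iff by (intro Least_le) blast
  obtain h where h: "bij_betw h {1..card I} I"
    using ex_bij_betw_nat_finite_1[OF I(1)] by blast
  then have h': "h ` {1..card I} = I" "inj_on h {1..card I}"
    by (auto simp: bij_betw_def)
  have x: "x \<in> I \<rightarrow> carrier G"
    using I(2) by (simp add: spans_def)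
  have reindex: "comb {1..card I} (\<lambda>i. x (h i)) (\<lambda>i. a (h i)) = comb I x a" for a
  proof -
    have "(\<lambda>i. x i [^] a i) \<in> h ` {1..card I} \<rightarrow> carrier G"
      using x h'(1) by auto
    from finprod_reindex[OF this h'(2)] show ?thesis
      by (simp only: comb_def h'(1))
  qed
  have xh: "(\<lambda>i. x (h i)) \<in> {1..card I} \<rightarrow> carrier G"
    using x h'(1) by blast
  show thesis
  proof (rule that)
    show "spans {1..card I} (\<lambda>i. x (h i))"
      unfolding spans_def
    proof (intro conjI ballI)
      fix g assume "g \<in> carrier G"
      then obtain t a where "t \<in> torsion_part G" "g = t \<otimes> comb I x a"
        using I(2) by (auto simp: spans_def)
      then show "\<exists>t\<in>torsion_part G. \<exists>a. g = t \<otimes> comb {1..card I} (\<lambda>i. x (h i)) a"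
        using reindex by metis
    qed (rule xh)
    fix a i assume a: "comb {1..card I} (\<lambda>i. x (h i)) a \<in> torsion_part G" and i: "i \<in> {1..card I}"
    define b where "b = (\<lambda>j. a (inv_into {1..card I} h j))"
    have bh: "b (h i) = a i" if "i \<in> {1..card I}" for i
      unfolding b_def using inv_into_f_f[OF h'(2) that] by simp
    have "comb {1..card I} (\<lambda>i. x (h i)) a = comb {1..card I} (\<lambda>i. x (h i)) (\<lambda>i. b (h i))"
      using bh by (intro comb_cong[OF xh]) auto
    then have "comb I x b \<in> torsion_part G"
      using a reindex[of b] by simp
    then have "b (h i) = 0"
      using h'(1) i by (intro minimal_spans_independent[of I x b "h i"] min I(1,2)) auto
    then show "a i = 0"
      using bh[OF i] by simp
  qed
qed

text \<open>The exponent of a torsion generator matters only modulo its order, so each new generator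
  multiplies the size by a bounded factor.\<close>

lemma finite_generate_torsion:
  assumes "finite Z" "Z \<subseteq> torsion_part G"
  shows "finite (generate G Z)"
  using assms
proof (induction Z rule: finite_induct)
  case empty
  show ?case by (simp add: generate_empty)
next
  case (insert g Z)
  obtain n :: nat where n: "g \<in> carrier G" "n > 0" "g [^] n = \<one>"
    using insert(4) by (auto simp: torsion_part_iff)
  have Z: "Z \<subseteq> carrier G"
    using insert(4) by (auto simp: torsion_part_iff)
  have "generate G (insert g Z) \<subseteq> (\<lambda>(h, k). h \<otimes> g [^] k) ` (generate G Z \<times> {0..<int n})"
  proof
    fix y assume "y \<in> generate G (insert g Z)"
    then obtain h and k :: int where hk: "h \<in> generate G Z" "y = h \<otimes> g [^] k"
      using generate_insert_decompose[OF Z n(1)] by blast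
    have "g [^] k = g [^] (int n * (k div int n) + k mod int n)"
      by simp
    also have "\<dots> = (g [^] int n) [^] (k div int n) \<otimes> g [^] (k mod int n)"
      using n(1) by (simp only: int_pow_mult int_pow_pow)
    also have "\<dots> = g [^] (k mod int n)"
      using n by (simp add: int_pow_int)
    finally show "y \<in> (\<lambda>(h, k). h \<otimes> g [^] k) ` (generate G Z \<times> {0..<int n})"
      using hk n(2) by (intro image_eqI[of _ _ "(h, k mod int n)"]) auto
  qed
  then show ?case
    using insert by (auto intro: finite_subset)
qed

end

section \<open>Groups with a finite basis modulo torsion\<close>

locale basis_modulo_torsion = comm_group G
  for G :: "('a, 'b) monoid_scheme" (structure) +
  fixes I :: "nat set" and x :: "nat \<Rightarrow> 'a"
  assumes finite_I [simp]: "finite I" and spans: "spans I x"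
    and independent: "comb I x a \<in> torsion_part G \<Longrightarrow> i \<in> I \<Longrightarrow> a i = 0"
begin

lemma x_closed: "x \<in> I \<rightarrow> carrier G"
  using spans by (simp add: spans_def)

lemma decompose: "g \<in> carrier G \<Longrightarrow> \<exists>t\<in>torsion_part G. \<exists>a. g = t \<otimes> comb I x a"
  using spans by (simp add: spans_def)

text \<open>The quotient of the two combinations is a torsion element, so independence equates the
  exponents on \<open>I\<close>; cancelling the combination then equates the torsion
  factors.\<close>

lemma decompose_unique:
  assumes "t \<in> torsion_part G" "t' \<in> torsion_part G" "t \<otimes> comb I x a = t' \<otimes> comb I x b"
  shows "i \<in> I \<Longrightarrow> a i = b i" "t = t'"
proof -
  note T = subgroup_torsion_part
  have tc: "t \<in> carrier G" "t' \<in> carrier G"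
    using assms(1,2) subgroup.mem_carrier[OF T] by auto
  have cc: "comb I x c \<in> carrier G" for c
    by (rule comb_closed[OF x_closed])
  have "comb I x (\<lambda>i. a i + - b i) = comb I x a \<otimes> inv (comb I x b)"
    by (simp only: comb_add[OF x_closed] comb_uminus[OF x_closed])
  also have "\<dots> = inv t \<otimes> (t \<otimes> comb I x a) \<otimes> inv (comb I x b)"
    using tc cc by (simp flip: m_assoc)
  also have "\<dots> = inv t \<otimes> t'"
    unfolding assms(3) using tc cc by (simp add: m_assoc)
  also have "\<dots> \<in> torsion_part G"
    using assms(1,2) T by (intro subgroup.m_closed subgroup.m_inv_closed)
  finally have eq: "a i = b i" if "i \<in> I" for i
    using independent[of "\<lambda>i. a i + - b i"] that by fastforce
  then show "i \<in> I \<Longrightarrow> a i = b i"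
    by blast
  have "comb I x a = comb I x b"
    using eq by (intro comb_cong[OF x_closed]) auto
  then show "t = t'"
    using assms(3) tc cc by simp
qed

lemma iso_torsion_times_free:
  "G \<cong> G\<lparr>carrier := torsion_part G\<rparr> \<times>\<times> product_group I (\<lambda>_. integer_group)"
proof -
  let ?T = "G\<lparr>carrier := torsion_part G\<rparr>" and ?Z = "product_group I (\<lambda>_. integer_group)"
  let ?\<psi> = "\<lambda>(t, a). t \<otimes> comb I x a"
  note T = subgroup_torsion_part
  have cc: "comb I x c \<in> carrier G" for c
    by (rule comb_closed[OF x_closed])
  interpret TZ: group "?T \<times>\<times> ?Z"
    by (intro DirProd_group subgroup.subgroup_is_group[OF T] group_axioms product_group group_integer_group)
  have "?\<psi> \<in> iso (?T \<times>\<times> ?Z) G"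
  proof (rule isoI)
    show "?\<psi> \<in> hom (?T \<times>\<times> ?Z) G"
    proof (rule homI)
      fix p q assume "p \<in> carrier (?T \<times>\<times> ?Z)" "q \<in> carrier (?T \<times>\<times> ?Z)"
      then obtain t a s b where pq: "p = (t, a)" "q = (s, b)" "t \<in> carrier G" "s \<in> carrier G"
        using subgroup.mem_carrier[OF T] by auto
      \<comment> \<open>Products in \<open>product_group\<close> are restricted to \<open>I\<close>,
        and \<open>comb\<close> ignores all values elsewhere.\<close>
      have "comb I x (\<lambda>i\<in>I. a i + b i) = comb I x (\<lambda>i. a i + b i)"
        by (intro comb_cong[OF x_closed]) auto
      then show "?\<psi> (p \<otimes>\<^bsub>?T \<times>\<times> ?Z\<^esub> q) = ?\<psi> p \<otimes> ?\<psi> q"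
        using pq cc by (simp add: comb_add[OF x_closed] m_ac)
    qed (use cc subgroup.mem_carrier[OF T] in auto)
    show "bij_betw ?\<psi> (carrier (?T \<times>\<times> ?Z)) (carrier G)"
      unfolding bij_betw_def
    proof
      show "inj_on ?\<psi> (carrier (?T \<times>\<times> ?Z))"
      proof (rule inj_onI)
        fix p q assume "p \<in> carrier (?T \<times>\<times> ?Z)" "q \<in> carrier (?T \<times>\<times> ?Z)" and eq: "?\<psi> p = ?\<psi> q"
        then obtain t a s b where pq: "p = (t, a)" "q = (s, b)" "t \<in> torsion_part G" "s \<in> torsion_part G"
          "a \<in> I \<rightarrow>\<^sub>E UNIV" "b \<in> I \<rightarrow>\<^sub>E UNIV"
          by auto
        then show "p = q"
          using decompose_unique[of t s a b] eq PiE_ext[of a "I" _ b] by auto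
      qed
      show "?\<psi> ` carrier (?T \<times>\<times> ?Z) = carrier G"
      proof
        show "?\<psi> ` carrier (?T \<times>\<times> ?Z) \<subseteq> carrier G"
          using cc subgroup.mem_carrier[OF T] by auto
        show "carrier G \<subseteq> ?\<psi> ` carrier (?T \<times>\<times> ?Z)"
        proof
          fix g assume "g \<in> carrier G"
          then obtain t a where ta: "t \<in> torsion_part G" "g = t \<otimes> comb I x a"
            using decompose by blast
          have "comb I x (restrict a I) = comb I x a"
            by (intro comb_cong[OF x_closed]) auto
          then show "g \<in> ?\<psi> ` carrier (?T \<times>\<times> ?Z)"
            using ta by (intro image_eqI[of _ _ "(t, restrict a I)"]) auto
        qed
      qed
    qed
  qed
  then show ?thesis
    using TZ.iso_sym is_isoI by blast
qed

text \<open>For J = {1..n} these are the groups of weights at the successive stages of the skew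
  Laurent tower.\<close>

definition torsion_plus :: "nat set \<Rightarrow> 'a set" where
  "torsion_plus J = {t \<otimes> comb J x a | t a. t \<in> torsion_part G}"

lemma torsion_plus_empty: "torsion_plus {} = torsion_part G"
  using subgroup.mem_carrier[OF subgroup_torsion_part] by (force simp: torsion_plus_def)

lemma torsion_plus_full: "torsion_plus I = carrier G"
  using decompose subgroup.mem_carrier[OF subgroup_torsion_part] comb_closed[OF x_closed]
  by (auto simp: torsion_plus_def)

lemma x_closed_subset: "J \<subseteq> I \<Longrightarrow> x \<in> J \<rightarrow> carrier G"
  using x_closed by auto

lemma subgroup_torsion_plus:
  assumes J: "J \<subseteq> I"
  shows "subgroup (torsion_plus J) G"
proof (rule subgroupI)
  note T = subgroup_torsion_part and cc = comb_closed[OF x_closed_subset[OF J]]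
    and Tc = subgroup.mem_carrier[OF subgroup_torsion_part]
  show "torsion_plus J \<subseteq> carrier G"
    using Tc cc by (auto simp: torsion_plus_def)
  show "torsion_plus J \<noteq> {}"
    using subgroup.one_closed[OF T] unfolding torsion_plus_def by blast
  fix g assume "g \<in> torsion_plus J"
  then obtain t a where g: "g = t \<otimes> comb J x a" "t \<in> torsion_part G"
    by (auto simp: torsion_plus_def)
  then have "inv g = inv t \<otimes> comb J x (\<lambda>i. - a i)"
    using Tc cc by (simp add: inv_mult comb_uminus[OF x_closed_subset[OF J]])
  then show "inv g \<in> torsion_plus J"
    using subgroup.m_inv_closed[OF T g(2)] unfolding torsion_plus_def by blast
  fix h assume "h \<in> torsion_plus J"
  then obtain s b where h: "h = s \<otimes> comb J x b" "s \<in> torsion_part G"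
    by (auto simp: torsion_plus_def)
  then have "g \<otimes> h = (t \<otimes> s) \<otimes> comb J x (\<lambda>i. a i + b i)"
    using g Tc cc by (simp add: m_ac comb_add[OF x_closed_subset[OF J]])
  then show "g \<otimes> h \<in> torsion_plus J"
    using subgroup.m_closed[OF T g(2) h(2)] unfolding torsion_plus_def by blast
qed

lemma torsion_plus_insert:
  assumes J: "insert i J \<subseteq> I" "i \<notin> J"
  shows "torsion_plus (insert i J) = {h \<otimes> x i [^] k | h k. h \<in> torsion_plus J \<and> k \<in> (UNIV :: int set)}"
proof -
  note Tc = subgroup.mem_carrier[OF subgroup_torsion_part]
  have xc: "x \<in> insert i J \<rightarrow> carrier G" "x \<in> J \<rightarrow> carrier G" "x i \<in> carrier G"
    using x_closed J by auto
  have "finite J"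
    using finite_subset[OF _ finite_I, of J] J by auto
  then have split: "t \<otimes> comb (insert i J) x a = (t \<otimes> comb J x a) \<otimes> x i [^] a i" if "t \<in> torsion_part G" for t a
    using xc Tc[OF that] J by (simp add: comb_insert m_ac)
  have upd: "comb J x (a(i := k)) = comb J x a" for a k
    using J xc by (intro comb_cong) auto
  show ?thesis
  proof (intro subset_antisym subsetI)
    fix g assume "g \<in> torsion_plus (insert i J)"
    then show "g \<in> {h \<otimes> x i [^] k | h k. h \<in> torsion_plus J \<and> k \<in> (UNIV :: int set)}"
      using split unfolding torsion_plus_def by blast
  next
    fix g assume "g \<in> {h \<otimes> x i [^] k | h k. h \<in> torsion_plus J \<and> k \<in> (UNIV :: int set)}"
    then obtain t a and k :: int where "t \<in> torsion_part G" "g = (t \<otimes> comb J x a) \<otimes> x i [^] k"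
      unfolding torsion_plus_def by blast
    then have "g = t \<otimes> comb (insert i J) x (a(i := k))" "t \<in> torsion_part G"
      using split[of t "a(i := k)"] upd by simp_all
    then show "g \<in> torsion_plus (insert i J)"
      unfolding torsion_plus_def by blast
  qed
qed

text \<open>A basis element thus has infinite order modulo an earlier stage; the freeness of the
  Laurent variable rests on this.\<close>

lemma pow_in_torsion_plus:
  assumes J: "insert i J \<subseteq> I" "i \<notin> J" and k: "x i [^] (k::int) \<in> torsion_plus J"
  shows "k = 0"
proof -
  obtain t a where t: "t \<in> torsion_part G" "x i [^] k = t \<otimes> comb J x a"
    using k by (auto simp: torsion_plus_def)
  have xc: "x \<in> J \<rightarrow> carrier G" "x i \<in> carrier G"
    using x_closed J by auto
  \<comment> \<open>The exponents are padded by 0 so that both sides become combinations over the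
    whole of \<open>I\<close>.\<close>
  define b where "b = (\<lambda>j. if j \<in> J then a j else 0)"
  have "comb I x b = comb J x a"
    unfolding comb_def b_def using J x_closed
    by (intro finprod_mono_neutral_cong_right) auto
  then have "t \<otimes> comb I x b = \<one> \<otimes> comb I x (\<lambda>j. if j = i then k else 0)"
    using comb_single[of I i x "\<lambda>j. if j = i then k else 0"] t(2) J x_closed xc(2)
      comb_closed[OF xc(1), of a] subgroup.mem_carrier[OF subgroup_torsion_part t(1)] by simp
  then have "b i = k"
    using decompose_unique(1)[OF t(1) subgroup.one_closed[OF subgroup_torsion_part], of b "\<lambda>j. if j = i then k else 0" i] J by simp
  then show ?thesis
    using J(2) by (simp add: b_def)
qed

subsection \<open>Rank\<close>

text \<open>The values on \<open>I\<close> are the coordinates of \<open>g\<close> modulo torsion;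
  elsewhere the choice is arbitrary.\<close>

definition coord :: "'a \<Rightarrow> nat \<Rightarrow> int" where
  "coord g = (SOME a. \<exists>t\<in>torsion_part G. g = t \<otimes> comb I x a)"

lemma coord: "g \<in> carrier G \<Longrightarrow> \<exists>t\<in>torsion_part G. g = t \<otimes> comb I x (coord g)"
  unfolding coord_def
  by (rule someI_ex[of "\<lambda>a. \<exists>t\<in>torsion_part G. g = t \<otimes> comb I x a"]) (use decompose[of g] in blast)

lemma coord_eq:
  assumes "t \<in> torsion_part G" "g = t \<otimes> comb I x a" "i \<in> I"
  shows "coord g i = a i"
proof -
  have "g \<in> carrier G"
    using assms(1,2) subgroup.mem_carrier[OF subgroup_torsion_part] comb_closed[OF x_closed] by auto
  then obtain s where "s \<in> torsion_part G" "g = s \<otimes> comb I x (coord g)"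
    using coord by blast
  then show ?thesis
    using decompose_unique(1)[of s t "coord g" a i] assms by simp
qed

lemma coord_mult:
  assumes g: "g \<in> carrier G" "h \<in> carrier G" and i: "i \<in> I"
  shows "coord (g \<otimes> h) i = coord g i + coord h i"
proof -
  note T = subgroup_torsion_part
  obtain s t where st: "s \<in> torsion_part G" "g = s \<otimes> comb I x (coord g)"
    "t \<in> torsion_part G" "h = t \<otimes> comb I x (coord h)"
    using coord g by blast
  have "g \<otimes> h = (s \<otimes> comb I x (coord g)) \<otimes> (t \<otimes> comb I x (coord h))"
    using st by simp
  also have "\<dots> = (s \<otimes> t) \<otimes> comb I x (\<lambda>i. coord g i + coord h i)"
    using st(1,3) subgroup.mem_carrier[OF T] comb_closed[OF x_closed]
    by (simp add: comb_add[OF x_closed] m_ac)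
  finally show ?thesis
    by (rule coord_eq[OF subgroup.m_closed[OF T st(1,3)] _ i])
qed

lemma coord_one: "i \<in> I \<Longrightarrow> coord \<one> i = 0"
  using coord_mult[of "\<one>" "\<one>" i] by simp

lemma coord_pow:
  assumes g: "g \<in> carrier G" and i: "i \<in> I"
  shows "coord (g [^] (n::int)) i = n * coord g i"
proof -
  have nat: "coord (g [^] k) i = int k * coord g i" for k :: nat
    by (induction k) (simp_all add: coord_one i coord_mult g algebra_simps nat_pow_Suc)
  have inv: "coord (inv h) i = - coord h i" if "h \<in> carrier G" for h
    using coord_mult[of "inv h" h i] that i coord_one[OF i] by simp
  show ?thesis
  proof (cases n)
    case (nonneg k)
    then show ?thesis by (simp add: int_pow_int nat)
  next
    case (neg k)
    have "g [^] n = inv (g [^] Suc k)"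
      unfolding neg by (rule int_pow_neg_int[OF g])
    then have "coord (g [^] n) i = - (int (Suc k) * coord g i)"
      using inv[of "g [^] Suc k"] nat[of "Suc k"] g by (simp only: nat_pow_closed)
    then show ?thesis
      by (simp add: neg algebra_simps)
  qed
qed

lemma coord_x: "i \<in> I \<Longrightarrow> j \<in> I \<Longrightarrow> coord (x j) i = (if i = j then 1 else 0)"
proof -
  assume ij: "i \<in> I" "j \<in> I"
  have "comb I x (\<lambda>i. if i = j then 1 else 0) = x j [^] (1::int)"
    using comb_single[of "I" j x "\<lambda>i. if i = j then 1 else 0"] ij x_closed by simp
  then have "x j = \<one> \<otimes> comb I x (\<lambda>i. if i = j then 1 else 0)"
    using ij x_closed by (simp add: Pi_iff)
  from coord_eq[OF subgroup.one_closed[OF subgroup_torsion_part] this ij(1)]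
  show ?thesis .
qed

interpretation rank: tensor "add_monoid (ring_of_type_algebra :: rat ring)" G
    "\<lambda>(n::int) (q::rat). of_int n * q" "\<lambda>(n::int) g. g [^] n"
  by (intro tensor.intro comm_group_add_monoid_type tensor_axioms.intro comm_group_axioms) auto

abbreviation "pure q g \<equiv> frag_of (q :: rat, g)"

text \<open>Calculations in the rational tensor product are done on representatives; for members of
  the free group this relation is equality of their cosets.\<close>

definition tcong :: "(rat \<times> 'a \<Rightarrow>\<^sub>0 int) \<Rightarrow> (rat \<times> 'a \<Rightarrow>\<^sub>0 int) \<Rightarrow> bool" where
  "tcong p q \<longleftrightarrow> p - q \<in> rank.null"

lemma tcong_relation:
  "p - q \<in> tensor_relations (add_monoid ring_of_type_algebra) G (\<lambda>(n::int) q. of_int n * q) (\<lambda>(n::int) g. g [^] n) \<Longrightarrow> tcong p q"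
  unfolding tcong_def by (rule rank.in_null_if_relation)

lemma tcong_refl [simp]: "tcong p p"
  using rank.null_zero by (simp only: tcong_def diff_self)

lemma tcong_sym: "tcong p q \<Longrightarrow> tcong q p"
  unfolding tcong_def using rank.null_minus[of "p - q"] by (simp only: minus_diff_eq)

lemma tcong_add: "tcong p q \<Longrightarrow> tcong p' q' \<Longrightarrow> tcong (p + p') (q + q')"
  unfolding tcong_def using rank.null_add[of "p - q" "p' - q'"] by (simp only: add_diff_add)

lemma tcong_trans [trans]: "tcong p q \<Longrightarrow> tcong q s \<Longrightarrow> tcong p s"
  unfolding tcong_def using rank.null_add[of "p - q" "q - s"] by (simp only: diff_add_cancel add_diff_eq)

lemma tcong_diff: "tcong p q \<Longrightarrow> tcong p' q' \<Longrightarrow> tcong (p - p') (q - q')"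
  using tcong_add[of p q "- p'" "- q'"] tcong_sym[of p' q']
  by (simp add: tcong_def)

lemma tcong_sum: "(\<And>i. i \<in> J \<Longrightarrow> tcong (f i) (h i)) \<Longrightarrow> tcong (sum f J) (sum h J)"
  by (induction J rule: infinite_finite_induct) (auto intro: tcong_add)

lemma pure_add_left: "g \<in> carrier G \<Longrightarrow> tcong (pure (q + q') g) (pure q g + pure q' g)"
  by (rule tcong_relation) (auto simp: tensor_relations_def diff_diff_eq[symmetric])

lemma pure_mult_right: "g \<in> carrier G \<Longrightarrow> h \<in> carrier G \<Longrightarrow> tcong (pure q (g \<otimes> h)) (pure q g + pure q h)"
  by (rule tcong_relation) (auto simp: tensor_relations_def diff_diff_eq[symmetric])

lemma pure_scale: "g \<in> carrier G \<Longrightarrow> tcong (pure (of_int n * q) g) (pure q (g [^] n))"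
  by (rule tcong_relation) (auto simp: tensor_relations_def)

lemma tcong_double: "tcong p (p + p) \<Longrightarrow> tcong p 0"
  using tcong_sym[OF tcong_diff[of p "p + p" p p]] by simp

lemma pure_one: "tcong (pure q \<one>) 0"
  using pure_mult_right[of "\<one>" "\<one>" q] by (intro tcong_double) simp

lemma pure_zero: "g \<in> carrier G \<Longrightarrow> tcong (pure 0 g) 0"
  using pure_add_left[of g 0 0] by (intro tcong_double) simp

lemma pure_diff: "g \<in> carrier G \<Longrightarrow> tcong (pure q g - pure q' g) (pure (q - q') g)"
  using tcong_diff[OF pure_add_left[of g "q - q'" q'] tcong_refl[of "pure q' g"]] by simp

text \<open>With n the order of t, write q as n (q / n) and move n across: the second factor becomes
  the neutral element.\<close>

lemma pure_torsion:
  assumes "t \<in> torsion_part G"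
  shows "tcong (pure q t) 0"
proof -
  obtain n :: nat where n: "t \<in> carrier G" "n > 0" "t [^] n = \<one>"
    using assms by (auto simp: torsion_part_iff)
  have "tcong (pure (of_int (int n) * (q / of_nat n)) t) (pure (q / of_nat n) (t [^] int n))"
    by (rule pure_scale[OF n(1)])
  then have "tcong (pure q t) (pure (q / of_nat n) \<one>)"
    using n by (simp add: int_pow_int)
  then show ?thesis
    using pure_one tcong_trans by blast
qed

lemma pure_comb:
  assumes "finite J" "J \<subseteq> I"
  shows "tcong (pure q (comb J x a)) (\<Sum>i\<in>J. pure (q * of_int (a i)) (x i))"
  using assms
proof (induction J rule: finite_induct)
  case empty
  then show ?case by (simp add: pure_one)
next
  case (insert i J)
  have xc: "x \<in> insert i J \<rightarrow> carrier G" "x i \<in> carrier G" "comb J x a \<in> carrier G"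
    using x_closed insert(4) by (auto intro!: comb_closed)
  have "tcong (pure q (x i [^] a i \<otimes> comb J x a)) (pure q (x i [^] a i) + pure q (comb J x a))"
    using xc by (intro pure_mult_right) auto
  also have "tcong (pure q (x i [^] a i)) (pure (q * of_int (a i)) (x i))"
    using tcong_sym[OF pure_scale[OF xc(2), of "a i" q]] by (simp add: mult.commute)
  then have "tcong (pure q (x i [^] a i) + pure q (comb J x a))
      (pure (q * of_int (a i)) (x i) + (\<Sum>i\<in>J. pure (q * of_int (a i)) (x i)))"
    using insert by (intro tcong_add) auto
  finally show ?case
    by (simp only: comb_insert[OF insert(1,2) xc(1)] sum.insert[OF insert(1,2)])
qed

abbreviation "ev i \<equiv> frag_eval (\<lambda>(q :: rat, g). q * of_int (coord g i))"

text \<open>\<open>coord\<close> is additive and turns powers into multiples, so \<open>ev i\<close>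
  factors through the tensor product. These maps are dual to the tensors of 1 with the
  \<open>x i\<close>.\<close>

lemma ev_tcong:
  assumes "i \<in> I" "tcong p q"
  shows "ev i p = ev i q"
proof -
  have "rank.balanced (\<lambda>(q, g). q * of_int (coord g i))"
    unfolding rank.balanced_def
    by (intro conjI ballI allI) (simp_all add: coord_mult[OF _ _ assms(1)] coord_pow[OF _ assms(1)] algebra_simps)
  from rank.frag_eval_null[OF this assms(2)[unfolded tcong_def]] show ?thesis
    by simp
qed

text \<open>Torsion dies in the tensor product, so a pure tensor is spread over the basis by the
  coordinates of its group element; general elements follow by additivity.\<close>

lemma tcong_basis:
  assumes "p \<in> carrier rank.free"
  shows "tcong p (\<Sum>i\<in>I. pure (ev i p) (x i))"
proof -
  have x_in: "x i \<in> carrier G" if "i \<in> I" for i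
    using x_closed that by auto
  have "Poly_Mapping.keys p \<subseteq> UNIV \<times> carrier G"
    using assms by simp
  then show ?thesis
  proof (induction p rule: frag_induction)
    case zero
    have "tcong (\<Sum>i\<in>I. pure 0 (x i)) (\<Sum>i\<in>I. 0)"
      by (intro tcong_sum pure_zero x_in)
    then show ?case
      by (simp add: tcong_sym)
  next
    case (one k)
    then obtain q g where k: "k = (q, g)" and g: "g \<in> carrier G"
      by auto
    obtain t where t: "t \<in> torsion_part G" "g = t \<otimes> comb I x (coord g)"
      using coord[OF g] by blast
    have "tcong (pure q (t \<otimes> comb I x (coord g))) (pure q t + pure q (comb I x (coord g)))"
      using t(1) subgroup.mem_carrier[OF subgroup_torsion_part] comb_closed[OF x_closed]
      by (intro pure_mult_right) auto
    also have "tcong \<dots> (0 + (\<Sum>i\<in>I. pure (q * of_int (coord g i)) (x i)))"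
      by (intro tcong_add pure_comb pure_torsion t(1)) auto
    finally show ?case
      unfolding t(2)[symmetric] by (simp add: k)
  next
    case (diff p p')
    have "tcong (p - p') ((\<Sum>i\<in>I. pure (ev i p) (x i)) - (\<Sum>i\<in>I. pure (ev i p') (x i)))"
      by (rule tcong_diff[OF diff])
    also have "\<dots> = (\<Sum>i\<in>I. pure (ev i p) (x i) - pure (ev i p') (x i))"
      by (simp only: sum_subtractf)
    also have "tcong \<dots> (\<Sum>i\<in>I. pure (ev i p - ev i p') (x i))"
      by (intro tcong_sum pure_diff x_in)
    finally show ?case
      by simp
  qed
qed

text \<open>The cosets of 1 tensored with the \<open>x i\<close> span by \<open>tcong_basis\<close>,
  and \<open>ev j\<close> applied to a linear combination returns its coefficient at j, which gives
  uniqueness.\<close>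

theorem has_rank_basis: "has_rank G (card I)"
proof -
  let ?Q = "add_monoid (ring_of_type_algebra :: rat ring)"
  let ?sQ = "\<lambda>(n::int) (q::rat). of_int n * q" and ?sG = "\<lambda>(n::int) g. g [^] n"
  let ?TP = "tensor_product ?Q G ?sQ ?sG"
  let ?act = "\<lambda>q. tensor_map ?Q G ?sQ ?sG (\<lambda>p. q * p) (\<lambda>g. g)"
  define \<beta> where "\<beta> = (\<lambda>i. rank.coset (pure 1 (x i)))"
  interpret TP: comm_group ?TP
    by (rule rank.comm_group_tensor)
  have x_in: "x i \<in> carrier G" if "i \<in> I" for i
    using x_closed that by auto
  have pure_free: "pure q (x i) \<in> carrier rank.free" if "i \<in> I" for q i
    using x_in[OF that] by simp
  have sum_free: "(\<Sum>i\<in>J. pure (c i) (x i)) \<in> carrier rank.free" if "J \<subseteq> I" for J c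
    using that pure_free by (intro sum_closed_free_Abelian_group) auto
  have ev_coset: "ev i p = ev i p'"
    if "rank.coset p = rank.coset p'" "p \<in> carrier rank.free" "p' \<in> carrier rank.free" "i \<in> I" for i p p'
  proof -
    have "p - p' \<in> rank.null"
      using rank.coset_eq_iff[OF that(2,3)] that(1) by blast
    then show ?thesis
      by (intro ev_tcong[OF that(4)]) (simp only: tcong_def)
  qed
  have ev_sum: "ev j (\<Sum>i\<in>J. pure (c i) (x i)) = (if j \<in> J then c j else 0)"
    if "finite J" "J \<subseteq> I" "j \<in> I" for J c j
    using that by (induction J rule: finite_induct) (auto simp: coord_x)
  \<comment> \<open>\<open>has_dimension\<close> counts a set of vectors and indexes coefficients by
    the vectors themselves, so an index must be recoverable from its basis vector.\<close>
  have inj: "inj_on \<beta> I"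
  proof (rule inj_onI)
    fix i j assume ij: "i \<in> I" "j \<in> I" "\<beta> i = \<beta> j"
    then have "ev i (pure 1 (x i)) = ev i (pure 1 (x j))"
      unfolding \<beta>_def by (intro ev_coset pure_free) auto
    then show "i = j"
      using coord_x[of i i] coord_x[of i j] ij by (auto split: if_splits)
  qed
  have act: "?act q (\<beta> i) = rank.coset (pure q (x i))" if "i \<in> I" for q i
    unfolding \<beta>_def using pure_free[OF that]
    by (subst rank.tensor_map_coset) (auto simp: hom_def algebra_simps)
  have coset_closed: "rank.coset p \<in> carrier ?TP" if "p \<in> carrier rank.free" for p
    unfolding rank.carrier_tensor using that by blast
  have lincomb: "finprod ?TP (\<lambda>b. ?act (c b) b) (\<beta> ` I) = rank.coset (\<Sum>i\<in>I. pure (c (\<beta> i)) (x i))" for c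
  proof -
    have "finprod ?TP (\<lambda>b. ?act (c b) b) (\<beta> ` I) = finprod ?TP (\<lambda>i. ?act (c (\<beta> i)) (\<beta> i)) I"
      using act coset_closed[OF pure_free] by (intro TP.finprod_reindex inj) auto
    also have "\<dots> = finprod ?TP (\<lambda>i. rank.coset (pure (c (\<beta> i)) (x i))) I"
      using act coset_closed[OF pure_free] by (intro TP.finprod_cong') auto
    also have "\<dots> = rank.coset (\<Sum>i\<in>I. pure (c (\<beta> i)) (x i))"
      by (rule rank.finprod_coset[OF finite_I pure_free])
    finally show ?thesis .
  qed
  have "has_dimension ?TP (UNIV :: rat set) ?act (card I)"
    unfolding has_dimension_def
  proof (intro exI[of _ "\<beta> ` I"] conjI ballI)
    show "\<beta> ` I \<subseteq> carrier ?TP"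
      unfolding \<beta>_def using coset_closed[OF pure_free] by blast
    show "card (\<beta> ` I) = card I"
      by (simp add: card_image[OF inj])
    fix v assume "v \<in> carrier ?TP"
    then obtain p where p: "v = rank.coset p" "p \<in> carrier rank.free"
      unfolding rank.carrier_tensor by blast
    define c where "c = restrict (\<lambda>b. ev (inv_into I \<beta> b) p) (\<beta> ` I)"
    have c_\<beta>: "c (\<beta> i) = ev i p" if "i \<in> I" for i
      unfolding c_def using that inv_into_f_f[OF inj that] by simp
    have "v = rank.coset (\<Sum>i\<in>I. pure (ev i p) (x i))"
      unfolding p(1)
      by (rule iffD2[OF rank.coset_eq_iff[OF p(2) sum_free[OF subset_refl]]])
        (rule tcong_basis[OF p(2), unfolded tcong_def])
    also have "(\<Sum>i\<in>I. pure (ev i p) (x i)) = (\<Sum>i\<in>I. pure (c (\<beta> i)) (x i))"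
      by (intro sum.cong refl) (simp add: c_\<beta>)
    finally have "v = finprod ?TP (\<lambda>b. ?act (c b) b) (\<beta> ` I)"
      unfolding lincomb .
    moreover have "d = c" if d: "d \<in> \<beta> ` I \<rightarrow>\<^sub>E UNIV"
      and v: "v = finprod ?TP (\<lambda>b. ?act (d b) b) (\<beta> ` I)" for d
    proof (rule PiE_ext[OF d])
      show "c \<in> \<beta> ` I \<rightarrow>\<^sub>E UNIV"
        by (simp add: c_def)
      fix b assume "b \<in> \<beta> ` I"
      then obtain j where j: "j \<in> I" "b = \<beta> j"
        by blast
      have "rank.coset p = rank.coset (\<Sum>i\<in>I. pure (d (\<beta> i)) (x i))"
        by (rule trans[OF p(1)[symmetric] trans[OF v lincomb]])
      then have "ev j p = ev j (\<Sum>i\<in>I. pure (d (\<beta> i)) (x i))"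
        by (rule ev_coset[OF _ p(2) sum_free[OF subset_refl] j(1)])
      then show "d b = c b"
        using j c_\<beta> ev_sum[of "I" j "\<lambda>i. d (\<beta> i)"] by simp
    qed
    ultimately show "\<exists>!c. c \<in> \<beta> ` I \<rightarrow>\<^sub>E UNIV \<and> v = finprod ?TP (\<lambda>b. ?act (c b) b) (\<beta> ` I)"
      by (intro ex1I[of _ c]) (auto simp: c_def)
  qed auto
  then show ?thesis
    by (simp only: has_rank_def Let_def)
qed

end

section \<open>One-sided ideals in subrings of a division ring\<close>

definition unital_subring :: "'d::ring_1 set \<Rightarrow> bool" where
  "unital_subring A \<longleftrightarrow> 0 \<in> A \<and> 1 \<in> A \<and>
     (\<forall>x\<in>A. \<forall>y\<in>A. x + y \<in> A) \<and> (\<forall>x\<in>A. - x \<in> A) \<and> (\<forall>x\<in>A. \<forall>y\<in>A. x * y \<in> A)"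

text \<open>The parameter is the multiplication of the division ring or of its opposite, so that every
  statement about left ideals also yields the one about right ideals.\<close>

locale side =
  fixes m :: "'d::division_ring \<Rightarrow> 'd \<Rightarrow> 'd" (infixl \<open>\<star>\<close> 70)
  assumes side: "(\<forall>x y. x \<star> y = x * y) \<or> (\<forall>x y. x \<star> y = y * x)"
begin

lemma assoc: "x \<star> y \<star> z = x \<star> (y \<star> z)"
  using side by (auto simp: mult.assoc)

lemma distrib_right: "(x + y) \<star> z = x \<star> z + y \<star> z"
  and distrib_left: "x \<star> (y + z) = x \<star> y + x \<star> z"
  and diff_right: "(x - y) \<star> z = x \<star> z - y \<star> z"
  using side by (auto simp: algebra_simps)

lemma one_left [simp]: "1 \<star> x = x" and one_right [simp]: "x \<star> 1 = x"
  and zero_left [simp]: "0 \<star> x = 0" and zero_right [simp]: "x \<star> 0 = 0"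
  and minus_left [simp]: "(- x) \<star> y = - (x \<star> y)" and minus_right [simp]: "x \<star> (- y) = - (x \<star> y)"
  using side by auto

lemma eq_0_iff [simp]: "x \<star> y = 0 \<longleftrightarrow> x = 0 \<or> y = 0"
  using side by auto

lemma inverse_left: "x \<noteq> 0 \<Longrightarrow> inverse x \<star> x = 1"
  and inverse_right: "x \<noteq> 0 \<Longrightarrow> x \<star> inverse x = 1"
  using side by auto

lemma power_Suc: "u ^ Suc n = u \<star> u ^ n" and power_Suc2: "u ^ Suc n = u ^ n \<star> u"
  using side by (auto simp: power_commutes)

lemma closed: "unital_subring A \<Longrightarrow> x \<in> A \<Longrightarrow> y \<in> A \<Longrightarrow> x \<star> y \<in> A"
  using side by (auto simp: unital_subring_def)

definition ideal_in :: "'d set \<Rightarrow> 'd set \<Rightarrow> bool" where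
  "ideal_in A I \<longleftrightarrow> I \<subseteq> A \<and> 0 \<in> I \<and> (\<forall>x\<in>I. \<forall>y\<in>I. x + y \<in> I) \<and> (\<forall>a\<in>A. \<forall>x\<in>I. a \<star> x \<in> I)"

lemma ideal_inD:
  assumes "ideal_in A I"
  shows "I \<subseteq> A" "0 \<in> I" "\<And>x y. x \<in> I \<Longrightarrow> y \<in> I \<Longrightarrow> x + y \<in> I" "\<And>a x. a \<in> A \<Longrightarrow> x \<in> I \<Longrightarrow> a \<star> x \<in> I"
  using assms by (auto simp: ideal_in_def)

lemma ideal_in_diff:
  assumes "unital_subring A" "ideal_in A I" "x \<in> I" "y \<in> I"
  shows "x - y \<in> I"
proof -
  have "(- 1) \<star> y \<in> I"
    using assms by (intro ideal_inD(4)[of A]) (auto simp: unital_subring_def)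
  then show ?thesis
    using ideal_inD(3)[OF assms(2) assms(3), of "- y"] by simp
qed

text \<open>If a and b had no common nonzero left multiple, the left ideals \<open>I n\<close> = A b
  + A b a + ... + A b a^(n-1) would increase strictly. Building \<open>I (Suc n)\<close> as
  \<open>I n\<close> a + A b lets an equality of later terms be cancelled back to earlier
  ones.\<close>

lemma ore_condition:
  assumes A: "unital_subring A" and acc: "acc (ideal_in A)"
    and a: "a \<in> A" "a \<noteq> 0" and b: "b \<in> A" "b \<noteq> 0"
  shows "\<exists>c\<in>A. \<exists>d\<in>A. c \<noteq> 0 \<and> d \<noteq> 0 \<and> c \<star> a = d \<star> b"
proof (rule ccontr)
  assume neg: "\<not> ?thesis"
  define I where "I = rec_nat {0} (\<lambda>_ J. {x \<star> a + c \<star> b | x c. x \<in> J \<and> c \<in> A})"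
  have I_0: "I 0 = {0}" and I_Suc: "I (Suc n) = {x \<star> a + c \<star> b | x c. x \<in> I n \<and> c \<in> A}" for n
    by (simp_all add: I_def)
  have A': "0 \<in> A" "1 \<in> A" "\<And>x y. x \<in> A \<Longrightarrow> y \<in> A \<Longrightarrow> x + y \<in> A" "\<And>x. x \<in> A \<Longrightarrow> - x \<in> A"
    using A by (auto simp: unital_subring_def)
  have I: "ideal_in A (I n)" for n
  proof (induction n)
    case 0
    show ?case using A'(1) by (auto simp: ideal_in_def I_0)
  next
    case (Suc n)
    note IH = ideal_inD[OF Suc]
    show ?case
      unfolding ideal_in_def
    proof (intro conjI ballI)
      show "I (Suc n) \<subseteq> A"
        using IH(1) a(1) b(1) by (auto simp: I_Suc intro!: A'(3) closed[OF A])
      show "0 \<in> I (Suc n)"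
        using IH(2) A'(1) by (force simp: I_Suc)
    next
      fix x y assume "x \<in> I (Suc n)" "y \<in> I (Suc n)"
      then obtain x' c y' d where "x = x' \<star> a + c \<star> b" "y = y' \<star> a + d \<star> b"
        "x' \<in> I n" "y' \<in> I n" "c \<in> A" "d \<in> A"
        by (auto simp: I_Suc)
      then have "x + y = (x' + y') \<star> a + (c + d) \<star> b" "x' + y' \<in> I n" "c + d \<in> A"
        using IH(3) A'(3) by (auto simp: distrib_right)
      then show "x + y \<in> I (Suc n)"
        unfolding I_Suc by blast
    next
      fix r x assume r: "r \<in> A" and "x \<in> I (Suc n)"
      then obtain x' c where "x = x' \<star> a + c \<star> b" "x' \<in> I n" "c \<in> A"
        by (auto simp: I_Suc)
      then have "r \<star> x = (r \<star> x') \<star> a + (r \<star> c) \<star> b" "r \<star> x' \<in> I n" "r \<star> c \<in> A"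
        using IH(4) r closed[OF A] by (auto simp: distrib_left assoc)
      then show "r \<star> x \<in> I (Suc n)"
        unfolding I_Suc by blast
    qed
  qed
  have mono: "I n \<subseteq> I (Suc n)" for n
  proof (induction n)
    case 0
    then show ?case using ideal_inD(2)[OF I] by (simp add: I_0)
  next
    case (Suc n)
    then show ?case unfolding I_Suc[of "Suc n"] I_Suc[of n] by blast
  qed
  have stab: "I (Suc n) \<noteq> I n" for n
  proof (induction n)
    case 0
    have "0 \<star> a + 1 \<star> b \<in> I (Suc 0)"
      unfolding I_Suc I_0 using A'(2) by blast
    then show ?case using b(2) by (auto simp: I_0)
  next
    case (Suc n)
    show ?case
    proof
      assume eq: "I (Suc (Suc n)) = I (Suc n)"
      \<comment> \<open>The product of x and a lies in the next ideal, hence by \<open>eq\<close> in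
        \<open>I (Suc n)\<close>. Comparing forms gives (x - y) a = c b with y in
        \<open>I n\<close>, and the assumption forces x = y.\<close>
      have "x \<in> I n" if x: "x \<in> I (Suc n)" for x
      proof -
        have "x \<star> a + 0 \<star> b \<in> I (Suc (Suc n))"
          unfolding I_Suc[of "Suc n"] using x A'(1) by blast
        then obtain y c where yc: "x \<star> a = y \<star> a + c \<star> b" "y \<in> I n" "c \<in> A"
          unfolding eq by (auto simp: I_Suc)
        then have eq': "(x - y) \<star> a = c \<star> b"
          by (simp add: diff_right)
        have "x + - y \<in> A"
          using yc(2) x ideal_inD(1)[OF I] by (intro A'(3,4)) blast+
        then have "x - y = 0"
          using neg eq' yc(3) a(2) b(2) by (metis diff_conv_add_uminus eq_0_iff)
        then show ?thesis
          using yc(2) by simp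
      qed
      then have "I (Suc n) = I n"
        using mono by blast
      then show False
        using Suc.IH by contradiction
    qed
  qed
  obtain N where "\<And>n. n \<ge> N \<Longrightarrow> I n = I N"
    using acc_constant_from[of "ideal_in A" I, OF acc I mono] by metis
  then show False
    using stab[of N] by (metis le_SucI order_refl)
qed

subsection \<open>Hilbert's basis theorem for skew Laurent extensions\<close>

text \<open>The elements \<open>a\<^sub>0 + u a\<^sub>1 + \<dots> + u\<^sup>n\<^sup>-\<^sup>1 a\<^sub>n\<^sub>-\<^sub>1\<close>; with the coefficients on the right, the
  leading coefficients of a left ideal form left ideals that increase with the degree.\<close>

fun skew_polys :: "'d set \<Rightarrow> 'd \<Rightarrow> nat \<Rightarrow> 'd set" where
  "skew_polys A u 0 = {0}"
| "skew_polys A u (Suc n) = {u ^ n \<star> a + p | a p. a \<in> A \<and> p \<in> skew_polys A u n}"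

context
  fixes A :: "'d set" and u :: 'd
  assumes A: "unital_subring A" and u: "u \<noteq> 0"
    and conj: "\<And>a. a \<in> A \<Longrightarrow> u * a * inverse u \<in> A" "\<And>a. a \<in> A \<Longrightarrow> inverse u * a * u \<in> A"
begin

lemma zero_A: "0 \<in> A" and one_A: "1 \<in> A" and add_A: "x \<in> A \<Longrightarrow> y \<in> A \<Longrightarrow> x + y \<in> A"
  and uminus_A: "x \<in> A \<Longrightarrow> - x \<in> A"
  using A by (auto simp: unital_subring_def)

lemma conj_side: "a \<in> A \<Longrightarrow> u \<star> (a \<star> inverse u) \<in> A" "a \<in> A \<Longrightarrow> inverse u \<star> (a \<star> u) \<in> A"
  using side conj by (auto simp: mult.assoc)

text \<open>Conjugation by u preserves A, so a coefficient may change sides at the price of being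
  replaced by a conjugate. Together with \<open>move_left\<close> this stands in for commutation
  with the variable.\<close>

lemma move_right: "a \<in> A \<Longrightarrow> \<exists>a'\<in>A. a \<star> u ^ n = u ^ n \<star> a'"
proof (induction n)
  case (Suc n)
  then obtain a' where a': "a' \<in> A" "a \<star> u ^ n = u ^ n \<star> a'"
    by blast
  have "a \<star> u ^ Suc n = u ^ n \<star> a' \<star> u"
    by (simp only: power_Suc2 a'(2) flip: assoc)
  also have "\<dots> = u ^ n \<star> (u \<star> inverse u) \<star> a' \<star> u"
    using u by (simp add: inverse_right)
  also have "\<dots> = u ^ Suc n \<star> (inverse u \<star> (a' \<star> u))"
    by (simp only: power_Suc2 assoc)
  finally show ?case
    using conj_side(2)[OF a'(1)] by blast
qed auto

lemma move_left: "a \<in> A \<Longrightarrow> \<exists>a'\<in>A. u ^ n \<star> a = a' \<star> u ^ n"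
proof (induction n)
  case (Suc n)
  then obtain a' where a': "a' \<in> A" "u ^ n \<star> a = a' \<star> u ^ n"
    by blast
  have "u ^ Suc n \<star> a = u \<star> a' \<star> u ^ n"
    by (simp only: power_Suc a'(2) assoc)
  also have "\<dots> = u \<star> a' \<star> (inverse u \<star> u) \<star> u ^ n"
    using u by (simp add: inverse_left)
  also have "\<dots> = (u \<star> (a' \<star> inverse u)) \<star> u ^ Suc n"
    by (simp only: power_Suc assoc)
  finally show ?case
    using conj_side(1)[OF a'(1)] by blast
qed auto

lemma skew_polys_SucI: "a \<in> A \<Longrightarrow> p \<in> skew_polys A u n \<Longrightarrow> u ^ n \<star> a + p \<in> skew_polys A u (Suc n)"
  by auto

lemma skew_polys_0: "0 \<in> skew_polys A u n"
proof (induction n)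
  case (Suc n)
  then show ?case
    using zero_A by (auto intro!: exI[of _ 0])
qed auto

lemma skew_polys_add: "p \<in> skew_polys A u n \<Longrightarrow> q \<in> skew_polys A u n \<Longrightarrow> p + q \<in> skew_polys A u n"
proof (induction n arbitrary: p q)
  case (Suc n)
  then obtain a p' b q' where *: "p = u ^ n \<star> a + p'" "q = u ^ n \<star> b + q'"
    "a \<in> A" "b \<in> A" "p' \<in> skew_polys A u n" "q' \<in> skew_polys A u n"
    by auto
  then have "p + q = u ^ n \<star> (a + b) + (p' + q')"
    by (simp add: distrib_left)
  then show ?case
    using skew_polys_SucI[OF add_A Suc.IH] * by metis
qed auto

lemma skew_polys_Suc: "p \<in> skew_polys A u n \<Longrightarrow> p \<in> skew_polys A u (Suc n)"
  using skew_polys_SucI[OF zero_A] by fastforce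

lemma skew_polys_mono: "n \<le> n' \<Longrightarrow> p \<in> skew_polys A u n \<Longrightarrow> p \<in> skew_polys A u n'"
  by (induction n' rule: dec_induct) (simp_all only: skew_polys_Suc)

lemma skew_polys_shift: "p \<in> skew_polys A u n \<Longrightarrow> u \<star> p \<in> skew_polys A u (Suc n)"
proof (induction n arbitrary: p)
  case 0
  then show ?case
    using zero_A by (auto intro!: exI[of _ 0])
next
  case (Suc n)
  then obtain a p' where *: "p = u ^ n \<star> a + p'" "a \<in> A" "p' \<in> skew_polys A u n"
    by auto
  then have "u \<star> p = u ^ Suc n \<star> a + u \<star> p'"
    by (simp only: distrib_left power_Suc assoc)
  then show ?case
    using *(2) Suc.IH[OF *(3)] unfolding skew_polys.simps(2)[of A u "Suc n"] by blast
qed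

lemma skew_polys_shift_pow: "p \<in> skew_polys A u n \<Longrightarrow> u ^ k \<star> p \<in> skew_polys A u (n + k)"
proof (induction k)
  case (Suc k)
  then show ?case
    using skew_polys_shift[of "u ^ k \<star> p" "n + k"] by (simp only: power_Suc assoc add_Suc_right)
qed auto

lemma skew_polys_mult: "b \<in> A \<Longrightarrow> p \<in> skew_polys A u n \<Longrightarrow> b \<star> p \<in> skew_polys A u n"
proof (induction n arbitrary: p)
  case (Suc n)
  then obtain a p' where *: "p = u ^ n \<star> a + p'" "a \<in> A" "p' \<in> skew_polys A u n"
    by auto
  obtain b' where b': "b' \<in> A" "b \<star> u ^ n = u ^ n \<star> b'"
    using move_right Suc.prems(1) by blast
  have "b \<star> p = u ^ n \<star> (b' \<star> a) + b \<star> p'"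
    unfolding *(1) distrib_left by (simp add: b'(2) flip: assoc)
  then show ?case
    using skew_polys_SucI[OF closed[OF A b'(1) *(2)] Suc.IH[OF Suc.prems(1) *(3)]] by simp
qed auto

text \<open>Powers of u may be dependent over A, so one element can have several leading
  coefficients; all of them are collected.\<close>

definition leading :: "'d set \<Rightarrow> nat \<Rightarrow> 'd set" where
  "leading I n = {a \<in> A. \<exists>p\<in>skew_polys A u n. u ^ n \<star> a + p \<in> I}"

lemma leading_mono: "I \<subseteq> J \<Longrightarrow> leading I n \<subseteq> leading J n"
  by (auto simp: leading_def)

context
  fixes B :: "'d set"
  assumes B: "unital_subring B" and AB: "A \<subseteq> B" and uB: "u \<in> B" "inverse u \<in> B"
begin

lemma power_u: "u ^ n \<in> B" "inverse u ^ n \<in> B"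
  using B uB by (induction n) (auto simp: unital_subring_def)

text \<open>To multiply the leading coefficient by b, the whole polynomial is multiplied by the
  conjugate b' with u^n b = b' u^n; lower terms stay lower because b' is again in A.\<close>

lemma ideal_in_leading:
  assumes I: "ideal_in B I"
  shows "ideal_in A (leading I n)"
  unfolding ideal_in_def
proof (intro conjI ballI)
  show "leading I n \<subseteq> A"
    by (auto simp: leading_def)
  show "0 \<in> leading I n"
    using zero_A skew_polys_0 ideal_inD(2)[OF I] by (auto simp: leading_def intro!: bexI[of _ 0])
next
  fix a b assume "a \<in> leading I n" "b \<in> leading I n"
  then obtain p q where *: "a \<in> A" "b \<in> A" "p \<in> skew_polys A u n" "q \<in> skew_polys A u n"
    "u ^ n \<star> a + p \<in> I" "u ^ n \<star> b + q \<in> I"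
    by (auto simp: leading_def)
  have "u ^ n \<star> (a + b) + (p + q) = (u ^ n \<star> a + p) + (u ^ n \<star> b + q)"
    by (simp add: distrib_left)
  also have "\<dots> \<in> I"
    by (rule ideal_inD(3)[OF I *(5,6)])
  finally show "a + b \<in> leading I n"
    using add_A[OF *(1,2)] skew_polys_add[OF *(3,4)] by (auto simp: leading_def)
next
  fix b a assume b: "b \<in> A" and "a \<in> leading I n"
  then obtain p where *: "a \<in> A" "p \<in> skew_polys A u n" "u ^ n \<star> a + p \<in> I"
    by (auto simp: leading_def)
  obtain b' where b': "b' \<in> A" "u ^ n \<star> b = b' \<star> u ^ n"
    using move_left b by blast
  have "u ^ n \<star> (b \<star> a) + b' \<star> p = b' \<star> (u ^ n \<star> a + p)"
    unfolding distrib_left by (simp add: b'(2) flip: assoc)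
  also have "\<dots> \<in> I"
    using ideal_inD(4)[OF I _ *(3)] b'(1) AB by blast
  finally show "b \<star> a \<in> leading I n"
    using closed[OF A b *(1)] skew_polys_mult[OF b'(1) *(2)] by (auto simp: leading_def)
qed

lemma leading_Suc:
  assumes I: "ideal_in B I"
  shows "leading I n \<subseteq> leading I (Suc n)"
proof
  fix a assume "a \<in> leading I n"
  then obtain p where *: "a \<in> A" "p \<in> skew_polys A u n" "u ^ n \<star> a + p \<in> I"
    by (auto simp: leading_def)
  have "u ^ Suc n \<star> a + u \<star> p = u \<star> (u ^ n \<star> a + p)"
    by (simp only: distrib_left power_Suc assoc)
  also have "\<dots> \<in> I"
    by (rule ideal_inD(4)[OF I uB(1) *(3)])
  finally show "a \<in> leading I (Suc n)"
    using *(1) skew_polys_shift[OF *(2)] unfolding leading_def by blast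
qed

text \<open>Some element of \<open>I\<close> has the same leading coefficient as f; subtracting it
  leaves an element of \<open>J\<close> of smaller degree, to which induction applies.\<close>

lemma mem_if_leading_eq:
  assumes I: "ideal_in B I" and J: "ideal_in B J" and IJ: "I \<subseteq> J"
    and eq: "\<And>n. leading I n = leading J n"
  shows "f \<in> J \<Longrightarrow> f \<in> skew_polys A u n \<Longrightarrow> f \<in> I"
proof (induction n arbitrary: f)
  case 0
  then show ?case using ideal_inD(2)[OF I] by simp
next
  case (Suc n)
  then obtain a p where f: "f = u ^ n \<star> a + p" "a \<in> A" "p \<in> skew_polys A u n"
    by auto
  then have "a \<in> leading J n"
    using Suc.prems(1) by (auto simp: leading_def)
  then obtain q where q: "q \<in> skew_polys A u n" "u ^ n \<star> a + q \<in> I"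
    unfolding eq[symmetric] by (auto simp: leading_def)
  have "f - (u ^ n \<star> a + q) \<in> J"
    using ideal_in_diff[OF B J] Suc.prems(1) q(2) IJ by blast
  moreover have "f - (u ^ n \<star> a + q) = p + (- 1) \<star> q"
    using f(1) by simp
  moreover have "p + (- 1) \<star> q \<in> skew_polys A u n"
    using f(3) q(1) one_A uminus_A by (intro skew_polys_add skew_polys_mult) auto
  ultimately have "f - (u ^ n \<star> a + q) \<in> I"
    using Suc.IH by metis
  then show ?case
    using ideal_inD(3)[OF I _ q(2)] by fastforce
qed

text \<open>Leading ideals grow with the chain index and with the degree. The diagonal settles all
  positions from N on, and each of the finitely many degrees below N settles separately. Past a
  common bound the ideals agree on polynomials; powers of u, invertible in B, carry this over to all
  of B.\<close>

theorem acc_skew_laurent: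
  assumes gen: "\<And>f. f \<in> B \<Longrightarrow> \<exists>k n. u ^ k \<star> f \<in> skew_polys A u n"
    and acc: "acc (ideal_in A)"
  shows "acc (ideal_in B)"
  unfolding acc_def
proof (intro allI impI)
  fix C :: "nat \<Rightarrow> 'd set"
  assume C: "\<forall>n. ideal_in B (C n) \<and> C n \<subseteq> C (Suc n)"
  then have C_ideal: "ideal_in B (C n)" and C_mono: "i \<le> j \<Longrightarrow> C i \<subseteq> C j" for n i j
    by (auto simp: lift_Suc_mono_le)
  have lead_mono: "leading (C k) n \<subseteq> leading (C l) n'" if "k \<le> l" "n \<le> n'" for k l n n'
  proof -
    have "leading (C k) n \<subseteq> leading (C k) n'"
      using lift_Suc_mono_le[of "leading (C k)" n n'] leading_Suc[OF C_ideal] that(2) by blast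
    then show ?thesis
      using leading_mono[OF C_mono[OF that(1)]] by blast
  qed
  obtain N where N: "\<And>n. n \<ge> N \<Longrightarrow> leading (C n) n = leading (C N) N"
    using acc_constant_from[OF acc, of "\<lambda>n. leading (C n) n"]
      ideal_in_leading[OF C_ideal] lead_mono[OF le_SucI[OF order_refl] le_SucI[OF order_refl]] by metis
  have "\<exists>K. \<forall>k\<ge>K. leading (C k) n = leading (C K) n" for n
    using acc_constant_from[OF acc, of "\<lambda>k. leading (C k) n"]
      ideal_in_leading[OF C_ideal] lead_mono[OF le_SucI[OF order_refl] order_refl] by metis
  then obtain K where K: "\<And>n k. k \<ge> K n \<Longrightarrow> leading (C k) n = leading (C (K n)) n"
    by metis
  \<comment> \<open>The sum serves as an upper bound in place of a maximum: it dominates N and every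
    \<open>K n\<close> with n < N, also when N = 0.\<close>
  define L where "L = N + (\<Sum>n<N. K n)"
  have L: "leading (C k) n = leading (C L) n" if k: "k \<ge> L" for k n
  proof (cases "n < N")
    case True
    then have "K n \<le> (\<Sum>n<N. K n)"
      by (intro member_le_sum) auto
    then show ?thesis
      using k K[of n k] K[of n L] by (simp add: L_def)
  next
    case False
    \<comment> \<open>The position (l, n) lies between the diagonal positions at N and at
      \<open>max l n\<close>, whose leading ideals coincide.\<close>
    have "leading (C l) n = leading (C N) N" if "l \<ge> N" for l
      using lead_mono[of N l N n] lead_mono[of l "max l n" n "max l n"] N[of "max l n"] that False
      by auto
    then show ?thesis
      using k by (simp add: L_def)
  qed
  have "C k = C L" if k: "k \<ge> L" for k
  proof
    show "C L \<subseteq> C k"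
      by (rule C_mono[OF k])
    show "C k \<subseteq> C L"
    proof
      fix f assume f: "f \<in> C k"
      then obtain l n where ln: "u ^ l \<star> f \<in> skew_polys A u n"
        using gen[of f] ideal_inD(1)[OF C_ideal] by blast
      have "u ^ l \<star> f \<in> C k"
        using ideal_inD(4)[OF C_ideal _ f] power_u by blast
      then have "u ^ l \<star> f \<in> C L"
        using mem_if_leading_eq[OF C_ideal C_ideal C_mono[OF k] L[OF k, symmetric] _ ln] by blast
      then have "inverse u ^ l \<star> (u ^ l \<star> f) \<in> C L"
        using ideal_inD(4)[OF C_ideal] power_u by blast
      moreover have "inverse u ^ l \<star> (u ^ l \<star> f) = f"
        using u by (simp add: power_inverse inverse_left flip: assoc)
      ultimately show "f \<in> C L"
        by simp
    qed
  qed
  then show "\<exists>N. \<forall>n\<ge>N. C n = C N"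
    by blast
qed

end

end

end

section \<open>Left and right ideals of subrings, and rings of fractions\<close>

interpretation lside: side "\<lambda>x y. x * y"
  by unfold_locales simp

interpretation rside: side "\<lambda>x y. y * x"
  by unfold_locales simp

lemma ring_ring_on:
  assumes "unital_subring A"
  shows "ring (ring_on A)"
proof -
  have "\<exists>y\<in>A. y + x = 0" if "x \<in> A" for x
    using assms that by (intro bexI[of _ "- x"]) (auto simp: unital_subring_def)
  then show ?thesis
    using assms
    by (intro ringI abelian_groupI monoidI) (auto simp: unital_subring_def algebra_simps)
qed

lemma nc_noetherian_domain_ring_on:
  assumes A: "unital_subring A" and "acc (lside.ideal_in A)" "acc (rside.ideal_in A)"
  shows "nc_noetherian_domain (ring_on A)"
proof -
  have "I \<subseteq> A \<and> 0 \<in> I \<and> (\<forall>x\<in>I. \<forall>y\<in>I. x + y \<in> I)" if "additive_subgroup I (ring_on A)" for I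
    using additive_subgroup.a_subset[OF that] additive_subgroup.zero_closed[OF that]
      additive_subgroup.a_closed[OF that] by simp
  then have "lside.ideal_in A I" if "left_ideal I (ring_on A)" for I
    using that by (simp add: lside.ideal_in_def left_ideal_def)
  moreover have "rside.ideal_in A I" if "right_ideal I (ring_on A)" for I
    using that \<open>\<And>I. additive_subgroup I (ring_on A) \<Longrightarrow> _ I\<close> by (simp add: rside.ideal_in_def right_ideal_def)
  ultimately have "acc (\<lambda>I. left_ideal I (ring_on A))" "acc (\<lambda>I. right_ideal I (ring_on A))"
    using assms(2,3) by (auto intro: acc_injective_image[where f = "\<lambda>I. I"])
  then show ?thesis
    using ring_ring_on[OF A] by (simp add: nc_noetherian_domain_def)
qed

lemma finsum_ring_on:
  assumes A: "unital_subring A" and "finite S" "\<And>i. i \<in> S \<Longrightarrow> f i \<in> A"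
  shows "finsum (ring_on A) f S = (\<Sum>i\<in>S. f i)"
proof -
  interpret ring "ring_on A"
    by (rule ring_ring_on[OF A])
  show ?thesis
    using assms(2,3)
  proof (induction S rule: finite_induct)
    case (insert i S)
    then have "f \<in> S \<rightarrow> carrier (ring_on A)" "f i \<in> carrier (ring_on A)"
      by auto
    then show ?case
      using insert finsum_insert[of S i f] by simp
  qed simp
qed

text \<open>Membership in \<open>Frac A\<close> amounts to having a left denominator. Sums use a
  common left multiple of two denominators, products move the numerator of one factor past the
  denominator of the other, and the right Ore condition turns left fractions into right
  ones.\<close>

lemma (in division_algebra) is_quotient_division_algebra_Frac:
  assumes A: "unital_subring A" and scale: "\<And>c x. x \<in> A \<Longrightarrow> scale c x \<in> A"
    and acc: "acc (lside.ideal_in A)" "acc (rside.ideal_in A)"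
  shows "is_quotient_division_algebra scale A (Frac A)"
proof -
  have A0: "0 \<in> A" "1 \<in> A" and A_add: "\<And>x y. x \<in> A \<Longrightarrow> y \<in> A \<Longrightarrow> x + y \<in> A"
    and A_mult: "\<And>x y. x \<in> A \<Longrightarrow> y \<in> A \<Longrightarrow> x * y \<in> A"
    using A by (auto simp: unital_subring_def)
  \<comment> \<open>The case of a zero numerator lies outside \<open>ore_condition\<close> and is
    settled by the pair 1, 0.\<close>
  have ore_left: "\<exists>s'\<in>A. \<exists>a'\<in>A. s' \<noteq> 0 \<and> s' * a = a' * s" if "a \<in> A" "s \<in> A" "s \<noteq> 0" for a s
  proof (cases "a = 0")
    case True
    then show ?thesis using A0 by (intro bexI[of _ 1] bexI[of _ 0]) auto
  next
    case False
    then show ?thesis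
      using lside.ore_condition[OF A acc(1) that(1) _ that(2,3)] by blast
  qed
  have ore_right: "\<exists>s'\<in>A. \<exists>a'\<in>A. s' \<noteq> 0 \<and> a * s' = s * a'" if "a \<in> A" "s \<in> A" "s \<noteq> 0" for a s
  proof (cases "a = 0")
    case True
    then show ?thesis using A0 by (intro bexI[of _ 1] bexI[of _ 0]) auto
  next
    case False
    then show ?thesis
      using rside.ore_condition[OF A acc(2) that(1) _ that(2,3)] by blast
  qed
  have Frac_iff: "x \<in> Frac A \<longleftrightarrow> (\<exists>s\<in>A. s \<noteq> 0 \<and> s * x \<in> A)" for x
  proof
    assume "x \<in> Frac A"
    then obtain s a where "s \<in> A" "s \<noteq> 0" "a \<in> A" "x = inverse s * a"
      by (auto simp: Frac_def)
    then show "\<exists>s\<in>A. s \<noteq> 0 \<and> s * x \<in> A"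
      by (intro bexI[of _ s]) (auto simp flip: mult.assoc)
  next
    assume "\<exists>s\<in>A. s \<noteq> 0 \<and> s * x \<in> A"
    then obtain s where s: "s \<in> A" "s \<noteq> 0" "s * x \<in> A"
      by blast
    then have "x = inverse s * (s * x)"
      by (simp flip: mult.assoc)
    then show "x \<in> Frac A"
      using s unfolding Frac_def by blast
  qed
  have sub: "A \<subseteq> Frac A"
    using A0 by (auto simp: Frac_iff intro!: bexI[of _ 1])
  moreover have "division_subalgebra scale (Frac A)"
  proof (rule division_subalgebraI)
    show "0 \<in> Frac A" "1 \<in> Frac A"
      using A0 sub by auto
  next
    fix x y assume "x \<in> Frac A" "y \<in> Frac A"
    then obtain s t where st: "s \<in> A" "s \<noteq> 0" "s * x \<in> A" "t \<in> A" "t \<noteq> 0" "t * y \<in> A"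
      by (auto simp: Frac_iff)
    obtain s' t' where *: "s' \<in> A" "t' \<in> A" "s' \<noteq> 0" "s' * s = t' * t"
      using ore_left st by metis
    have "(s' * s) * (x + y) = s' * (s * x) + t' * (t * y)"
      by (simp add: distrib_left mult.assoc[symmetric] *(4))
    also have "\<dots> \<in> A"
      by (intro A_add A_mult st *)
    finally show "x + y \<in> Frac A"
      using * st A_mult by (auto simp: Frac_iff intro!: bexI[of _ "s' * s"])
    \<comment> \<open>Here a * t replaces u * (s * x), so \<open>u * s\<close> becomes a left
      denominator of \<open>x * y\<close>.\<close>
    obtain u a where **: "u \<in> A" "a \<in> A" "u \<noteq> 0" "u * (s * x) = a * t"
      using ore_left st by metis
    have "(u * s) * (x * y) = a * (t * y)"
      by (simp add: mult.assoc[symmetric] **(4)[unfolded mult.assoc[symmetric]])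
    also have "\<dots> \<in> A"
      by (intro A_mult ** st)
    finally show "x * y \<in> Frac A"
      using ** st A_mult by (auto simp: Frac_iff intro!: bexI[of _ "u * s"])
  next
    fix x assume "x \<in> Frac A"
    then obtain s where s: "s \<in> A" "s \<noteq> 0" "s * x \<in> A"
      by (auto simp: Frac_iff)
    then show "scale c x \<in> Frac A" for c
      using scale by (auto simp: Frac_iff simp flip: scale_mult_right)
    show "inverse x \<in> Frac A"
    proof (cases "x = 0")
      case True
      then show ?thesis using sub A0 by auto
    next
      case False
      then have "(s * x) * inverse x = s"
        by (simp add: mult.assoc)
      then show ?thesis
        using s False by (auto simp: Frac_iff intro!: bexI[of _ "s * x"])
    qed
  qed
  moreover have "Frac A = {a * inverse s | s a. s \<in> A \<and> s \<noteq> 0 \<and> a \<in> A}"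
  proof (intro subset_antisym subsetI)
    fix x assume "x \<in> Frac A"
    then obtain s where s: "s \<in> A" "s \<noteq> 0" "s * x \<in> A"
      by (auto simp: Frac_iff)
    then obtain s' a' where *: "s' \<in> A" "a' \<in> A" "s' \<noteq> 0" "(s * x) * s' = s * a'"
      using ore_right by metis
    then have "x * s' = a'"
      using s(2) by (simp add: mult.assoc)
    then have "x = a' * inverse s'"
      using *(3) by (auto simp: mult.assoc)
    then show "x \<in> {a * inverse s | s a. s \<in> A \<and> s \<noteq> 0 \<and> a \<in> A}"
      using * by blast
  next
    fix x assume "x \<in> {a * inverse s | s a. s \<in> A \<and> s \<noteq> 0 \<and> a \<in> A}"
    then obtain s a where sa: "s \<in> A" "s \<noteq> 0" "a \<in> A" "x = a * inverse s"
      by blast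
    then obtain s' a' where *: "s' \<in> A" "a' \<in> A" "s' \<noteq> 0" "s' * a = a' * s"
      using ore_left by metis
    then have "s' * x = a'"
      using sa by (simp add: mult.assoc[symmetric]) (simp add: mult.assoc)
    then show "x \<in> Frac A"
      using * by (auto simp: Frac_iff)
  qed
  ultimately show ?thesis
    by (simp add: is_quotient_division_algebra_def Frac_def)
qed

section \<open>Division rings with a family of independent homogeneous components\<close>

text \<open>An abstraction of the eigenspaces in which derivations and automorphisms look alike. The
  components are independent but need not fill D, and V \<nu> may be zero.\<close>

locale graded_division_ring = comm_group W
  for W :: "('w, 'm) monoid_scheme" (structure) +
  fixes V :: "'w \<Rightarrow> 'd::division_ring set"
  assumes V_zero: "\<nu> \<in> carrier W \<Longrightarrow> 0 \<in> V \<nu>"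
    and V_add: "\<nu> \<in> carrier W \<Longrightarrow> x \<in> V \<nu> \<Longrightarrow> y \<in> V \<nu> \<Longrightarrow> x + y \<in> V \<nu>"
    and V_uminus: "\<nu> \<in> carrier W \<Longrightarrow> x \<in> V \<nu> \<Longrightarrow> - x \<in> V \<nu>"
    and V_one: "1 \<in> V \<one>"
    and V_mult: "\<nu> \<in> carrier W \<Longrightarrow> \<mu> \<in> carrier W \<Longrightarrow> x \<in> V \<nu> \<Longrightarrow> y \<in> V \<mu> \<Longrightarrow> x * y \<in> V (\<nu> \<otimes> \<mu>)"
    and V_inverse: "\<nu> \<in> carrier W \<Longrightarrow> x \<in> V \<nu> \<Longrightarrow> inverse x \<in> V (inv \<nu>)"
    and V_independent: "finite S \<Longrightarrow> S \<subseteq> carrier W \<Longrightarrow> (\<And>\<nu>. \<nu> \<in> S \<Longrightarrow> u \<nu> \<in> V \<nu>) \<Longrightarrow>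
      (\<Sum>\<nu>\<in>S. u \<nu>) = 0 \<Longrightarrow> \<nu> \<in> S \<Longrightarrow> u \<nu> = 0"
begin

definition Ev :: "'w set" where
  "Ev = {\<nu> \<in> carrier W. \<exists>u\<in>V \<nu>. u \<noteq> 0}"

definition DS :: "'w set \<Rightarrow> 'd set" where
  "DS F = {\<Sum>\<nu>\<in>S. u \<nu> | S u. finite S \<and> S \<subseteq> F \<and> (\<forall>\<nu>\<in>S. u \<nu> \<in> V \<nu>)}"

lemma Ev_subset: "Ev \<subseteq> carrier W"
  by (auto simp: Ev_def)

lemma subgroup_Ev: "subgroup Ev W"
proof (rule subgroupI)
  show "Ev \<noteq> {}"
    using V_one by (auto simp: Ev_def intro!: exI[of _ "\<one>"] bexI[of _ 1])
next
  fix a assume "a \<in> Ev"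
  then obtain u where "a \<in> carrier W" "u \<in> V a" "u \<noteq> 0"
    by (auto simp: Ev_def)
  then show "inv a \<in> Ev"
    using V_inverse[of a u] by (auto simp: Ev_def intro!: bexI[of _ "inverse u"])
next
  fix a b assume "a \<in> Ev" "b \<in> Ev"
  then obtain u v where "a \<in> carrier W" "u \<in> V a" "u \<noteq> 0" "b \<in> carrier W" "v \<in> V b" "v \<noteq> 0"
    by (auto simp: Ev_def)
  then show "a \<otimes> b \<in> Ev"
    using V_mult[of a b u v] by (auto simp: Ev_def intro!: bexI[of _ "u * v"])
qed (rule Ev_subset)

lemma DS_0: "0 \<in> DS F"
  unfolding DS_def by (auto intro!: exI[of _ "{}"])

lemma DS_mono: "F \<subseteq> F' \<Longrightarrow> DS F \<subseteq> DS F'"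
  unfolding DS_def by blast

lemma DS_add_homogeneous:
  assumes F: "F \<subseteq> carrier W" and v: "\<nu> \<in> F" "v \<in> V \<nu>" and x: "x \<in> DS F"
  shows "v + x \<in> DS F"
proof -
  obtain S u where S: "x = (\<Sum>\<nu>\<in>S. u \<nu>)" "finite S" "S \<subseteq> F" "\<forall>\<nu>\<in>S. u \<nu> \<in> V \<nu>"
    using x unfolding DS_def by blast
  \<comment> \<open>The degree of v may already occur in \<open>S\<close>, so the two families are
    extended by zero and added.\<close>
  define u' where "u' = (\<lambda>\<mu>. (if \<mu> = \<nu> then v else 0) + (if \<mu> \<in> S then u \<mu> else 0))"
  have "(\<Sum>\<mu>\<in>insert \<nu> S. u' \<mu>) = v + (\<Sum>\<mu>\<in>insert \<nu> S. if \<mu> \<in> S then u \<mu> else 0)"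
    unfolding u'_def sum.distrib using S(2) by simp
  also have "(\<Sum>\<mu>\<in>insert \<nu> S. if \<mu> \<in> S then u \<mu> else 0) = x"
    unfolding S(1) using S(2) by (intro sum.mono_neutral_cong_right) auto
  finally have "v + x = (\<Sum>\<mu>\<in>insert \<nu> S. u' \<mu>)" ..
  moreover have "\<forall>\<mu>\<in>insert \<nu> S. u' \<mu> \<in> V \<mu>"
    using S(3,4) F v by (auto simp: u'_def V_add V_zero subset_iff)
  ultimately show ?thesis
    unfolding DS_def using S(2,3) v(1)
    by (intro CollectI exI[of _ "insert \<nu> S"] exI[of _ u']) simp
qed

lemma DS_homogeneous: "F \<subseteq> carrier W \<Longrightarrow> \<nu> \<in> F \<Longrightarrow> v \<in> V \<nu> \<Longrightarrow> v \<in> DS F"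
  using DS_add_homogeneous[of F \<nu> v 0] DS_0 by simp

lemma DS_induct [consumes 2, case_names zero add]:
  assumes "F \<subseteq> carrier W" "x \<in> DS F" and "P 0"
    and step: "\<And>\<nu> v x. \<nu> \<in> F \<Longrightarrow> v \<in> V \<nu> \<Longrightarrow> x \<in> DS F \<Longrightarrow> P x \<Longrightarrow> P (v + x)"
  shows "P x"
proof -
  obtain S u where S: "x = (\<Sum>\<nu>\<in>S. u \<nu>)" "finite S" "S \<subseteq> F" "\<forall>\<nu>\<in>S. u \<nu> \<in> V \<nu>"
    using assms(2) unfolding DS_def by blast
  have "(\<Sum>\<nu>\<in>S. u \<nu>) \<in> DS F \<and> P (\<Sum>\<nu>\<in>S. u \<nu>)"
    using S(2-4)
  proof (induction S rule: finite_induct)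
    case (insert \<nu> S)
    then show ?case
      using step[of \<nu> "u \<nu>"] DS_add_homogeneous[OF assms(1), of \<nu> "u \<nu>"] by auto
  qed (use DS_0 \<open>P 0\<close> in auto)
  then show ?thesis
    using S(1) by simp
qed

lemma DS_add:
  assumes F: "F \<subseteq> carrier W" and x: "x \<in> DS F" and y: "y \<in> DS F"
  shows "x + y \<in> DS F"
  using F x
proof (induction x rule: DS_induct)
  case (add \<nu> v x)
  then show ?case
    using DS_add_homogeneous[OF F, of \<nu> v "x + y"] by (simp add: add.assoc)
qed (use y in simp)

lemma DS_sum: "F \<subseteq> carrier W \<Longrightarrow> (\<And>i. i \<in> S \<Longrightarrow> f i \<in> DS F) \<Longrightarrow> (\<Sum>i\<in>S. f i) \<in> DS F"
  by (induction S rule: infinite_finite_induct) (auto intro: DS_add DS_0)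

lemma DS_uminus:
  assumes "F \<subseteq> carrier W" "x \<in> DS F"
  shows "- x \<in> DS F"
  using assms
proof (induction x rule: DS_induct)
  case (add \<nu> v x)
  then have "- v + - x \<in> DS F"
    using assms(1) by (intro DS_add_homogeneous[of F \<nu>] V_uminus) auto
  then show ?case by (simp add: add.commute)
qed (simp add: DS_0)

lemma DS_mult_homogeneous:
  assumes F: "subgroup F W" and v: "\<nu> \<in> F" "v \<in> V \<nu>" and x: "x \<in> DS F"
  shows "v * x \<in> DS F"
  using subgroup.subset[OF F] x
proof (induction x rule: DS_induct)
  case (add \<mu> w x)
  then have "v * w \<in> V (\<nu> \<otimes> \<mu>)"
    using subgroup.mem_carrier[OF F] v by (intro V_mult) auto
  then show ?case
    using add subgroup.m_closed[OF F v(1) add(1)]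
    by (auto simp: distrib_left intro: DS_add_homogeneous[OF subgroup.subset[OF F]])
qed (simp add: DS_0)

lemma unital_subring_DS:
  assumes F: "subgroup F W"
  shows "unital_subring (DS F)"
proof -
  have "x * y \<in> DS F" if "x \<in> DS F" "y \<in> DS F" for x y
    using subgroup.subset[OF F] that(1)
  proof (induction x rule: DS_induct)
    case (add \<nu> v x)
    then show ?case
      using that(2) subgroup.subset[OF F]
      by (auto simp: distrib_right intro!: DS_add DS_mult_homogeneous[OF F add(1)])
  qed (simp add: DS_0)
  moreover have "1 \<in> DS F"
    using DS_homogeneous[OF subgroup.subset[OF F] subgroup.one_closed[OF F]] V_one by blast
  ultimately show ?thesis
    using subgroup.subset[OF F]
    by (auto simp: unital_subring_def intro: DS_0 DS_add DS_uminus)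
qed

lemma DS_trivial: "DS {\<one>} = V \<one>"
proof
  show "DS {\<one>} \<subseteq> V \<one>"
  proof
    fix x assume "x \<in> DS {\<one>}"
    with _ show "x \<in> V \<one>"
      by (induction x rule: DS_induct) (auto intro: V_add V_zero)
  qed
qed (auto intro: DS_homogeneous)

subsection \<open>Homogeneous components\<close>

definition decomposition :: "'d \<Rightarrow> ('w \<Rightarrow> 'd) \<Rightarrow> bool" where
  "decomposition x c \<longleftrightarrow> finite {\<nu>. c \<nu> \<noteq> 0} \<and> {\<nu>. c \<nu> \<noteq> 0} \<subseteq> carrier W \<and>
     (\<forall>\<nu>\<in>carrier W. c \<nu> \<in> V \<nu>) \<and> x = (\<Sum>\<nu>|c \<nu> \<noteq> 0. c \<nu>)"

text \<open>An element outside \<open>DS (carrier W)\<close> has no decomposition, and its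
  components are arbitrary values.\<close>

definition component :: "'w \<Rightarrow> 'd \<Rightarrow> 'd" where
  "component \<nu> x = (SOME c. decomposition x c) \<nu>"

text \<open>Independence is applied to the difference of the two families on the union of their
  supports.\<close>

lemma decomposition_unique:
  assumes "decomposition x c" "decomposition x d"
  shows "c = d"
proof
  fix \<nu>
  let ?S = "{\<nu>. c \<nu> \<noteq> 0} \<union> {\<nu>. d \<nu> \<noteq> 0}"
  have S: "finite ?S" "?S \<subseteq> carrier W"
    using assms by (auto simp: decomposition_def)
  have "(\<Sum>\<nu>\<in>?S. c \<nu>) = x" "(\<Sum>\<nu>\<in>?S. d \<nu>) = x"
    using assms S(1) unfolding decomposition_def
    by (metis (mono_tags, lifting) sum.mono_neutral_right Un_upper1 mem_Collect_eq DiffD2,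
        metis (mono_tags, lifting) sum.mono_neutral_right Un_upper2 mem_Collect_eq DiffD2)
  then have "(\<Sum>\<nu>\<in>?S. c \<nu> + - d \<nu>) = 0"
    by (simp add: sum_subtractf)
  moreover have "c \<nu> + - d \<nu> \<in> V \<nu>" if "\<nu> \<in> ?S" for \<nu>
    using assms that S(2) by (intro V_add V_uminus) (auto simp: decomposition_def)
  ultimately have "c \<nu> + - d \<nu> = 0" if "\<nu> \<in> ?S"
    using V_independent[OF S, of "\<lambda>\<nu>. c \<nu> + - d \<nu>"] that by blast
  then show "c \<nu> = d \<nu>"
    by (cases "\<nu> \<in> ?S") auto
qed

lemma component_eq: "decomposition x c \<Longrightarrow> component \<nu> x = c \<nu>"
  unfolding component_def using decomposition_unique by (metis (mono_tags) someI)

lemma decomposition_homogeneous: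
  "\<nu> \<in> carrier W \<Longrightarrow> v \<in> V \<nu> \<Longrightarrow> decomposition v (\<lambda>\<mu>. if \<mu> = \<nu> then v else 0)"
  by (cases "v = 0") (auto simp: decomposition_def V_zero)

lemma decomposition_zero: "decomposition 0 (\<lambda>_. 0)"
  by (simp add: decomposition_def V_zero)

lemma decomposition_add:
  assumes "decomposition x c" "decomposition y d"
  shows "decomposition (x + y) (\<lambda>\<nu>. c \<nu> + d \<nu>)"
proof -
  let ?S = "{\<nu>. c \<nu> \<noteq> 0} \<union> {\<nu>. d \<nu> \<noteq> 0}"
  have S: "finite ?S" "?S \<subseteq> carrier W"
    using assms by (auto simp: decomposition_def)
  have "x = (\<Sum>\<nu>\<in>?S. c \<nu>)" "y = (\<Sum>\<nu>\<in>?S. d \<nu>)"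
    using assms S(1) by (auto simp: decomposition_def intro!: sum.mono_neutral_left)
  then have "x + y = (\<Sum>\<nu>\<in>?S. c \<nu> + d \<nu>)"
    by (simp add: sum.distrib)
  also have "\<dots> = (\<Sum>\<nu>|c \<nu> + d \<nu> \<noteq> 0. c \<nu> + d \<nu>)"
    using S(1) by (intro sum.mono_neutral_right) auto
  finally have "x + y = (\<Sum>\<nu>|c \<nu> + d \<nu> \<noteq> 0. c \<nu> + d \<nu>)" .
  moreover have "{\<nu>. c \<nu> + d \<nu> \<noteq> 0} \<subseteq> ?S"
    by auto
  ultimately show ?thesis
    using assms S finite_subset[OF \<open>{\<nu>. c \<nu> + d \<nu> \<noteq> 0} \<subseteq> ?S\<close>]
    unfolding decomposition_def by (auto intro: V_add)
qed

lemma decomposition_exists: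
  assumes "F \<subseteq> carrier W" "x \<in> DS F"
  shows "\<exists>c. decomposition x c"
  using assms
proof (induction x rule: DS_induct)
  case zero
  then show ?case using decomposition_zero by blast
next
  case (add \<nu> v x)
  then show ?case
    using assms(1) decomposition_add[OF decomposition_homogeneous[of \<nu> v]] by blast
qed

lemma decomposition_component:
  assumes "F \<subseteq> carrier W" "x \<in> DS F"
  shows "decomposition x (\<lambda>\<nu>. component \<nu> x)"
proof -
  obtain c where c: "decomposition x c"
    using decomposition_exists[OF assms] by blast
  then have "(\<lambda>\<nu>. component \<nu> x) = c"
    using component_eq by blast
  then show ?thesis
    using c by simp
qed

lemma component_0 [simp]: "component \<nu> 0 = 0"
  by (rule component_eq[OF decomposition_zero])

lemma component_homogeneous:
  "\<nu> \<in> carrier W \<Longrightarrow> v \<in> V \<nu> \<Longrightarrow> component \<mu> v = (if \<mu> = \<nu> then v else 0)"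
  using component_eq[OF decomposition_homogeneous] by simp

lemma component_add:
  assumes "F \<subseteq> carrier W" "x \<in> DS F" "y \<in> DS F"
  shows "component \<nu> (x + y) = component \<nu> x + component \<nu> y"
  using component_eq[OF decomposition_add[OF decomposition_component decomposition_component]] assms
  by blast

lemma component_sum:
  assumes "F \<subseteq> carrier W" "\<And>i. i \<in> S \<Longrightarrow> f i \<in> DS F"
  shows "component \<nu> (\<Sum>i\<in>S. f i) = (\<Sum>i\<in>S. component \<nu> (f i))"
  using assms(2)
  by (induction S rule: infinite_finite_induct) (auto simp: component_add[OF assms(1)] DS_sum[OF assms(1)])

lemma component_in_V:
  assumes "F \<subseteq> carrier W" "x \<in> DS F" "\<nu> \<in> carrier W"
  shows "component \<nu> x \<in> V \<nu>"
  using decomposition_component[OF assms(1,2)] assms(3) by (simp add: decomposition_def)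

lemma component_outside:
  assumes "F \<subseteq> carrier W" "x \<in> DS F" "\<nu> \<notin> F"
  shows "component \<nu> x = 0"
  using assms(1,2)
proof (induction x rule: DS_induct)
  case (add \<mu> v x)
  then show ?case
    using assms by (auto simp: component_add[OF assms(1)] component_homogeneous DS_homogeneous subset_iff)
qed simp

lemma sum_components:
  assumes "F \<subseteq> carrier W" "x \<in> DS F" "finite S" "{\<nu>. component \<nu> x \<noteq> 0} \<subseteq> S"
  shows "x = (\<Sum>\<nu>\<in>S. component \<nu> x)"
proof -
  have "x = (\<Sum>\<nu>|component \<nu> x \<noteq> 0. component \<nu> x)"
    using decomposition_component[OF assms(1,2)] by (simp add: decomposition_def)
  also have "\<dots> = (\<Sum>\<nu>\<in>S. component \<nu> x)"
    using assms(3,4) by (intro sum.mono_neutral_left) auto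
  finally show ?thesis .
qed

lemma eq_0_if_components_0: "F \<subseteq> carrier W \<Longrightarrow> x \<in> DS F \<Longrightarrow> (\<And>\<nu>. component \<nu> x = 0) \<Longrightarrow> x = 0"
  using sum_components[of F x "{}"] by simp

lemma component_nonzero_in: "F \<subseteq> carrier W \<Longrightarrow> x \<in> DS F \<Longrightarrow> component \<nu> x \<noteq> 0 \<Longrightarrow> \<nu> \<in> F"
  using component_outside by blast

text \<open>A homogeneous factor shifts all degrees by one group element, so different components
  are never mixed.\<close>

lemma component_mult_right:
  assumes x: "x \<in> DS (carrier W)" and \<nu>: "\<nu> \<in> carrier W" "w \<in> V \<nu>" and \<mu>: "\<mu> \<in> carrier W"
  shows "component (\<mu> \<otimes> \<nu>) (x * w) = component \<mu> x * w"
  using subset_refl x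
proof (induction x rule: DS_induct)
  case (add \<kappa> v x)
  have vw: "v * w \<in> V (\<kappa> \<otimes> \<nu>)" "\<kappa> \<otimes> \<nu> \<in> carrier W"
    using add \<nu> by (auto intro: V_mult)
  moreover have "x * w \<in> DS (carrier W)"
    using unital_subring_DS[OF subgroup_self] add(3) DS_homogeneous[OF subset_refl \<nu>]
    by (simp add: unital_subring_def)
  moreover have "\<mu> \<otimes> \<nu> = \<kappa> \<otimes> \<nu> \<longleftrightarrow> \<mu> = \<kappa>"
    using \<mu> \<nu> add by simp
  ultimately show ?case
    using add DS_homogeneous[OF subset_refl] component_homogeneous[OF vw(2,1)] component_homogeneous[of \<kappa> v]
    by (simp add: distrib_right component_add[OF subset_refl])
qed simp

lemma component_mult_left:
  assumes x: "x \<in> DS (carrier W)" and \<nu>: "\<nu> \<in> carrier W" "w \<in> V \<nu>" and \<mu>: "\<mu> \<in> carrier W"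
  shows "component (\<nu> \<otimes> \<mu>) (w * x) = w * component \<mu> x"
  using subset_refl x
proof (induction x rule: DS_induct)
  case (add \<kappa> v x)
  have vw: "w * v \<in> V (\<nu> \<otimes> \<kappa>)" "\<nu> \<otimes> \<kappa> \<in> carrier W"
    using add \<nu> by (auto intro: V_mult)
  moreover have "w * x \<in> DS (carrier W)"
    using unital_subring_DS[OF subgroup_self] add(3) DS_homogeneous[OF subset_refl \<nu>]
    by (simp add: unital_subring_def)
  moreover have "\<nu> \<otimes> \<mu> = \<nu> \<otimes> \<kappa> \<longleftrightarrow> \<mu> = \<kappa>"
    using \<mu> \<nu> add by simp
  ultimately show ?case
    using add DS_homogeneous[OF subset_refl] component_homogeneous[OF vw(2,1)] component_homogeneous[of \<kappa> v]
    by (simp add: distrib_left component_add[OF subset_refl])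
qed simp

lemma homogeneous_fraction:
  assumes F: "F \<subseteq> carrier W" and \<nu>: "\<nu> \<in> carrier W" "v \<in> V \<nu>" "v \<noteq> 0" and v: "v \<in> Frac (DS F)"
  obtains \<mu> u where "\<mu> \<in> F" "\<nu> \<otimes> \<mu> \<in> F" "u \<in> V \<mu>" "u \<noteq> 0" "u * v \<in> V (\<nu> \<otimes> \<mu>)" "v = inverse u * (u * v)"
proof -
  obtain s a where sa: "s \<in> DS F" "s \<noteq> 0" "a \<in> DS F" "v = inverse s * a"
    using v by (auto simp: Frac_def)
  then have a: "s * v = a"
    by (simp flip: mult.assoc)
  \<comment> \<open>Any degree occurring in the denominator will do; the component of
    \<open>s\<close> there becomes the new denominator.\<close>
  obtain \<mu> where \<mu>: "component \<mu> s \<noteq> 0"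
    using eq_0_if_components_0[OF F sa(1)] sa(2) by blast
  then have "\<mu> \<in> F"
    using component_nonzero_in[OF F sa(1)] by blast
  then have "\<mu> \<in> carrier W"
    using F by blast
  have "component (\<mu> \<otimes> \<nu>) a = component \<mu> s * v"
    unfolding a[symmetric] using sa(1) DS_mono[OF F] \<nu> \<open>\<mu> \<in> carrier W\<close>
    by (intro component_mult_right) auto
  then have "\<mu> \<otimes> \<nu> \<in> F"
    using component_nonzero_in[OF F sa(3)] \<mu> \<nu>(3) by (metis mult_eq_0_iff)
  then have "\<nu> \<otimes> \<mu> \<in> F"
    using m_comm \<open>\<mu> \<in> carrier W\<close> \<nu>(1) by simp
  have "component \<mu> s \<in> V \<mu>"
    by (rule component_in_V[OF F sa(1) \<open>\<mu> \<in> carrier W\<close>])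
  moreover have "component \<mu> s * v \<in> V (\<nu> \<otimes> \<mu>)"
    using V_mult[OF \<open>\<mu> \<in> carrier W\<close> \<nu>(1) calculation \<nu>(2)] m_comm \<open>\<mu> \<in> carrier W\<close> \<nu>(1) by simp
  ultimately show thesis
    using that[OF \<open>\<mu> \<in> F\<close> \<open>\<nu> \<otimes> \<mu> \<in> F\<close> _ \<mu>] \<mu> by (simp flip: mult.assoc)
qed

subsection \<open>Finite groups of degrees\<close>

text \<open>The set of leading degrees of a left subspace, with respect to an enumeration of the finite
  group, plays the role of its dimension.\<close>

lemma inverse_in_DS_finite:
  assumes T: "subgroup T W" and fin: "finite T" and x: "x \<in> DS T"
  shows "inverse x \<in> DS T"
proof (cases "x = 0")
  case True
  then show ?thesis by (simp add: DS_0)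
next
  case False
  obtain idx :: "'w \<Rightarrow> nat" where idx: "inj_on idx T"
    using fin finite_imp_inj_to_nat_seg by blast
  note sub = subgroup.subset[OF T]
  have A: "x + y \<in> DS T" "x * y \<in> DS T" "- x \<in> DS T" "1 \<in> DS T" if "x \<in> DS T" "y \<in> DS T" for x y
    using unital_subring_DS[OF T] that by (auto simp: unital_subring_def)
  \<comment> \<open>\<open>L\<close> collects the degrees at which an element of the subspace has
    its last nonzero component in the enumeration. It is applied to the decreasing left subspaces
    \<open>M k\<close> of multiples of x^k.\<close>
  define L where "L = (\<lambda>M. {\<tau> \<in> T. \<exists>y\<in>M. component \<tau> y \<noteq> 0 \<and> (\<forall>\<sigma>\<in>T. idx \<sigma> > idx \<tau> \<longrightarrow> component \<sigma> y = 0)})"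
  define M where "M = (\<lambda>k. (\<lambda>a. a * x ^ k) ` DS T)"
  have xk: "x ^ k \<in> DS T" for k
    using A x by (induction k) auto
  have M_sub: "M k \<subseteq> DS T" for k
    unfolding M_def using A(2)[OF _ xk] by blast
  have M_diff: "y - c * z \<in> M k" if "y \<in> M k" "z \<in> M k" "c \<in> DS T" for y z c k
  proof -
    obtain a b where "y = a * x ^ k" "z = b * x ^ k" "a \<in> DS T" "b \<in> DS T"
      using \<open>y \<in> M k\<close> \<open>z \<in> M k\<close> unfolding M_def by blast
    then have "y - c * z = (a + - (c * b)) * x ^ k" "a + - (c * b) \<in> DS T"
      using A that(3) by (auto simp: algebra_simps simp del: add_uminus_conv_diff)
    then show ?thesis
      unfolding M_def by blast
  qed
  have M_Suc: "M (Suc k) \<subseteq> M k" for k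
  proof
    fix y assume "y \<in> M (Suc k)"
    then obtain a where "y = (a * x) * x ^ k" "a \<in> DS T"
      unfolding M_def by (auto simp: mult.assoc)
    then show "y \<in> M k"
      unfolding M_def using A x by blast
  qed
  have V_one_DS: "V \<one> \<subseteq> DS T"
    using DS_homogeneous[OF sub] subgroup.one_closed[OF T] by blast
  \<comment> \<open>Gaussian elimination: with equal leading degrees, an element of
    \<open>M k\<close> is reduced by elements of \<open>M (Suc k)\<close> one degree at a time, and
    \<open>d\<close> bounds the indices still present.\<close>
  have M_eq: "M k \<subseteq> M (Suc k)" if L: "L (M (Suc k)) = L (M k)" for k
  proof -
    have "y \<in> M (Suc k)" if "y \<in> M k" "\<forall>\<sigma>\<in>T. component \<sigma> y \<noteq> 0 \<longrightarrow> idx \<sigma> < d" for y d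
      using that
    proof (induction d arbitrary: y)
      case 0
      then have "y \<in> DS T" "component \<sigma> y = 0" if "\<sigma> \<in> T" for \<sigma>
        using M_sub that by auto
      then have "y = 0"
        using eq_0_if_components_0[OF sub, of y] component_nonzero_in[OF sub, of y]
          subgroup.one_closed[OF T] by metis
      then show ?case
        unfolding M_def using DS_0 by (auto intro!: image_eqI[of _ _ 0])
    next
      case (Suc d)
      show ?case
      proof (cases "\<exists>\<tau>\<in>T. idx \<tau> = d \<and> component \<tau> y \<noteq> 0")
        case False
        then show ?thesis
          using Suc.IH[OF Suc.prems(1)] Suc.prems(2) less_Suc_eq by blast
      next
        case True
        then obtain \<tau> where \<tau>: "\<tau> \<in> T" "idx \<tau> = d" "component \<tau> y \<noteq> 0"
          by blast
        have "component \<sigma> y = 0" if "\<sigma> \<in> T" "idx \<sigma> > idx \<tau>" for \<sigma>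
          using Suc.prems(2) that \<tau>(2) by (metis not_less_eq)
        then have "\<tau> \<in> L (M k)"
          unfolding L_def using Suc.prems(1) \<tau>(1,3) by blast
        then obtain z where z: "z \<in> M (Suc k)" "component \<tau> z \<noteq> 0"
          "\<And>\<sigma>. \<sigma> \<in> T \<Longrightarrow> idx \<sigma> > d \<Longrightarrow> component \<sigma> z = 0"
          unfolding L[symmetric] unfolding L_def using \<tau>(2) by blast
        have in_DS: "y \<in> DS T" "z \<in> DS T" and \<tau>W: "\<tau> \<in> carrier W"
          using Suc.prems(1) z(1) M_sub \<tau>(1) sub by blast+
        \<comment> \<open>Both components have degree \<tau>, so \<open>c\<close> lies in V \<one>
          and multiplication by it preserves degrees. Subtracting \<open>c * z\<close> cancels the
          leading component of \<open>y\<close> and creates none beyond it.\<close>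
        define c where "c = component \<tau> y * inverse (component \<tau> z)"
        have "c \<in> V (\<tau> \<otimes> inv \<tau>)"
          unfolding c_def using in_DS \<tau>W by (intro V_mult V_inverse component_in_V[OF sub]) auto
        then have c: "c \<in> V \<one>" "c \<in> DS T"
          using \<tau>W V_one_DS by (auto simp: r_inv)
        have comp: "component \<sigma> (y - c * z) = component \<sigma> y - c * component \<sigma> z" if "\<sigma> \<in> T" for \<sigma>
        proof -
          have "\<sigma> \<in> carrier W"
            using that sub by blast
          have "component \<sigma> (y + - c * z) = component \<sigma> y + component \<sigma> (- c * z)"
            using in_DS c A by (intro component_add[OF sub]) auto
          also have "component (\<one> \<otimes> \<sigma>) (- c * z) = - c * component \<sigma> z"
            using in_DS c DS_mono[OF sub] \<open>\<sigma> \<in> carrier W\<close> by (intro component_mult_left V_uminus) auto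
          then have "component \<sigma> (- c * z) = - c * component \<sigma> z"
            using \<open>\<sigma> \<in> carrier W\<close> by simp
          finally show ?thesis
            by simp
        qed
        have "z \<in> M k"
          using z(1) M_Suc by blast
        then have "y - c * z \<in> M k"
          using M_diff Suc.prems(1) c(2) by blast
        moreover have "idx \<sigma> < d" if \<sigma>: "\<sigma> \<in> T" "component \<sigma> (y - c * z) \<noteq> 0" for \<sigma>
        proof (rule ccontr)
          assume "\<not> idx \<sigma> < d"
          then consider "idx \<sigma> = d" | "idx \<sigma> > d"
            by linarith
          then show False
          proof cases
            case 1
            then have "\<sigma> = \<tau>"
              using idx \<sigma>(1) \<tau> by (auto dest: inj_onD)
            then show False
              using \<sigma>(2) comp[OF \<tau>(1)] z(2) by (simp add: c_def mult.assoc)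
          next
            case 2
            then have "component \<sigma> y = 0"
              using Suc.prems(2) \<sigma>(1) by fastforce
            then show False
              using \<sigma> comp z(3)[OF \<sigma>(1) 2] by simp
          qed
        qed
        ultimately have "y - c * z \<in> M (Suc k)"
          using Suc.IH by blast
        \<comment> \<open>\<open>c * z\<close> is added back by using \<open>M_diff\<close> with the
          coefficient \<open>- c\<close>.\<close>
        then have "(y - c * z) - (- c) * z \<in> M (Suc k)"
          by (rule M_diff[OF _ z(1) A(3)[OF c(2) c(2)]])
        then show ?thesis
          by simp
      qed
    qed
    moreover have "\<exists>d. \<forall>\<sigma>\<in>T. idx \<sigma> < d"
      using fin by (metis finite_imageI finite_nat_set_iff_bounded imageI)
    ultimately show ?thesis
      by blast
  qed
  \<comment> \<open>Each strict decrease uses up one of the \<open>card T\<close> degrees.\<close>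
  have "\<exists>k. L (M (Suc k)) = L (M k)"
  proof (rule ccontr)
    assume neg: "\<not> ?thesis"
    have "card (L (M k)) + k \<le> card T" for k
    proof (induction k)
      case 0
      show ?case
        unfolding L_def using fin by (auto intro!: card_mono)
    next
      case (Suc k)
      have "L (M (Suc k)) \<subset> L (M k)"
        using neg M_Suc[of k] unfolding L_def by blast
      moreover have "finite (L (M k))"
        unfolding L_def using fin by auto
      ultimately have "card (L (M (Suc k))) < card (L (M k))"
        by (rule psubset_card_mono[rotated])
      then show ?case
        using Suc by simp
    qed
    from this[of "Suc (card T)"] show False
      by simp
  qed
  \<comment> \<open>Now x^k is a left multiple of x^(k+1); cancelling x^k leaves a left inverse of x
    inside \<open>DS T\<close>.\<close>
  then obtain k where "M k \<subseteq> M (Suc k)"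
    using M_eq by blast
  moreover have "1 * x ^ k \<in> M k"
    unfolding M_def using A(4)[OF x x] by blast
  ultimately obtain a where a: "a \<in> DS T" "1 * x ^ k = a * x ^ Suc k"
    unfolding M_def by blast
  then have "1 * x ^ k = (a * x) * x ^ k"
    by (simp add: mult.assoc)
  then have "1 = a * x"
    using False by (subst (asm) mult_cancel_right) simp
  then have "inverse x = a"
    using False by (metis mult.assoc mult_1_left mult_1_right right_inverse)
  then show ?thesis
    using a(1) by simp
qed

section \<open>Noetherian property and dimension of sums of components\<close>

lemma V_power: "\<nu> \<in> carrier W \<Longrightarrow> u \<in> V \<nu> \<Longrightarrow> u ^ n \<in> V (\<nu> [^] n)"
proof (induction n)
  case (Suc n)
  then have "u ^ n * u \<in> V (\<nu> [^] n \<otimes> \<nu>)"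
    by (intro V_mult) auto
  then show ?case
    by (simp add: power_commutes)
qed (simp add: V_one)

lemma V_power_int:
  fixes k :: int
  assumes "\<nu> \<in> carrier W" "u \<in> V \<nu>"
  shows "u powi k \<in> V (\<nu> [^] k)"
proof (cases "k \<ge> 0")
  case True
  then show ?thesis
    using V_power[OF assms, of "nat k"] by (metis int_nat_eq int_pow_int power_int_of_nat)
next
  case False
  then obtain n where k: "k = - int n"
    by (metis int_nat_eq linear minus_minus neg_0_le_iff_le)
  have "inverse (u ^ n) \<in> V (inv (\<nu> [^] n))"
    using V_power[OF assms] assms by (intro V_inverse) auto
  moreover have "\<nu> [^] k = inv (\<nu> [^] n)"
    unfolding k by (simp add: int_pow_neg int_pow_int assms(1))
  moreover have "u powi k = inverse (u ^ n)"
    unfolding k power_int_minus by simp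
  ultimately show ?thesis
    by simp
qed

text \<open>The component of neutral degree is a division ring, so a one-sided ideal of it is zero
  or everything.\<close>

lemma acc_ideal_in_V_one:
  fixes m :: "'d \<Rightarrow> 'd \<Rightarrow> 'd" (infixl \<open>\<star>\<close> 70)
  assumes "side m"
  shows "acc (side.ideal_in m (V \<one>))"
  unfolding acc_def
proof (intro allI impI)
  interpret side m by fact
  fix C :: "nat \<Rightarrow> 'd set"
  assume "\<forall>n. ideal_in (V \<one>) (C n) \<and> C n \<subseteq> C (Suc n)"
  then have C: "ideal_in (V \<one>) (C n)" and mono: "i \<le> j \<Longrightarrow> C i \<subseteq> C j" for n i j
    by (auto simp: lift_Suc_mono_le)
  have full: "C n = V \<one>" if x: "x \<in> C n" "x \<noteq> 0" for x n
  proof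
    show "C n \<subseteq> V \<one>"
      by (rule ideal_inD(1)[OF C])
    have x1: "x \<in> V \<one>"
      using ideal_inD(1)[OF C] x(1) by blast
    have "y \<in> C n" if y: "y \<in> V \<one>" for y
    proof -
      have "y \<star> inverse x \<in> V \<one>"
        using side V_inverse[of "\<one>" x] V_mult[of "\<one>" "\<one>"] x1 y by fastforce
      then have "(y \<star> inverse x) \<star> x \<in> C n"
        using ideal_inD(4)[OF C] x(1) by blast
      then show ?thesis
        using x(2) by (simp add: assoc inverse_left)
    qed
    then show "V \<one> \<subseteq> C n"
      by blast
  qed
  show "\<exists>N. \<forall>n\<ge>N. C n = C N"
  proof (cases "\<exists>n x. x \<in> C n \<and> x \<noteq> 0")
    case True
    then obtain N x where "x \<in> C N" "x \<noteq> 0"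
      by blast
    then have "\<forall>n\<ge>N. C n = V \<one>"
      using full mono by blast
    then show ?thesis
      by (metis order_refl)
  next
    case False
    then have "C n = {0}" for n
      using ideal_inD(2)[OF C] by blast
    then show ?thesis
      by auto
  qed
qed

text \<open>Conjugation by u leaves degrees unchanged, so u normalizes \<open>DS F\<close>. A
  component of degree \<open>h \<otimes> g [^] k\<close> differs from one of degree \<open>h\<close>
  by the factor u^k, so a power of u makes every element a polynomial and the basis theorem applies.
  Here \<open>g\<close> may have finite order modulo \<open>F\<close>.\<close>

lemma acc_DS_adjoin:
  fixes m :: "'d \<Rightarrow> 'd \<Rightarrow> 'd" (infixl \<open>\<star>\<close> 70)
  assumes "side m" and F: "subgroup F W" and F': "subgroup F' W" "F \<subseteq> F'" and g: "g \<in> Ev" "g \<in> F'"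
    and gen: "\<And>x. x \<in> F' \<Longrightarrow> \<exists>h\<in>F. \<exists>k::int. x = h \<otimes> g [^] k"
    and acc: "acc (side.ideal_in m (DS F))"
  shows "acc (side.ideal_in m (DS F'))"
proof -
  interpret side m by fact
  note sub = subgroup.subset[OF F] and sub' = subgroup.subset[OF F'(1)]
  have gW: "g \<in> carrier W"
    using g(2) sub' by blast
  obtain u where u: "u \<in> V g" "u \<noteq> 0"
    using g(1) by (auto simp: Ev_def)
  have V_side: "x \<star> y \<in> V (\<nu> \<otimes> \<mu>)" if "\<nu> \<in> carrier W" "\<mu> \<in> carrier W" "x \<in> V \<nu>" "y \<in> V \<mu>" for x y \<nu> \<mu>
    using side that V_mult[of \<nu> \<mu> x y] V_mult[of \<mu> \<nu> y x] m_comm[of \<nu> \<mu>] by auto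
  have conj: "u * a * inverse u \<in> DS F" "inverse u * a * u \<in> DS F" if "a \<in> DS F" for a
    using sub that
  proof (induction a rule: DS_induct)
    case (add \<nu> v x)
    have \<nu>: "\<nu> \<in> carrier W"
      using add(1) sub by blast
    have "u * v * inverse u \<in> V (g \<otimes> \<nu> \<otimes> inv g)" "inverse u * v * u \<in> V (inv g \<otimes> \<nu> \<otimes> g)"
      using gW \<nu> add(2) u(1) by (auto intro!: V_mult V_inverse)
    moreover have "g \<otimes> \<nu> \<otimes> inv g = \<nu>" "inv g \<otimes> \<nu> \<otimes> g = \<nu>"
      using gW \<nu> by (metis inv_solve_right m_closed m_comm, metis inv_solve_left m_assoc m_comm inv_closed m_closed)
    ultimately have "u * v * inverse u \<in> V \<nu>" "inverse u * v * u \<in> V \<nu>"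
      by simp_all
    then show "u * (v + x) * inverse u \<in> DS F" "inverse u * (v + x) * u \<in> DS F"
      using DS_add_homogeneous[OF sub add(1)] add(4,5)
      by (simp_all add: ring_distribs)
  qed (simp_all add: DS_0)
  have shift: "\<exists>k n. u ^ k \<star> f \<in> skew_polys (DS F) u n" if "f \<in> DS F'" for f
    using sub' that
  proof (induction f rule: DS_induct)
    case zero
    then show ?case
      by (auto intro!: exI[of _ 0])
  next
    case (add \<nu> v x)
    obtain h and k :: int where h: "h \<in> F" "\<nu> = h \<otimes> g [^] k"
      using gen[OF add(1)] by blast
    have hW: "h \<in> carrier W"
      using h(1) sub by blast
    \<comment> \<open>The positive and negative parts of k: as - ?n + ?l + k = 0, the element
      \<open>inverse u ^ ?n \<star> (u ^ ?l \<star> v)\<close> has degree \<open>h\<close>.\<close>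
    let ?l = "nat (- k)" and ?n = "nat k"
    have "inverse u ^ ?n \<star> (u ^ ?l \<star> v) \<in> V (inv g [^] ?n \<otimes> (g [^] ?l \<otimes> \<nu>))"
      using add(2) gW u(1) hW h(2) by (intro V_side V_power V_inverse) auto
    also have "inv g [^] ?n \<otimes> (g [^] ?l \<otimes> \<nu>) = h \<otimes> (inv g [^] ?n \<otimes> g [^] ?l \<otimes> g [^] k)"
      using gW hW h(2) by (simp add: m_ac)
    also have "inv g [^] ?n \<otimes> g [^] ?l \<otimes> g [^] k = \<one>"
    proof -
      have "inv g [^] ?n = g [^] (- int ?n)" "g [^] ?l = g [^] int ?l"
        using gW by (simp_all add: int_pow_neg int_pow_int nat_pow_inv)
      then have "inv g [^] ?n \<otimes> g [^] ?l \<otimes> g [^] k = g [^] (- int ?n + int ?l + k)"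
        using gW by (simp add: int_pow_mult)
      then show ?thesis
        by simp
    qed
    finally have "inverse u ^ ?n \<star> (u ^ ?l \<star> v) \<in> DS F"
      using DS_homogeneous[OF sub h(1)] hW by simp
    then have "u ^ ?n \<star> (inverse u ^ ?n \<star> (u ^ ?l \<star> v)) + 0 \<in> skew_polys (DS F) u (Suc ?n)"
      using skew_polys_SucI[OF unital_subring_DS[OF F] u(2) conj] skew_polys_0[OF unital_subring_DS[OF F] u(2) conj] by blast
    moreover have "u ^ ?n \<star> (inverse u ^ ?n \<star> (u ^ ?l \<star> v)) = u ^ ?l \<star> v"
      using u(2) by (simp add: power_inverse inverse_right flip: assoc)
    ultimately have v: "u ^ ?l \<star> v \<in> skew_polys (DS F) u (Suc ?n)"
      by simp
    obtain l n where x: "u ^ l \<star> x \<in> skew_polys (DS F) u n"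
      using add(4) by blast
    note shift = skew_polys_shift_pow[OF unital_subring_DS[OF F] u(2) conj]
      and mono = skew_polys_mono[OF unital_subring_DS[OF F] u(2) conj]
    \<comment> \<open>A common degree bound for both shifted summands.\<close>
    let ?M = "Suc ?n + l + (n + ?l)"
    have "u ^ l \<star> (u ^ ?l \<star> v) \<in> skew_polys (DS F) u ?M"
      by (rule mono[OF _ _ _ shift[OF _ _ v]]) auto
    moreover have "u ^ ?l \<star> (u ^ l \<star> x) \<in> skew_polys (DS F) u ?M"
      by (rule mono[OF _ _ _ shift[OF _ _ x]]) auto
    ultimately have "u ^ l \<star> (u ^ ?l \<star> v) + u ^ ?l \<star> (u ^ l \<star> x) \<in> skew_polys (DS F) u ?M"
      using skew_polys_add[OF unital_subring_DS[OF F] u(2) conj] by blast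
    \<comment> \<open>Powers of u commute, so both summands can be brought under the single exponent
      l + ?l.\<close>
    moreover have "u ^ (l + ?l) = u ^ l \<star> u ^ ?l" "u ^ (l + ?l) = u ^ ?l \<star> u ^ l"
      using side by (auto simp: power_add) (metis add.commute power_add)+
    then have "u ^ (l + ?l) \<star> (v + x) = u ^ l \<star> (u ^ ?l \<star> v) + u ^ ?l \<star> (u ^ l \<star> x)"
      by (metis assoc distrib_left)
    ultimately show ?case
      by metis
  qed
  show ?thesis
  proof (rule acc_skew_laurent[OF unital_subring_DS[OF F] u(2) conj unital_subring_DS[OF F'(1)] DS_mono[OF F'(2)]])
    show "u \<in> DS F'" "inverse u \<in> DS F'"
      using DS_homogeneous[OF sub'] u g(2) V_inverse[OF gW u(1)] subgroup.m_inv_closed[OF F'(1) g(2)]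
      by blast+
  qed (use shift acc in auto)
qed

lemma acc_DS_generate:
  assumes "side m" "finite Z" "Z \<subseteq> Ev"
  shows "acc (side.ideal_in m (DS (generate W Z)))"
  using assms(2,3)
proof (induction Z rule: finite_induct)
  case empty
  show ?case
    using acc_ideal_in_V_one[OF assms(1)] by (simp add: generate_empty DS_trivial)
next
  case (insert g Z)
  have Z: "insert g Z \<subseteq> carrier W" "Z \<subseteq> carrier W" "g \<in> carrier W"
    using insert(4) Ev_subset by auto
  show ?case
  proof (rule acc_DS_adjoin[OF assms(1)])
    show "subgroup (generate W Z) W" "subgroup (generate W (insert g Z)) W"
      using Z generate_is_subgroup by auto
    show "generate W Z \<subseteq> generate W (insert g Z)"
      by (rule mono_generate) auto
    show "g \<in> generate W (insert g Z)"
      by (rule generate.incl) simp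
  qed (use insert generate_insert_decompose[OF Z(2,3)] in auto)
qed

text \<open>One nonzero element u \<tau> from each component forms a basis: dividing the component
  of v at \<tau> by u \<tau> leaves a coefficient of neutral degree. The two choices of \<star> give
  the left and the right dimension.\<close>

lemma has_dimension_DS:
  fixes m :: "'d \<Rightarrow> 'd \<Rightarrow> 'd" (infixl \<open>\<star>\<close> 70)
  assumes "side m" and T: "subgroup T W" "T \<subseteq> Ev" "finite T"
  shows "has_dimension (add_monoid (ring_on (DS T))) (V \<one>) m (card T)"
proof -
  interpret side m by fact
  note sub = subgroup.subset[OF T(1)]
  have "\<forall>\<tau>\<in>T. \<exists>u. u \<in> V \<tau> \<and> u \<noteq> 0"
    using T(2) by (auto simp: Ev_def)
  then obtain u where u: "\<And>\<tau>. \<tau> \<in> T \<Longrightarrow> u \<tau> \<in> V \<tau>" "\<And>\<tau>. \<tau> \<in> T \<Longrightarrow> u \<tau> \<noteq> 0"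
    by metis
  have comp_u: "component \<sigma> (u \<tau>) = (if \<sigma> = \<tau> then u \<tau> else 0)" if "\<tau> \<in> T" for \<sigma> \<tau>
    using component_homogeneous[of \<tau>] that u sub by blast
  have inj: "inj_on u T"
    by (rule inj_onI) (metis comp_u u(2))
  have V_side: "x \<star> y \<in> V (\<nu> \<otimes> \<mu>)" if "\<nu> \<in> carrier W" "\<mu> \<in> carrier W" "x \<in> V \<nu>" "y \<in> V \<mu>" for x y \<nu> \<mu>
    using side that V_mult[of \<nu> \<mu> x y] V_mult[of \<mu> \<nu> y x] m_comm[of \<nu> \<mu>] by auto
  have prod: "a \<star> u \<tau> \<in> V \<tau>" if "a \<in> V \<one>" "\<tau> \<in> T" for a \<tau>
    using V_side[of "\<one>" \<tau> a "u \<tau>"] that u sub by auto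
  have sum: "finprod (add_monoid (ring_on (DS T))) (\<lambda>b. c b \<star> b) (u ` T) = (\<Sum>\<tau>\<in>T. c (u \<tau>) \<star> u \<tau>)"
    if "c \<in> u ` T \<rightarrow> V \<one>" for c
  proof -
    have "c b \<star> b \<in> DS T" if "b \<in> u ` T" for b
      using that \<open>c \<in> _\<close> prod DS_homogeneous[OF sub] by blast
    then have "finprod (add_monoid (ring_on (DS T))) (\<lambda>b. c b \<star> b) (u ` T) = (\<Sum>b\<in>u ` T. c b \<star> b)"
      using finsum_ring_on[OF unital_subring_DS[OF T(1)], of "u ` T" "\<lambda>b. c b \<star> b"] T(3)
      by (simp add: finsum_def)
    then show ?thesis
      by (simp add: sum.reindex[OF inj])
  qed
  have comp: "component \<sigma> (\<Sum>\<tau>\<in>T. c (u \<tau>) \<star> u \<tau>) = c (u \<sigma>) \<star> u \<sigma>"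
    if "c \<in> u ` T \<rightarrow> V \<one>" "\<sigma> \<in> T" for c \<sigma>
  proof -
    have c: "c (u \<tau>) \<star> u \<tau> \<in> V \<tau>" if "\<tau> \<in> T" for \<tau>
      using \<open>c \<in> _\<close> that prod by blast
    then have "component \<sigma> (\<Sum>\<tau>\<in>T. c (u \<tau>) \<star> u \<tau>) = (\<Sum>\<tau>\<in>T. component \<sigma> (c (u \<tau>) \<star> u \<tau>))"
      using DS_homogeneous[OF sub] by (intro component_sum[OF sub]) blast
    also have "\<dots> = (\<Sum>\<tau>\<in>T. if \<sigma> = \<tau> then c (u \<tau>) \<star> u \<tau> else 0)"
      using c sub by (intro sum.cong refl component_homogeneous) auto
    finally show ?thesis
      using T(3) that(2) by simp
  qed
  show ?thesis
    unfolding has_dimension_def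
  proof (intro exI[of _ "u ` T"] conjI ballI)
    show "u ` T \<subseteq> carrier (add_monoid (ring_on (DS T)))"
      using u(1) DS_homogeneous[OF sub] by auto
    show "card (u ` T) = card T"
      by (rule card_image[OF inj])
    fix v assume "v \<in> carrier (add_monoid (ring_on (DS T)))"
    then have v: "v \<in> DS T"
      by simp
    define c where "c = restrict (\<lambda>b. component (inv_into T u b) v \<star> inverse b) (u ` T)"
    have c_u: "c (u \<tau>) = component \<tau> v \<star> inverse (u \<tau>)" if "\<tau> \<in> T" for \<tau>
      using that by (simp add: c_def inv_into_f_f[OF inj])
    have "c (u \<tau>) \<in> V \<one>" if "\<tau> \<in> T" for \<tau>
    proof -
      have \<tau>: "\<tau> \<in> carrier W"
        using that sub by blast
      then have "component \<tau> v \<star> inverse (u \<tau>) \<in> V (\<tau> \<otimes> inv \<tau>)"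
        using u(1)[OF that] v by (intro V_side component_in_V[OF sub] V_inverse) auto
      then show ?thesis
        using c_u[OF that] \<tau> by simp
    qed
    then have c: "c \<in> u ` T \<rightarrow>\<^sub>E V \<one>"
      by (auto simp: c_def)
    have "(\<Sum>\<tau>\<in>T. c (u \<tau>) \<star> u \<tau>) = (\<Sum>\<tau>\<in>T. component \<tau> v)"
      using u(2) by (intro sum.cong refl) (simp add: c_u assoc inverse_left)
    also have "\<dots> = v"
      using T(3) component_nonzero_in[OF sub v] by (intro sum_components[OF sub v, symmetric]) auto
    finally have "v = finprod (add_monoid (ring_on (DS T))) (\<lambda>b. c b \<star> b) (u ` T)"
      using sum[of c] c by (simp only: PiE_def Int_iff)
    moreover have "d = c" if d: "d \<in> u ` T \<rightarrow>\<^sub>E V \<one>"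
      and v': "v = finprod (add_monoid (ring_on (DS T))) (\<lambda>b. d b \<star> b) (u ` T)" for d
    proof (rule PiE_ext[OF d c])
      fix b assume "b \<in> u ` T"
      then obtain \<tau> where \<tau>: "\<tau> \<in> T" "b = u \<tau>"
        by blast
      have d': "d \<in> u ` T \<rightarrow> V \<one>"
        using d by (simp only: PiE_def Int_iff)
      have "component \<tau> v = d (u \<tau>) \<star> u \<tau>"
        unfolding v' sum[OF d'] by (rule comp[OF d' \<tau>(1)])
      then show "d b = c b"
        using u(2)[OF \<tau>(1)] by (simp add: \<tau>(2) c_u[OF \<tau>(1)] assoc inverse_right)
    qed
    ultimately show "\<exists>!c. c \<in> u ` T \<rightarrow>\<^sub>E V \<one> \<and>
        v = finprod (add_monoid (ring_on (DS T))) (\<lambda>b. c b \<star> b) (u ` T)"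
      using c by (intro ex1I[of _ c]) blast+
  qed (use T(3) in auto)
qed

subsection \<open>Adjoining an independent degree\<close>

context
  fixes F F' :: "'w set" and g :: 'w and u :: 'd
  assumes F: "subgroup F W" and F': "F' = {h \<otimes> g [^] k | h k. h \<in> F \<and> k \<in> (UNIV :: int set)}"
    and sgF': "subgroup F' W"
    and g: "g \<in> carrier W" and u: "u \<in> V g" "u \<noteq> 0"
    and independent: "\<And>k::int. g [^] k \<in> F \<Longrightarrow> k = 0"
begin

text \<open>The automorphism \<sigma> of the Laurent extension, dictated by u a = \<sigma>(a)
  u.\<close>

definition conjugation :: "'d \<Rightarrow> 'd" where
  "conjugation a = u * a * inverse u"

definition laurent_eval :: "(int \<Rightarrow> 'd) \<Rightarrow> 'd" where
  "laurent_eval f = (\<Sum>i|f i \<noteq> 0. f i * u powi i)"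

lemma F_carrier: "F \<subseteq> carrier W"
  by (rule subgroup.subset[OF F])

lemma F'_carrier: "F' \<subseteq> carrier W"
  by (rule subgroup.subset[OF sgF'])

lemma F_subset: "F \<subseteq> F'"
proof
  fix h assume "h \<in> F"
  moreover from this have "h = h \<otimes> g [^] (0::int)"
    using F_carrier by auto
  ultimately show "h \<in> F'"
    unfolding F' by blast
qed

text \<open>W is commutative, so conjugation by a power of u keeps each component in its
  degree.\<close>

lemma conj_pow_DS:
  fixes i :: int
  assumes "a \<in> DS F"
  shows "u powi i * a * inverse (u powi i) \<in> DS F"
  using F_carrier assms
proof (induction a rule: DS_induct)
  case (add \<nu> v x)
  have \<nu>: "\<nu> \<in> carrier W"
    using add(1) F_carrier by blast
  have "u powi i * v * inverse (u powi i) \<in> V (g [^] i \<otimes> \<nu> \<otimes> inv (g [^] i))"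
    using g \<nu> add(2) u(1) by (auto intro!: V_mult V_inverse V_power_int)
  also have "g [^] i \<otimes> \<nu> \<otimes> inv (g [^] i) = \<nu>"
    using g \<nu> by (metis int_pow_closed inv_solve_right m_closed m_comm)
  finally show ?case
    using DS_add_homogeneous[OF F_carrier add(1)] add(4) by (simp add: ring_distribs)
qed (simp add: DS_0)

lemma bij_conjugation: "bij_betw conjugation (DS F) (DS F)"
proof (rule bij_betw_byWitness[where f' = "\<lambda>a. inverse u * a * u"])
  show "\<forall>a\<in>DS F. inverse u * conjugation a * u = a" "\<forall>a\<in>DS F. conjugation (inverse u * a * u) = a"
    using u(2) by (simp_all add: conjugation_def mult.assoc) (simp_all flip: mult.assoc)
  show "conjugation ` DS F \<subseteq> DS F"
    using conj_pow_DS[of _ 1] by (auto simp: conjugation_def)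
  show "(\<lambda>a. inverse u * a * u) ` DS F \<subseteq> DS F"
    using conj_pow_DS[of _ "- 1"] by auto
qed

lemma conjugation_iso: "conjugation \<in> ring_iso (ring_on (DS F)) (ring_on (DS F))"
proof (rule ring_iso_memI)
  fix x y
  have "u * (x * y) * inverse u = (u * x * inverse u) * (u * y * inverse u)"
    using u(2) by (simp add: mult.assoc) (simp flip: mult.assoc)
  then show "conjugation (x \<otimes>\<^bsub>ring_on (DS F)\<^esub> y) = conjugation x \<otimes>\<^bsub>ring_on (DS F)\<^esub> conjugation y"
    by (simp add: conjugation_def)
qed (use bij_conjugation u(2) conj_pow_DS[of _ 1] in \<open>auto simp: conjugation_def ring_distribs\<close>)

lemma auto_pow_conjugation:
  assumes "a \<in> DS F"
  shows "auto_pow (ring_on (DS F)) conjugation i a = u powi i * a * inverse (u powi i)"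
proof (cases "i \<ge> 0")
  case True
  have "(conjugation ^^ n) a = u ^ n * a * inverse (u ^ n)" for n
    by (induction n) (use u(2) in \<open>simp_all add: conjugation_def mult.assoc nonzero_inverse_mult_distrib power_commutes
       flip: power_Suc2\<close>)
  then show ?thesis
    using True by (simp add: auto_pow_def power_int_def)
next
  case False
  \<comment> \<open>\<open>auto_pow\<close> inverts \<sigma> by \<open>inv_into\<close> on
    \<open>DS F\<close>, and only there is this known to be the opposite conjugation; the iterates
    must therefore be seen to stay in \<open>DS F\<close>.\<close>
  have inv: "inv_into (DS F) conjugation b = inverse u * b * u" if "b \<in> DS F" for b
  proof -
    have "conjugation (inverse u * b * u) = b"
      using u(2) by (simp add: conjugation_def mult.assoc) (simp flip: mult.assoc)
    moreover have "inverse u * b * u \<in> DS F"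
      using conj_pow_DS[OF that, of "- 1"] by simp
    ultimately show ?thesis
      using bij_betw_inv_into_left[OF bij_conjugation] by metis
  qed
  have "(inv_into (DS F) conjugation ^^ n) a = inverse u ^ n * a * u ^ n" for n
  proof (induction n)
    case (Suc n)
    have "inverse u ^ n * a * u ^ n \<in> DS F"
      using conj_pow_DS[OF assms, of "- int n"] by (simp add: power_int_minus power_inverse)
    then show ?case
      by (simp add: Suc inv mult.assoc power_commutes)
  qed simp
  then show ?thesis
    using False by (simp add: auto_pow_def power_int_def power_inverse)
qed

abbreviation "Laurent \<equiv> skew_laurent (ring_on (DS F)) conjugation"

lemma carrier_Laurent: "f \<in> carrier Laurent \<longleftrightarrow> (\<forall>i. f i \<in> DS F) \<and> finite {i. f i \<noteq> 0}"
  by (simp add: skew_laurent_def)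

lemma laurent_eval_superset:
  assumes "finite S" "{i. f i \<noteq> 0} \<subseteq> S"
  shows "laurent_eval f = (\<Sum>i\<in>S. f i * u powi i)"
  unfolding laurent_eval_def using assms by (intro sum.mono_neutral_left) auto

lemma laurent_eval_add:
  assumes "finite {i. f i \<noteq> 0}" "finite {i. h i \<noteq> 0}"
  shows "laurent_eval (\<lambda>i. f i + h i) = laurent_eval f + laurent_eval h"
proof -
  let ?S = "{i. f i \<noteq> 0} \<union> {i. h i \<noteq> 0}"
  have "laurent_eval (\<lambda>i. f i + h i) = (\<Sum>i\<in>?S. (f i + h i) * u powi i)"
    "laurent_eval f = (\<Sum>i\<in>?S. f i * u powi i)" "laurent_eval h = (\<Sum>i\<in>?S. h i * u powi i)"
    using assms by (auto intro!: laurent_eval_superset)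
  then show ?thesis
    by (simp add: ring_distribs sum.distrib)
qed

lemma laurent_eval_monomial: "laurent_eval (\<lambda>i. if i = k then a else 0) = a * u powi k"
  by (subst laurent_eval_superset[of "{k}"]) auto

lemma laurent_term:
  assumes "a \<in> DS F"
  shows "a * u powi i \<in> DS F'"
proof -
  have "g [^] i \<in> F'"
  proof -
    have "g [^] i = \<one> \<otimes> g [^] i"
      using g by simp
    then show ?thesis
      unfolding F' using subgroup.one_closed[OF F] by blast
  qed
  then have "u powi i \<in> DS F'"
    using DS_homogeneous[OF F'_carrier] V_power_int[OF g u(1)] by blast
  then show ?thesis
    using unital_subring_DS[OF sgF'] assms DS_mono[OF F_subset] by (auto simp: unital_subring_def)
qed

text \<open>The cosets of \<open>F\<close> by the powers of \<open>g\<close> are pairwise different,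
  so this degree is met only by the summand with index i. The coefficients can thus be recovered
  from the value, which gives injectivity.\<close>

lemma component_laurent_eval:
  assumes f: "f \<in> carrier Laurent" and h: "h \<in> F"
  shows "component (h \<otimes> g [^] i) (laurent_eval f) = component h (f i) * u powi i"
proof -
  have hW: "h \<in> carrier W"
    using h F_carrier by blast
  have fin: "finite {j. f j \<noteq> 0}" and f_in: "\<And>j. f j \<in> DS F"
    using f by (auto simp: carrier_Laurent)
  have summand: "component (h \<otimes> g [^] i) (f j * u powi j) = (if j = i then component h (f i) * u powi i else 0)" for j
  proof -
    have eq: "h \<otimes> g [^] i = (h \<otimes> g [^] (i - j)) \<otimes> g [^] j"
      using hW g by (simp add: m_assoc flip: int_pow_mult)
    have "component (h \<otimes> g [^] i) (f j * u powi j) = component (h \<otimes> g [^] (i - j)) (f j) * u powi j"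
      unfolding eq using f_in DS_mono[OF F_carrier] hW g u(1)
      by (intro component_mult_right V_power_int) auto
    moreover have "component (h \<otimes> g [^] (i - j)) (f j) = 0" if "j \<noteq> i"
    proof (rule component_outside[OF F_carrier f_in])
      show "h \<otimes> g [^] (i - j) \<notin> F"
      proof
        assume "h \<otimes> g [^] (i - j) \<in> F"
        then have "inv h \<otimes> (h \<otimes> g [^] (i - j)) \<in> F"
          by (rule subgroup.m_closed[OF F subgroup.m_inv_closed[OF F h]])
        then have "g [^] (i - j) \<in> F"
          using hW g by (simp flip: m_assoc)
        then show False
          using independent that by fastforce
      qed
    qed
    ultimately show ?thesis
      using hW by auto
  qed
  have "component (h \<otimes> g [^] i) (laurent_eval f) = (\<Sum>j\<in>insert i {j. f j \<noteq> 0}. component (h \<otimes> g [^] i) (f j * u powi j))"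
    using fin laurent_term[OF f_in]
    by (subst laurent_eval_superset[of "insert i {j. f j \<noteq> 0}"])
      (auto simp del: sum.insert intro!: component_sum[OF F'_carrier])
  also have "\<dots> = component h (f i) * u powi i"
    unfolding summand using fin by (subst sum.delta) auto
  finally show ?thesis .
qed

lemma laurent_eval_inject:
  assumes f: "f \<in> carrier Laurent" and f': "f' \<in> carrier Laurent" and eq: "laurent_eval f = laurent_eval f'"
  shows "f = f'"
proof
  fix i
  have in_DS: "f i \<in> DS F" "f' i \<in> DS F" "- f' i \<in> DS F"
    using f f' DS_uminus[OF F_carrier] by (auto simp: carrier_Laurent)
  have "component h (f i) = component h (f' i)" for h
  proof (cases "h \<in> F")
    case True
    then have "component h (f i) * u powi i = component h (f' i) * u powi i"
      using component_laurent_eval[OF f] component_laurent_eval[OF f'] eq by metis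
    then show ?thesis
      using u(2) by simp
  next
    case False
    then show ?thesis
      using component_outside[OF F_carrier] in_DS by simp
  qed
  \<comment> \<open>Additivity of \<open>component\<close> yields the difference by adding
    \<open>f' i\<close> back.\<close>
  moreover have "component h (f i + - f' i) + component h (f' i) = component h (f i)" for h
    using in_DS component_add[OF F_carrier DS_add[OF F_carrier in_DS(1,3)] in_DS(2)] by simp
  ultimately have "component h (f i + - f' i) = 0" for h
    by (metis add_cancel_left_left)
  then have "f i + - f' i = 0"
    by (rule eq_0_if_components_0[OF F_carrier DS_add[OF F_carrier in_DS(1,3)]])
  then show "f i = f' i"
    by simp
qed

text \<open>A homogeneous v of degree \<open>h \<otimes> g [^] k\<close> equals (v u^(-k)) u^k, and
  v u^(-k) lies in V h.\<close>

lemma laurent_eval_surj: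
  assumes "x \<in> DS F'"
  shows "\<exists>f\<in>carrier Laurent. laurent_eval f = x"
  using F'_carrier assms
proof (induction x rule: DS_induct)
  case zero
  show ?case
    by (intro bexI[of _ "\<lambda>_. 0"]) (auto simp: carrier_Laurent DS_0 laurent_eval_def)
next
  case (add \<nu> v x)
  obtain f where f: "f \<in> carrier Laurent" "laurent_eval f = x"
    using add(4) by blast
  obtain h and k :: int where h: "h \<in> F" "\<nu> = h \<otimes> g [^] k"
    using add(1) unfolding F' by blast
  have hW: "h \<in> carrier W"
    using h(1) F_carrier by blast
  define a where "a = v * inverse (u powi k)"
  have "a \<in> V (\<nu> \<otimes> inv (g [^] k))"
    unfolding a_def using add(2) hW g u(1) h(2) by (auto intro!: V_mult V_inverse V_power_int)
  moreover have "\<nu> \<otimes> inv (g [^] k) = h"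
    unfolding h(2) using hW g by (simp add: m_assoc)
  ultimately have "a \<in> V h"
    by simp
  then have a: "a \<in> DS F"
    using DS_homogeneous[OF F_carrier h(1)] by simp
  let ?m = "\<lambda>i. if i = k then a else 0"
  have fin: "finite {i. f i \<noteq> 0}" "finite {i. ?m i \<noteq> 0}"
    using f(1) by (auto simp: carrier_Laurent)
  have "finite {i. ?m i + f i \<noteq> 0}"
    by (rule finite_subset[OF _ finite_UnI[OF fin]]) auto
  moreover have "\<forall>i. ?m i + f i \<in> DS F"
    using f(1) a DS_add[OF F_carrier] by (auto simp: carrier_Laurent)
  ultimately have "(\<lambda>i. ?m i + f i) \<in> carrier Laurent"
    unfolding carrier_Laurent by blast
  moreover have "laurent_eval (\<lambda>i. ?m i + f i) = v + x"
    unfolding laurent_eval_add[OF fin(2,1)] laurent_eval_monomial f(2)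
    using u(2) by (simp add: a_def mult.assoc)
  ultimately show ?case
    by blast
qed

lemma mult_Laurent:
  assumes f: "f \<in> carrier Laurent" and h: "h \<in> carrier Laurent"
  shows "(f \<otimes>\<^bsub>Laurent\<^esub> h) k = (\<Sum>i|f i \<noteq> 0. f i * (u powi i * h (k - i) * inverse (u powi i)))"
proof -
  have in_DS: "f i \<in> DS F" "h i \<in> DS F" for i
    using f h by (auto simp: carrier_Laurent)
  have "f i * (u powi i * h (k - i) * inverse (u powi i)) \<in> DS F" for i
    using unital_subring_DS[OF F] in_DS conj_pow_DS[OF in_DS(2)] by (auto simp: unital_subring_def)
  then have "(\<Sum>i|f i \<noteq> 0. f i * (u powi i * h (k - i) * inverse (u powi i))) =
      finsum (ring_on (DS F)) (\<lambda>i. f i * (u powi i * h (k - i) * inverse (u powi i))) {i. f i \<noteq> 0}"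
    using f by (intro finsum_ring_on[symmetric] unital_subring_DS F) (auto simp: carrier_Laurent)
  then show ?thesis
    by (simp add: skew_laurent_def auto_pow_conjugation[OF in_DS(2)])
qed

text \<open>Since \<sigma>^i(b) u^i = u^i b, the value of the product is a double sum over i and k;
  exchanging the sums and shifting k by i separates the two factors.\<close>

lemma laurent_eval_mult:
  assumes f: "f \<in> carrier Laurent" and h: "h \<in> carrier Laurent"
  shows "laurent_eval (f \<otimes>\<^bsub>Laurent\<^esub> h) = laurent_eval f * laurent_eval h"
proof -
  let ?I = "{i. f i \<noteq> 0}" and ?J = "{j. h j \<noteq> 0}"
  \<comment> \<open>A finite set that contains the support of the product, which may be smaller
    through cancellation.\<close>
  let ?K = "(\<lambda>(i, j). i + j) ` (?I \<times> ?J)"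
  have fin: "finite ?I" "finite ?J"
    using f h by (auto simp: carrier_Laurent)
  then have finK: "finite ?K"
    by blast
  have "(f \<otimes>\<^bsub>Laurent\<^esub> h) k = 0" if "k \<notin> ?K" for k
    unfolding mult_Laurent[OF f h]
  proof (rule sum.neutral, rule ballI)
    fix i assume "i \<in> ?I"
    then have "h (k - i) = 0"
      using that by (force intro!: image_eqI[of _ _ "(i, k - i)"])
    then show "f i * (u powi i * h (k - i) * inverse (u powi i)) = 0"
      by simp
  qed
  then have "laurent_eval (f \<otimes>\<^bsub>Laurent\<^esub> h) = (\<Sum>k\<in>?K. (f \<otimes>\<^bsub>Laurent\<^esub> h) k * u powi k)"
    by (intro laurent_eval_superset[OF finK]) blast
  also have "\<dots> = (\<Sum>k\<in>?K. \<Sum>i\<in>?I. f i * u powi i * (h (k - i) * u powi (k - i)))"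
  proof (rule sum.cong[OF refl])
    fix k
    have "inverse (u powi i) * u powi k = u powi (k - i)" for i
      using u(2) power_int_add[of u "- i" k] by (simp add: power_int_minus)
    then have "f i * (u powi i * h (k - i) * inverse (u powi i)) * u powi k =
        f i * u powi i * (h (k - i) * u powi (k - i))" for i
      by (simp add: mult.assoc)
    then show "(f \<otimes>\<^bsub>Laurent\<^esub> h) k * u powi k = (\<Sum>i\<in>?I. f i * u powi i * (h (k - i) * u powi (k - i)))"
      unfolding mult_Laurent[OF f h] sum_distrib_right by simp
  qed
  also have "\<dots> = (\<Sum>i\<in>?I. f i * u powi i * (\<Sum>k\<in>?K. h (k - i) * u powi (k - i)))"
    by (subst sum.swap) (simp add: sum_distrib_left)
  also have "\<dots> = (\<Sum>i\<in>?I. f i * u powi i * laurent_eval h)"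
  proof (intro sum.cong refl arg_cong[where f = "\<lambda>x. _ * x"])
    fix i assume i: "i \<in> ?I"
    have "(\<Sum>k\<in>?K. h (k - i) * u powi (k - i)) = (\<Sum>k\<in>(\<lambda>j. i + j) ` ?J. h (k - i) * u powi (k - i))"
    proof (rule sum.mono_neutral_right[OF finK])
      show "(+) i ` ?J \<subseteq> ?K"
        using i by force
      have "k \<in> (+) i ` ?J" if "h (k - i) \<noteq> 0" for k
        using that by (intro image_eqI[of _ _ "k - i"]) auto
      then show "\<forall>k\<in>?K - (+) i ` ?J. h (k - i) * u powi (k - i) = 0"
        by (metis DiffD2 mult_zero_left)
    qed
    also have "\<dots> = laurent_eval h"
      by (simp add: sum.reindex laurent_eval_def)
    finally show "(\<Sum>k\<in>?K. h (k - i) * u powi (k - i)) = laurent_eval h" .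
  qed
  finally show ?thesis
    by (simp add: sum_distrib_right laurent_eval_def[of f])
qed

lemma laurent_eval_iso: "laurent_eval \<in> ring_iso Laurent (ring_on (DS F'))"
proof (rule ring_iso_memI)
  have closed: "laurent_eval f \<in> DS F'" if "f \<in> carrier Laurent" for f
    unfolding laurent_eval_def using that laurent_term
    by (intro DS_sum[OF F'_carrier]) (auto simp: carrier_Laurent)
  then show "laurent_eval f \<in> carrier (ring_on (DS F'))" if "f \<in> carrier Laurent" for f
    using that by simp
  show "bij_betw laurent_eval (carrier Laurent) (carrier (ring_on (DS F')))"
    unfolding bij_betw_def
    using closed laurent_eval_surj by (auto intro!: inj_onI laurent_eval_inject)
  fix f h assume fh: "f \<in> carrier Laurent" "h \<in> carrier Laurent"
  then show "laurent_eval (f \<otimes>\<^bsub>Laurent\<^esub> h) = laurent_eval f \<otimes>\<^bsub>ring_on (DS F')\<^esub> laurent_eval h"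
    by (simp add: laurent_eval_mult)
  show "laurent_eval (f \<oplus>\<^bsub>Laurent\<^esub> h) = laurent_eval f \<oplus>\<^bsub>ring_on (DS F')\<^esub> laurent_eval h"
    using fh laurent_eval_add[of f h] by (simp add: carrier_Laurent) (simp add: skew_laurent_def)
next
  show "laurent_eval \<one>\<^bsub>Laurent\<^esub> = \<one>\<^bsub>ring_on (DS F')\<^esub>"
    using laurent_eval_monomial[of 0 1] by (simp add: skew_laurent_def cong: if_cong)
qed

text \<open>Evaluation fixes constants, so the old stage sits in the new one as a subset, as the
  inductive rule demands of its isomorphism.\<close>

lemma iterated_skew_laurent_adjoin:
  assumes "iterated_skew_laurent \<Gamma> n (ring_on (DS F))"
  shows "iterated_skew_laurent \<Gamma> (Suc n) (ring_on (DS F'))"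
proof (rule iterated_skew_laurent.step[OF assms conjugation_iso _ laurent_eval_iso])
  show "ring (ring_on (DS F'))"
    by (rule ring_ring_on[OF unital_subring_DS[OF sgF']])
  show "laurent_eval (laurent_const (ring_on (DS F)) b) = b" for b
    using laurent_eval_monomial[of 0 b] by (simp add: laurent_const_def cong: if_cong)
qed

end

end

section \<open>Finite generation from the chain condition on division subalgebras\<close>

locale graded_division_algebra =
  division_algebra scale + graded_division_ring W V
  for scale :: "'k::field \<Rightarrow> 'd::division_ring \<Rightarrow> 'd"
    and W :: "('w, 'm) monoid_scheme" (structure) and V :: "'w \<Rightarrow> 'd set" +
  assumes V_scale: "\<nu> \<in> carrier W \<Longrightarrow> x \<in> V \<nu> \<Longrightarrow> scale c x \<in> V \<nu>"
    and acc: "acc (division_subalgebra scale)"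
begin

lemma DS_scale:
  assumes "F \<subseteq> carrier W" "x \<in> DS F"
  shows "scale c x \<in> DS F"
  using assms
proof (induction x rule: DS_induct)
  case (add \<nu> v x)
  then show ?case
    using DS_add_homogeneous[OF assms(1), of \<nu> "scale c v"] V_scale[of \<nu> v c] assms(1)
    by (auto simp: scale_right_distrib)
qed (simp add: DS_0)

text \<open>Stated for finitely many generators because the Ore condition is so far available only
  there; \<open>is_quotient_Frac_DS\<close> lifts the restriction.\<close>

lemma is_quotient_Frac_DS_generate:
  assumes "finite Z" "Z \<subseteq> Ev"
  shows "is_quotient_division_algebra scale (DS (generate W Z)) (Frac (DS (generate W Z)))"
proof -
  have F: "subgroup (generate W Z) W"
    using assms(2) Ev_subset by (intro generate_is_subgroup) auto
  show ?thesis
    using DS_scale[OF subgroup.subset[OF F]] acc_DS_generate[OF _ assms]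
    by (intro is_quotient_division_algebra_Frac unital_subring_DS F)
      (auto intro: lside.side_axioms rside.side_axioms)
qed

lemma degree_in_if_Frac:
  assumes "F \<subseteq> carrier W" "subgroup F W" "\<nu> \<in> carrier W" "v \<in> V \<nu>" "v \<noteq> 0" "v \<in> Frac (DS F)"
  shows "\<nu> \<in> F"
proof -
  obtain \<mu> where \<mu>: "\<mu> \<in> F" "\<nu> \<otimes> \<mu> \<in> F"
    using homogeneous_fraction[OF assms(1,3-6)] by blast
  have "\<nu> = (\<nu> \<otimes> \<mu>) \<otimes> inv \<mu>"
    using assms(1,3) \<mu>(1) by (auto simp: m_assoc)
  also have "\<dots> \<in> F"
    by (rule subgroup.m_closed[OF assms(2) \<mu>(2) subgroup.m_inv_closed[OF assms(2) \<mu>(1)]])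
  finally show ?thesis .
qed

text \<open>If U lies in Y and both give the same fractions, a nonzero element of degree in Y is a
  fraction over \<open>DS U\<close>, so its degree is in U. Chains of finitely generated subgroups
  of \<open>F\<close> therefore map injectively to chains of division subalgebras.\<close>

theorem finitely_generated_subgroup:
  assumes F: "subgroup F W" "F \<subseteq> Ev"
  shows "\<exists>Z. finite Z \<and> Z \<subseteq> F \<and> generate W Z = F"
proof (rule finitely_generated_if_acc)
  show "acc (\<lambda>C. \<exists>Z. finite Z \<and> Z \<subseteq> F \<and> C = generate W Z)"
  proof (rule acc_injective_image[OF acc, where f = "\<lambda>C. Frac (DS C)"])
    fix U assume "\<exists>Z. finite Z \<and> Z \<subseteq> F \<and> U = generate W Z"
    then obtain Z where "finite Z" "Z \<subseteq> Ev" "U = generate W Z"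
      using F(2) by blast
    then show "division_subalgebra scale (Frac (DS U))"
      using is_quotient_Frac_DS_generate[of Z] unfolding is_quotient_division_algebra_def by blast
  next
    fix U Y :: "'w set"
    assume "U \<subseteq> Y"
    then show "Frac (DS U) \<subseteq> Frac (DS Y)"
      using DS_mono unfolding Frac_def by blast
  next
    fix U Y
    assume "\<exists>Z. finite Z \<and> Z \<subseteq> F \<and> U = generate W Z" "\<exists>Z. finite Z \<and> Z \<subseteq> F \<and> Y = generate W Z"
      and UY: "U \<subseteq> Y" "Frac (DS U) = Frac (DS Y)"
    then obtain Z Z' where Z: "finite Z" "Z \<subseteq> F" "U = generate W Z" "finite Z'" "Z' \<subseteq> F" "Y = generate W Z'"
      by blast
    then have U: "subgroup U W" "subgroup Y W"
      using F(2) Ev_subset by (auto intro!: generate_is_subgroup)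
    have "Y \<subseteq> F"
      using generate_subgroup_incl[OF Z(5) F(1)] Z(6) by simp
    have "\<nu> \<in> U" if \<nu>: "\<nu> \<in> Y" for \<nu>
    proof -
      have "\<nu> \<in> Ev"
        using \<nu> \<open>Y \<subseteq> F\<close> F(2) by blast
      then obtain v where v: "\<nu> \<in> carrier W" "v \<in> V \<nu>" "v \<noteq> 0"
        by (auto simp: Ev_def)
      have "v \<in> DS Y"
        using DS_homogeneous[OF subgroup.subset[OF U(2)] \<nu> v(2)] .
      then have "v \<in> Frac (DS Y)"
        using is_quotient_Frac_DS_generate[of Z'] Z(4-6) F(2)
        unfolding is_quotient_division_algebra_def by blast
      then show "\<nu> \<in> U"
        using degree_in_if_Frac[OF subgroup.subset[OF U(1)] U(1) v] UY(2) by simp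
    qed
    then show "U = Y"
      using UY(1) by blast
  qed
  show "generate W Z \<subseteq> F" if "Z \<subseteq> F" for Z
    using generate_subgroup_incl[OF that F(1)] .
qed (auto intro: generate.incl dest: mono_generate)

lemma acc_DS:
  assumes "side m" "subgroup F W" "F \<subseteq> Ev"
  shows "acc (side.ideal_in m (DS F))"
  using finitely_generated_subgroup[OF assms(2,3)] acc_DS_generate[OF assms(1)] assms(3) by blast

theorem nc_noetherian_domain_DS:
  assumes "subgroup F W" "F \<subseteq> Ev"
  shows "nc_noetherian_domain (ring_on (DS F))"
  by (intro nc_noetherian_domain_ring_on unital_subring_DS acc_DS assms lside.side_axioms rside.side_axioms)

theorem is_quotient_Frac_DS:
  assumes "subgroup F W" "F \<subseteq> Ev"
  shows "is_quotient_division_algebra scale (DS F) (Frac (DS F))"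
  using finitely_generated_subgroup[OF assms] is_quotient_Frac_DS_generate assms(2) by blast

theorem division_subalgebra_DS_finite:
  assumes T: "subgroup T W" "finite T"
  shows "division_subalgebra scale (DS T)"
  using unital_subring_DS[OF T(1)] inverse_in_DS_finite[OF T] DS_scale[OF subgroup.subset[OF T(1)]]
  by (intro division_subalgebraI) (auto simp: unital_subring_def)

end

section \<open>Eigenvalues of commuting derivations and automorphisms\<close>

lemma comm_group_product_group:
  assumes "\<And>i. i \<in> I \<Longrightarrow> comm_group (G i)"
  shows "comm_group (product_group I G)"
proof (rule group.group_comm_groupI)
  show "group (product_group I G)"
    using assms by (intro product_group) (auto intro: comm_group.axioms)
  fix x y assume "x \<in> carrier (product_group I G)" "y \<in> carrier (product_group I G)"
  then show "x \<otimes>\<^bsub>product_group I G\<^esub> y = y \<otimes>\<^bsub>product_group I G\<^esub> x"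
    using assms by (auto intro!: restrict_ext comm_monoid.m_comm comm_group.axioms(1) simp: PiE_iff)
qed

lemma comm_group_weight_group: "comm_group (weight_group kind t :: (nat \<Rightarrow> 'k::field) monoid)"
proof -
  have "comm_monoid (ring_of_type_algebra :: 'k ring)"
    using cring.axioms(2)[OF cring_from_type_algebra] .
  then show ?thesis
    unfolding weight_group_def using comm_group_add_monoid_type comm_monoid.units_comm_group
    by (intro comm_group_product_group) (auto split: delta_kind.split)
qed

lemma weight_mult:
  "i \<in> {1..t} \<Longrightarrow> (\<nu> \<otimes>\<^bsub>weight_group kind t\<^esub> \<mu>) i =
    (case kind of Derivations \<Rightarrow> \<nu> i + \<mu> i | Automorphisms \<Rightarrow> \<nu> i * \<mu> i)"
  by (cases kind) (auto simp: weight_group_def units_of_def)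

lemma weight_one:
  "i \<in> {1..t} \<Longrightarrow> \<one>\<^bsub>weight_group kind t\<^esub> i = (case kind of Derivations \<Rightarrow> 0 | Automorphisms \<Rightarrow> 1)"
  by (cases kind) (auto simp: weight_group_def units_of_def)

text \<open>Weights are extensional functions, so two different ones already differ at an index in
  {1..t}; independence of eigenspaces finds its separating operator there.\<close>

lemma weight_ext:
  assumes "\<nu> \<in> carrier (weight_group kind t)" "\<mu> \<in> carrier (weight_group kind t)"
    and "\<And>i. i \<in> {1..t} \<Longrightarrow> \<nu> i = \<mu> i"
  shows "\<nu> = \<mu>"
  using assms unfolding weight_group_def carrier_product_group by (rule PiE_ext)

locale delta_division_algebra = division_algebra scale
  for scale :: "'k::field \<Rightarrow> 'd::division_ring \<Rightarrow> 'd" +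
  fixes kind :: delta_kind and t :: nat and \<delta> :: "nat \<Rightarrow> 'd \<Rightarrow> 'd"
  assumes family: "commuting_family kind scale t \<delta>"
    and noetherian: "noetherian_self_tensor scale"
begin

abbreviation "W \<equiv> weight_group kind t :: (nat \<Rightarrow> 'k) monoid"
abbreviation "V \<equiv> eigenspace scale t \<delta> UNIV"

lemma delta_add: "i \<in> {1..t} \<Longrightarrow> \<delta> i (x + y) = \<delta> i x + \<delta> i y"
  and delta_scale: "i \<in> {1..t} \<Longrightarrow> \<delta> i (scale c x) = scale c (\<delta> i x)"
proof -
  have "Vector_Spaces.linear scale scale (\<delta> i)" if "i \<in> {1..t}"
    using family that
    by (cases kind) (auto simp: commuting_family_def algebra_derivation_def algebra_automorphism_def)
  then show "i \<in> {1..t} \<Longrightarrow> \<delta> i (x + y) = \<delta> i x + \<delta> i y"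
    "i \<in> {1..t} \<Longrightarrow> \<delta> i (scale c x) = scale c (\<delta> i x)"
    by (simp_all add: Vector_Spaces.linear_iff)
qed

lemma delta_derivation:
  "kind = Derivations \<Longrightarrow> i \<in> {1..t} \<Longrightarrow> \<delta> i (x * y) = \<delta> i x * y + x * \<delta> i y"
  using family by (auto simp: commuting_family_def algebra_derivation_def)

lemma delta_automorphism:
  "kind = Automorphisms \<Longrightarrow> i \<in> {1..t} \<Longrightarrow> \<delta> i (x * y) = \<delta> i x * \<delta> i y"
  "kind = Automorphisms \<Longrightarrow> i \<in> {1..t} \<Longrightarrow> \<delta> i 1 = 1"
  using family by (auto simp: commuting_family_def algebra_automorphism_def)

lemma delta_0: "i \<in> {1..t} \<Longrightarrow> \<delta> i 0 = 0"
  using delta_add[of i 0 0] by simp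

lemma delta_uminus: "i \<in> {1..t} \<Longrightarrow> \<delta> i (- x) = - \<delta> i x"
  using delta_add[of i x "- x"] delta_0[of i] by (metis add.right_inverse minus_unique)

lemma delta_sum: "i \<in> {1..t} \<Longrightarrow> \<delta> i (\<Sum>j\<in>S. f j) = (\<Sum>j\<in>S. \<delta> i (f j))"
  by (induction S rule: infinite_finite_induct) (auto simp: delta_0 delta_add)

lemma delta_inverse:
  assumes "i \<in> {1..t}" "x \<noteq> 0"
  shows "\<delta> i (inverse x) =
    (case kind of Derivations \<Rightarrow> - inverse x * \<delta> i x * inverse x | Automorphisms \<Rightarrow> inverse (\<delta> i x))"
proof (cases kind)
  case Derivations
  have "\<delta> i 1 = 0"
    using delta_derivation[OF Derivations assms(1), of 1 1] by simp
  moreover have "\<delta> i (x * inverse x) = \<delta> i x * inverse x + x * \<delta> i (inverse x)"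
    by (rule delta_derivation[OF Derivations assms(1)])
  ultimately have "x * \<delta> i (inverse x) = - (\<delta> i x * inverse x)"
    using assms(2) by (simp add: eq_neg_iff_add_eq_0 add.commute)
  then have "inverse x * (x * \<delta> i (inverse x)) = - (inverse x * \<delta> i x * inverse x)"
    by (simp add: mult.assoc)
  then show ?thesis
    using assms(2) Derivations by (simp flip: mult.assoc)
next
  case Automorphisms
  have "\<delta> i x * \<delta> i (inverse x) = 1"
    using delta_automorphism[OF Automorphisms assms(1)] assms(2) by (metis right_inverse)
  then show ?thesis
    using Automorphisms inverse_unique by fastforce
qed

lemma V_iff: "x \<in> V \<nu> \<longleftrightarrow> (\<forall>i\<in>{1..t}. \<delta> i x = scale (\<nu> i) x)"
  by (simp add: eigenspace_def)

lemma eigenspace_mult: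
  assumes "x \<in> V \<nu>" "y \<in> V \<mu>"
  shows "x * y \<in> V (\<nu> \<otimes>\<^bsub>W\<^esub> \<mu>)"
proof -
  have "\<delta> i (x * y) = scale ((\<nu> \<otimes>\<^bsub>W\<^esub> \<mu>) i) (x * y)" if i: "i \<in> {1..t}" for i
  proof -
    have xy: "\<delta> i x = scale (\<nu> i) x" "\<delta> i y = scale (\<mu> i) y"
      using assms i by (auto simp: V_iff)
    show ?thesis
    proof (cases kind)
      case Derivations
      then show ?thesis
        using xy by (simp add: delta_derivation[OF Derivations i] weight_mult[OF i] scale_left_distrib
            flip: scale_mult_left scale_mult_right)
    next
      case Automorphisms
      then show ?thesis
        using xy by (simp add: delta_automorphism(1)[OF Automorphisms i] weight_mult[OF i]
            flip: scale_mult_left scale_mult_right)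
    qed
  qed
  then show ?thesis
    by (simp add: V_iff)
qed

lemma eigenspace_one: "1 \<in> V \<one>\<^bsub>W\<^esub>"
proof -
  have "\<delta> i 1 = scale (\<one>\<^bsub>W\<^esub> i) 1" if i: "i \<in> {1..t}" for i
    using delta_derivation[OF _ i, of 1 1] delta_automorphism(2)[OF _ i]
    by (cases kind) (auto simp: weight_one[OF i])
  then show ?thesis
    by (simp add: V_iff)
qed

lemma eigenspace_inverse:
  assumes \<nu>: "\<nu> \<in> carrier W" and x: "x \<in> V \<nu>"
  shows "inverse x \<in> V (inv\<^bsub>W\<^esub> \<nu>)"
proof (cases "x = 0")
  case True
  then show ?thesis
    by (simp add: V_iff delta_0)
next
  case False
  interpret W: comm_group W
    by (rule comm_group_weight_group)
  have "\<delta> i (inverse x) = scale ((inv\<^bsub>W\<^esub> \<nu>) i) (inverse x)" if i: "i \<in> {1..t}" for i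
  proof -
    have \<delta>x: "\<delta> i x = scale (\<nu> i) x"
      using x i by (simp add: V_iff)
    have inv: "(\<nu> \<otimes>\<^bsub>W\<^esub> inv\<^bsub>W\<^esub> \<nu>) i = \<one>\<^bsub>W\<^esub> i"
      using W.r_inv[OF \<nu>] by simp
    show ?thesis
    proof (cases kind)
      case Derivations
      then have "(inv\<^bsub>W\<^esub> \<nu>) i = - \<nu> i"
        using inv by (simp add: weight_mult[OF i] weight_one[OF i] minus_unique)
      then show ?thesis
        using Derivations False
        by (simp add: delta_inverse[OF i False] \<delta>x flip: scale_mult_left scale_mult_right)
    next
      case Automorphisms
      then have "(inv\<^bsub>W\<^esub> \<nu>) i * \<nu> i = 1"
        using inv by (simp add: weight_mult[OF i] weight_one[OF i] mult.commute)
      then have "scale (\<nu> i) x * scale ((inv\<^bsub>W\<^esub> \<nu>) i) (inverse x) = 1"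
        using False by (simp flip: scale_mult_left scale_mult_right)
      then have "inverse (scale (\<nu> i) x) = scale ((inv\<^bsub>W\<^esub> \<nu>) i) (inverse x)"
        by (rule inverse_unique)
      then show ?thesis
        using Automorphisms by (simp add: delta_inverse[OF i False] \<delta>x)
    qed
  qed
  then show ?thesis
    by (simp add: V_iff)
qed

text \<open>Applying \<delta> i minus the scalar \<mu> i to a relation removes the summand at \<mu>
  and multiplies the one at \<nu> by \<nu> i - \<mu> i. By induction the rescaled summands vanish
  for every i, and some i has \<nu> i different from \<mu> i.\<close>

lemma eigenspaces_independent:
  assumes "finite S" "S \<subseteq> carrier W" "\<And>\<nu>. \<nu> \<in> S \<Longrightarrow> u \<nu> \<in> V \<nu>" "(\<Sum>\<nu>\<in>S. u \<nu>) = 0"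
  shows "\<forall>\<nu>\<in>S. u \<nu> = 0"
  using assms
proof (induction S arbitrary: u rule: finite_induct)
  case (insert \<mu> S)
  have zero: "scale (\<nu> i - \<mu> i) (u \<nu>) = 0" if i: "i \<in> {1..t}" and \<nu>: "\<nu> \<in> S" for i \<nu>
  proof -
    let ?u = "\<lambda>\<nu>. scale (\<nu> i - \<mu> i) (u \<nu>)"
    have "(\<Sum>\<nu>\<in>insert \<mu> S. \<delta> i (u \<nu>) - scale (\<mu> i) (u \<nu>)) =
        \<delta> i (\<Sum>\<nu>\<in>insert \<mu> S. u \<nu>) - scale (\<mu> i) (\<Sum>\<nu>\<in>insert \<mu> S. u \<nu>)"
      by (simp only: sum_subtractf delta_sum[OF i] scale_sum_right)
    also have "\<dots> = \<delta> i 0 - scale (\<mu> i) 0"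
      by (simp only: insert(6))
    finally have "(\<Sum>\<nu>\<in>insert \<mu> S. \<delta> i (u \<nu>) - scale (\<mu> i) (u \<nu>)) = \<delta> i 0 - scale (\<mu> i) 0" .
    moreover have "\<delta> i (u \<nu>) - scale (\<mu> i) (u \<nu>) = ?u \<nu>" if "\<nu> \<in> insert \<mu> S" for \<nu>
      using insert(5)[OF that] i by (simp add: V_iff scale_left_diff_distrib)
    ultimately have "(\<Sum>\<nu>\<in>insert \<mu> S. ?u \<nu>) = 0"
      using i by (simp add: delta_0)
    then have "(\<Sum>\<nu>\<in>S. ?u \<nu>) = 0"
      using insert(1,2) by simp
    moreover have "?u \<nu> \<in> V \<nu>" if "\<nu> \<in> S" for \<nu>
      using insert(5)[of \<nu>] that by (auto simp: V_iff delta_scale scale_left_commute)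
    ultimately show ?thesis
      using insert.IH[of ?u] insert(4) \<nu> by auto
  qed
  have S: "u \<nu> = 0" if \<nu>: "\<nu> \<in> S" for \<nu>
  proof -
    have "\<nu> \<in> carrier W" "\<mu> \<in> carrier W" "\<nu> \<noteq> \<mu>"
      using insert(2,4) \<nu> by auto
    then obtain i where "i \<in> {1..t}" "\<nu> i \<noteq> \<mu> i"
      using weight_ext by blast
    then show ?thesis
      using zero[OF _ \<nu>, of i] by simp
  qed
  then show ?case
    using insert(1,2,6) by simp
qed simp

text \<open>The two kinds of \<Delta> become one grading here, and the tensor hypothesis enters as
  the chain condition on division subalgebras.\<close>

sublocale graded_division_algebra scale W V
proof (intro graded_division_algebra.intro graded_division_ring.intro
    graded_division_ring_axioms.intro graded_division_algebra_axioms.intro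
    comm_group_weight_group division_algebra_axioms)
  show "1 \<in> V \<one>\<^bsub>W\<^esub>"
    by (rule eigenspace_one)
  show "acc (division_subalgebra scale)"
    by (rule acc_division_subalgebras[OF noetherian])
  show "finite S \<Longrightarrow> S \<subseteq> carrier W \<Longrightarrow> (\<And>\<nu>. \<nu> \<in> S \<Longrightarrow> u \<nu> \<in> V \<nu>) \<Longrightarrow>
      (\<Sum>\<nu>\<in>S. u \<nu>) = 0 \<Longrightarrow> \<nu> \<in> S \<Longrightarrow> u \<nu> = 0" for S u \<nu>
    using eigenspaces_independent by blast
qed (auto simp: V_iff delta_0 delta_add delta_uminus delta_scale scale_right_distrib scale_left_commute
    intro: eigenspace_mult[unfolded V_iff, rule_format] eigenspace_inverse[unfolded V_iff, rule_format])

lemma Ev_eq: "eigenvalues kind scale t \<delta> UNIV = Ev"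
  by (simp add: eigenvalues_def Ev_def)

lemma eigen_sum_eq: "eigen_sum scale t \<delta> F = DS F"
  by (simp add: eigen_sum_def DS_def)

abbreviation "G \<equiv> W\<lparr>carrier := Ev\<rparr>"

lemma eigenvalue_group_eq: "eigenvalue_group kind scale t \<delta> = G"
  by (simp add: eigenvalue_group_def Ev_eq)

lemma comm_group_G: "comm_group G"
  using subgroup.subgroup_is_group[OF subgroup_Ev group_axioms] Ev_subset
  by (intro group.group_comm_groupI) (auto simp: m_comm subset_iff)

lemma subgroup_G_iff: "subgroup F G \<longleftrightarrow> subgroup F W \<and> F \<subseteq> Ev"
  using incl_subgroup[OF subgroup_Ev] subgroup_incl[OF _ subgroup_Ev] subgroup.subset[of F G] by auto

lemma finitely_generated_group_G: "finitely_generated_group G"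
  using finitely_generated_subgroup[OF subgroup_Ev] generate_consistent[OF _ subgroup_Ev]
  by (auto simp: finitely_generated_group_def)

abbreviation "T \<equiv> torsion_part G"

lemma subgroup_T: "subgroup T G" "subgroup T W" "T \<subseteq> Ev"
  using comm_group.subgroup_torsion_part[OF comm_group_G] subgroup_G_iff by auto

text \<open>The torsion part is itself a subgroup of \<open>Ev\<close>, hence finitely generated by
  the same theorem, and finitely many torsion elements generate a finite abelian group.\<close>

lemma finite_T: "finite T"
proof -
  obtain Z where Z: "finite Z" "Z \<subseteq> T" "generate W Z = T"
    using finitely_generated_subgroup[OF subgroup_T(2,3)] by blast
  have "finite (generate G Z)"
    by (rule comm_group.finite_generate_torsion[OF comm_group_G Z(1,2)])
  moreover have "generate G Z = generate W Z"
    using Z(2) subgroup_T(3) by (intro generate_consistent subgroup_Ev) auto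
  ultimately show ?thesis
    using Z(3) by simp
qed

text \<open>\<open>H n\<close> joins the first n basis weights to the torsion part; each step
  adjoins an eigenvector whose weight has infinite order modulo the step before.\<close>

lemma iterated_skew_laurent_DS:
  assumes "basis_modulo_torsion G {1..r} x"
  shows "iterated_skew_laurent (ring_on (DS T)) r (ring_on (DS Ev))"
proof -
  interpret G: basis_modulo_torsion G "{1..r}" x
    by fact
  define H where "H = (\<lambda>n. G.torsion_plus {1..n})"
  have H: "subgroup (H n) W" "H n \<subseteq> Ev" if "n \<le> r" for n
    using G.subgroup_torsion_plus[of "{1..n}"] that subgroup_G_iff by (auto simp: H_def)
  have "iterated_skew_laurent (ring_on (DS T)) n (ring_on (DS (H n)))" if "n \<le> r" for n
    using that
  proof (induction n)
    case 0
    have "H 0 = T"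
      using G.torsion_plus_empty by (simp add: H_def)
    then show ?case
      by (simp add: iterated_skew_laurent.base)
  next
    case (Suc n)
    have n: "{1..Suc n} = insert (Suc n) {1..n}" "insert (Suc n) {1..n} \<subseteq> {1..r}" "Suc n \<notin> {1..n}"
      using Suc.prems by auto
    have g: "x (Suc n) \<in> Ev"
      using G.x_closed Suc.prems by auto
    then obtain u where u: "u \<in> V (x (Suc n))" "u \<noteq> 0"
      by (auto simp: Ev_def)
    \<comment> \<open>The basis lives in \<open>G\<close> and the ring construction in
      \<open>W\<close>; powers agree because \<open>G\<close> only restricts the carrier.\<close>
    have pow: "x (Suc n) [^]\<^bsub>G\<^esub> k = x (Suc n) [^]\<^bsub>W\<^esub> k" for k :: int
      using int_pow_consistent[OF subgroup_Ev g] by simp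
    show ?case
    proof (rule iterated_skew_laurent_adjoin)
      show "subgroup (H n) W" "subgroup (H (Suc n)) W"
        using H Suc.prems by auto
      show "H (Suc n) = {h \<otimes>\<^bsub>W\<^esub> x (Suc n) [^]\<^bsub>W\<^esub> k | h k. h \<in> H n \<and> k \<in> (UNIV :: int set)}"
        using G.torsion_plus_insert[OF n(2,3)] unfolding H_def n(1) pow by simp
      show "x (Suc n) \<in> carrier W"
        using g Ev_subset by blast
      show "k = 0" if "x (Suc n) [^]\<^bsub>W\<^esub> k \<in> H n" for k :: int
        using G.pow_in_torsion_plus[OF n(2,3), of k] that unfolding H_def pow by simp
      show "iterated_skew_laurent (ring_on (DS T)) n (ring_on (DS (H n)))"
        using Suc by simp
    qed (rule u)+
  qed
  moreover have "H r = Ev"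
    using G.torsion_plus_full by (simp add: H_def)
  ultimately show ?thesis
    by (metis order_refl)
qed

section \<open>Action of \<Delta> on the quotient division algebras\<close>

lemma delta_DS:
  assumes F: "F \<subseteq> carrier W" and i: "i \<in> {1..t}" and x: "x \<in> DS F"
  shows "\<delta> i x \<in> DS F"
  using F x
proof (induction x rule: DS_induct)
  case (add \<nu> v x)
  have "\<delta> i v = scale (\<nu> i) v"
    using add(2) i by (simp add: V_iff)
  then have "\<delta> i v \<in> V \<nu>"
    using V_scale[of \<nu> v] add(1,2) F by auto
  then show ?case
    using DS_add_homogeneous[OF F add(1)] add(4) by (simp add: delta_add[OF i])
qed (simp add: delta_0[OF i] DS_0)

text \<open>The rules for products and inverses express the image of a fraction by s, a and their
  images, all of which lie in the division algebra of fractions.\<close>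

lemma delta_Frac:
  assumes F: "subgroup F W" "F \<subseteq> Ev" and i: "i \<in> {1..t}"
  shows "\<delta> i ` Frac (DS F) \<subseteq> Frac (DS F)"
proof
  fix z assume "z \<in> \<delta> i ` Frac (DS F)"
  then obtain s a where sa: "s \<in> DS F" "s \<noteq> 0" "a \<in> DS F" "z = \<delta> i (inverse s * a)"
    by (auto simp: Frac_def)
  have Q: "division_subalgebra scale (Frac (DS F))" and sub: "DS F \<subseteq> Frac (DS F)"
    using is_quotient_Frac_DS[OF F] unfolding is_quotient_division_algebra_def by blast+
  note closed = division_subalgebraD[OF Q]
  have in_Frac: "s \<in> Frac (DS F)" "a \<in> Frac (DS F)" "\<delta> i s \<in> Frac (DS F)" "\<delta> i a \<in> Frac (DS F)"
    using sub sa delta_DS[OF subgroup.subset[OF F(1)] i] by auto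
  show "z \<in> Frac (DS F)"
  proof (cases kind)
    case Derivations
    then show ?thesis
      unfolding sa(4) delta_derivation[OF Derivations i] delta_inverse[OF i sa(2)]
      using in_Frac by (simp only: delta_kind.case) (intro closed in_Frac)
  next
    case Automorphisms
    then show ?thesis
      unfolding sa(4) delta_automorphism(1)[OF Automorphisms i] delta_inverse[OF i sa(2)]
      using in_Frac by (simp only: delta_kind.case) (intro closed in_Frac)
  qed
qed

lemma eigenvector_in_Frac:
  assumes F: "subgroup F W" "F \<subseteq> Ev" and \<nu>: "\<nu> \<in> carrier W"
    and v: "v \<in> eigenspace scale t \<delta> (Frac (DS F)) \<nu>" "v \<noteq> 0"
  shows "\<nu> \<in> F \<and> (\<exists>\<mu>\<in>F. \<exists>u\<in>V \<mu>. \<exists>w\<in>V (\<nu> \<otimes>\<^bsub>W\<^esub> \<mu>). u \<noteq> 0 \<and> v = inverse u * w)"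
proof -
  have v': "v \<in> V \<nu>" "v \<in> Frac (DS F)"
    using v(1) by (auto simp: eigenspace_def)
  note sub = subgroup.subset[OF F(1)]
  obtain \<mu> u where "\<mu> \<in> F" "u \<in> V \<mu>" "u \<noteq> 0" "u * v \<in> V (\<nu> \<otimes>\<^bsub>W\<^esub> \<mu>)" "v = inverse u * (u * v)"
    using homogeneous_fraction[OF sub \<nu> v'(1) v(2) v'(2)] by metis
  then show ?thesis
    using degree_in_if_Frac[OF sub F(1) \<nu> v'(1) v(2) v'(2)] by blast
qed

lemma eigenvalues_Frac:
  assumes F: "subgroup F W" "F \<subseteq> Ev"
  shows "eigenvalues kind scale t \<delta> (Frac (DS F)) = F"
proof
  show "eigenvalues kind scale t \<delta> (Frac (DS F)) \<subseteq> F"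
    using eigenvector_in_Frac[OF F] by (auto simp: eigenvalues_def)
  show "F \<subseteq> eigenvalues kind scale t \<delta> (Frac (DS F))"
  proof
    fix \<nu> assume \<nu>: "\<nu> \<in> F"
    then obtain u where u: "\<nu> \<in> carrier W" "u \<in> V \<nu>" "u \<noteq> 0"
      using F(2) by (auto simp: Ev_def)
    have "u \<in> DS F"
      using DS_homogeneous[OF subgroup.subset[OF F(1)] \<nu> u(2)] .
    then have "u \<in> Frac (DS F)"
      using is_quotient_Frac_DS[OF F] unfolding is_quotient_division_algebra_def by blast
    then show "\<nu> \<in> eigenvalues kind scale t \<delta> (Frac (DS F))"
      using u by (auto simp: eigenvalues_def eigenspace_def)
  qed
qed

text \<open>The constants are the case of the trivial group of weights.\<close>

lemma division_subalgebra_V_one: "division_subalgebra scale (V \<one>\<^bsub>W\<^esub>)"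
  using division_subalgebra_DS_finite[OF triv_subgroup] DS_trivial by simp

lemma independent_eigenspaces_Ev: "independent_eigenspaces scale t \<delta> Ev"
  unfolding independent_eigenspaces_def using eigenspaces_independent Ev_subset by blast

end

theorem theorem1p1:
  fixes scale :: "'k::field \<Rightarrow> 'd::division_ring \<Rightarrow> 'd"
    and kind :: delta_kind
    and t :: nat
    and \<delta> :: "nat \<Rightarrow> 'd \<Rightarrow> 'd"
  assumes "division_algebra scale"
    and "noetherian_self_tensor scale"
    and "commuting_family kind scale t \<delta>"
  shows "let W = (weight_group kind t :: (nat \<Rightarrow> 'k) monoid);
             G = eigenvalue_group kind scale t \<delta>;
             Ev = eigenvalues kind scale t \<delta>;
             V = eigenspace scale t \<delta> UNIV;
             DS = eigen_sum scale t \<delta>;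
             T = torsion_part G
         in
           acc (division_subalgebra scale) \<and>
           (\<forall>E. division_subalgebra scale E \<longrightarrow> fin_gen_division_algebra scale E) \<and>
           subgroup (Ev UNIV) W \<and> comm_group G \<and> finitely_generated_group G \<and>
           subgroup T G \<and> finite T \<and>
           independent_eigenspaces scale t \<delta> (Ev UNIV) \<and>
           nc_noetherian_domain (ring_on (DS (Ev UNIV))) \<and>
           division_subalgebra scale (V \<one>\<^bsub>W\<^esub>) \<and>
           division_subalgebra scale (DS T) \<and>
           has_dimension (add_monoid (ring_on (DS T))) (V \<one>\<^bsub>W\<^esub>) (\<lambda>a v. a * v) (card T) \<and>
           has_dimension (add_monoid (ring_on (DS T))) (V \<one>\<^bsub>W\<^esub>) (\<lambda>a v. v * a) (card T) \<and>
           (\<exists>r. has_rank G r \<and>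
              G \<cong> (G\<lparr>carrier := T\<rparr> \<times>\<times> product_group {1..r} (\<lambda>_. integer_group)) \<and>
              iterated_skew_laurent (ring_on (DS T)) r (ring_on (DS (Ev UNIV)))) \<and>
           (\<forall>F. subgroup F G \<longrightarrow>
              nc_noetherian_domain (ring_on (DS F)) \<and>
              is_quotient_division_algebra scale (DS F) (Frac (DS F)) \<and>
              (\<forall>i\<in>{1..t}. \<delta> i ` Frac (DS F) \<subseteq> Frac (DS F)) \<and>
              Ev (Frac (DS F)) = F \<and>
              (\<forall>\<nu>\<in>carrier W. \<forall>v\<in>eigenspace scale t \<delta> (Frac (DS F)) \<nu>. v \<noteq> 0 \<longrightarrow>
                 \<nu> \<in> F \<and>
                 (\<exists>\<mu>\<in>F. \<exists>u\<in>V \<mu>. \<exists>w\<in>V (\<nu> \<otimes>\<^bsub>W\<^esub> \<mu>). u \<noteq> 0 \<and> v = inverse u * w)))"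
proof -
  interpret delta_division_algebra scale kind t \<delta>
    using assms by (intro delta_division_algebra.intro delta_division_algebra_axioms.intro)
  \<comment> \<open>One basis serves for the rank, the splitting and the tower, so the same r occurs
    in all three.\<close>
  obtain r x where basis: "basis_modulo_torsion G {1..r} x"
    using comm_group.ex_basis_modulo_torsion[OF comm_group_G finitely_generated_group_G] comm_group_G
    by (metis basis_modulo_torsion.intro basis_modulo_torsion_axioms.intro finite_atLeastAtMost)
  then interpret G: basis_modulo_torsion G "{1..r}" x .
  have "has_rank G r"
    using G.has_rank_basis by simp
  moreover have "G \<cong> (G\<lparr>carrier := T\<rparr> \<times>\<times> product_group {1..r} (\<lambda>_. integer_group))"
    by (rule G.iso_torsion_times_free)
  moreover have "iterated_skew_laurent (ring_on (DS T)) r (ring_on (DS Ev))"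
    by (rule iterated_skew_laurent_DS[OF basis])
  ultimately have rank: "\<exists>r. has_rank G r \<and>
      G \<cong> (G\<lparr>carrier := T\<rparr> \<times>\<times> product_group {1..r} (\<lambda>_. integer_group)) \<and>
      iterated_skew_laurent (ring_on (DS T)) r (ring_on (DS Ev))"
    by blast
  show ?thesis
    unfolding Let_def eigenvalue_group_eq Ev_eq eigen_sum_eq
  proof (intro conjI allI impI)
    fix F assume "subgroup F G"
    then have F: "subgroup F W" "F \<subseteq> Ev"
      by (simp_all add: subgroup_G_iff)
    show "nc_noetherian_domain (ring_on (DS F))"
      by (rule nc_noetherian_domain_DS[OF F])
    show "is_quotient_division_algebra scale (DS F) (Frac (DS F))"
      by (rule is_quotient_Frac_DS[OF F])
    show "\<forall>i\<in>{1..t}. \<delta> i ` Frac (DS F) \<subseteq> Frac (DS F)"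
      using delta_Frac[OF F] by blast
    show "eigenvalues kind scale t \<delta> (Frac (DS F)) = F"
      by (rule eigenvalues_Frac[OF F])
    show "\<forall>\<nu>\<in>carrier W. \<forall>v\<in>eigenspace scale t \<delta> (Frac (DS F)) \<nu>. v \<noteq> 0 \<longrightarrow>
        \<nu> \<in> F \<and> (\<exists>\<mu>\<in>F. \<exists>u\<in>V \<mu>. \<exists>w\<in>V (\<nu> \<otimes>\<^bsub>W\<^esub> \<mu>). u \<noteq> 0 \<and> v = inverse u * w)"
      using eigenvector_in_Frac[OF F] by blast
  qed (fact acc subgroup_Ev comm_group_G finitely_generated_group_G subgroup_T(1) finite_T
      independent_eigenspaces_Ev nc_noetherian_domain_DS[OF subgroup_Ev order_refl]
      fin_gen_division_subalgebra[OF acc] division_subalgebra_V_one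
      division_subalgebra_DS_finite[OF subgroup_T(2) finite_T]
      has_dimension_DS[OF lside.side_axioms subgroup_T(2,3) finite_T]
      has_dimension_DS[OF rside.side_axioms subgroup_T(2,3) finite_T] rank)+
qed

end
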